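(* Let $n\ge 3$ and consider the renewal risk model with $n$-order phase-type interclaim times and exponential claim sizes described in the context, with optimal value functions $V_i$ and iterates $V_i^{(k)}$ defined there. Then for every $i\in\{1,\dots,n\}$, $V_i^{(k)}\to V_i$ pointwise on $[0,\infty)$ as $k\to\infty$.
   Context: **Model.** Fix $n\ge 3$, $c>0$, $\beta>0$, $\delta>0$, and $\pi_1,\dots,\pi_n\ge0$ with $\sum_{i=1}^n\pi_i=1$. For $i\in\{1,\dots,n\}$ and $j\in\{1,\dots,n+1\}$, $j\ne i$, let $\lambda_{ij}\ge 0$ be transition intensities, and put $\lambda_i=\sum_{j=1,j\ne i}^{n+1}\lambda_{ij}>0$. A continuous-time Markov process $\bar J$ on $\{1,\dots,n+1\}$ has these intensities; $n+1$ is absorbing and all states $1,\dots,n$ (the phases) are transient. The observed phase process $J$ moves like $\bar J$ on $\{1,\dots,n\}$; each time $n+1$ is entered a claim occurs and the process immediately restarts in phase $i$ with probability $\pi_i$, independently of the past. $N_t$ is the number of claims up to time $t$. Claim sizes $Y_1,Y_2,\dots$ are i.i.d. with distribution function $1-e^{-\beta y}$, $y\ge 0$, and independent of $J$. With cumulative dividends $D_t$ and initial capital $x\ge 0$ the surplus is $X_t^D=x+ct-\sum_{k=1}^{N_t}Y_k-D_t$, with ruin time $\tau=\inf\{t: X_t^D<0\}$. **Admissible strategies and value function.** A dividend strategy $D$ is admissible ($D\in\mathscr U_{ad}$) if $D$ is nondecreasing, left-continuous with right limits, $D_0=0$, predictable with respect to the (completed) filtration of the observed claims and phases, and $D_t\le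 x+ct-\sum_{k=1}^{N_t}Y_k$ for all $t<\tau$. Put $$V_i^D(x)=\mathbb E\Big[\int_{0-}^{\tau-}e^{-\delta t}\,\mathrm dD_t\,\Big|\,J_0=i,\ X_{0-}^D=x\Big],\qquad V_i(x)=\sup_{D\in\mathscr U_{ad}}V_i^D(x),\quad x\ge 0,$$ where the integral includes the lump sum $D_{0+}-D_0$ and excludes any payment at or after $\tau$. **Iterates.** Let $\tau_1=\inf\{t\ge 0:\bar J_t\ne J_0\}$ be the time of the first jump of the phase process (entrance into $n+1$, i.e. a claim, counts as a jump). Set $V_i^{(0)}\equiv 0$ for $i=1,\dots,n+1$. For $k\ge 1$, $x\ge0$ and $i=1,\dots,n$, $$V_i^{(k)}(x)=\sup_{D\in\mathscr{U}_{ad}}\mathbb{E}\Big[\int_{0-}^{\tau_1-} e^{-\delta t}\,\mathrm{d}D_t +e^{-\delta\tau_1}V_{\bar{J}_{\tau_1}}^{(k-1)}(X^D_{\tau_1}) \,\Big|\,J_0=i,\ X^D_{0-}=x\Big],$$ $$V_{n+1}^{(k)}(x)=\beta e^{-\beta x}\int_0^xe^{\beta y}\Big(\sum_{i=1}^n\pi_iV_i^{(k)}(y)\Big)\mathrm{d}y .$$ Here $X^D_{\tau_1}$ denotes $x+c\tau_1-D_{\tau_1}$, the surplus before deducting any claim occurring at $\tau_1$ (the claim and the restart are accounted for by $V_{n+1}^{(k-1)}$).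
   Formalization: The admissibility bound D_t ≤ x+ct−ΣY_k is a tautology for t<τ and would make the iterates infinite; it is imposed instead for all t before the first claim time at which the surplus is negative, so dividends cannot cause ruin. *)

theory Defs
  imports "HOL-Probability.Probability"
begin

section \<open>Renewal risk model with phase-type interclaim times\<close>

text \<open>
  The phases are \<open>1, \<dots>, n\<close> and \<open>n + 1\<close> is the absorbing state whose entrance triggers a claim.
  The phase process is given by its jump chain and holding times.
  \<open>sojourn k\<close> is the time spent between the \<open>k\<close>-th and the \<open>(k+1)\<close>-st jump,
  \<open>target k\<close> (\<open>k \<ge> 1\<close>) is the state in \<open>{1..n+1}\<close> entered at the \<open>k\<close>-th jump, and
  \<open>phase k\<close> is the phase occupied right after the \<open>k\<close>-th jump. The latter differs from the target
  only if the target is \<open>n + 1\<close>, in which case it is the phase of the immediate restart.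
  \<open>claim k\<close> (\<open>k \<ge> 1\<close>) is the size of the \<open>k\<close>-th claim.
  \<open>law i\<close> is the probability measure conditional on \<open>J\<^sub>0 = i\<close>: a Markov family is used because
  \<open>J\<^sub>0\<close> has no prescribed distribution.
\<close>

record 'a risk_model =
  num_phases :: nat
  premium :: real
  claim_rate :: real
  discount :: real
  restart :: "nat \<Rightarrow> real"
  intensity :: "nat \<Rightarrow> nat \<Rightarrow> real"
  law :: "nat \<Rightarrow> 'a measure"
  sojourn :: "nat \<Rightarrow> 'a \<Rightarrow> real"
  target :: "nat \<Rightarrow> 'a \<Rightarrow> nat"
  phase :: "nat \<Rightarrow> 'a \<Rightarrow> nat"
  claim :: "nat \<Rightarrow> 'a \<Rightarrow> real"

definition total_intensity :: "'a risk_model \<Rightarrow> nat \<Rightarrow> real" where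
  "total_intensity R i = (\<Sum>j\<in>{1..num_phases R + 1} - {i}. intensity R i j)"

definition valid_parameters :: "'a risk_model \<Rightarrow> bool" where
  "valid_parameters R \<longleftrightarrow>
     premium R > 0 \<and> claim_rate R > 0 \<and> discount R > 0 \<and>
     (\<forall>i\<in>{1..num_phases R}. restart R i \<ge> 0) \<and>
     (\<Sum>i\<in>{1..num_phases R}. restart R i) = 1 \<and>
     (\<forall>i\<in>{1..num_phases R}. \<forall>j\<in>{1..num_phases R + 1} - {i}. intensity R i j \<ge> 0) \<and>
     (\<forall>i\<in>{1..num_phases R}. total_intensity R i > 0)"


subsection \<open>Phase process, claim counting process and aggregate claims\<close>

definition jump_time :: "'a risk_model \<Rightarrow> nat \<Rightarrow> 'a \<Rightarrow> real" where
  "jump_time R k \<omega> = (\<Sum>l<k. sojourn R l \<omega>)"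

definition num_jumps :: "'a risk_model \<Rightarrow> real \<Rightarrow> 'a \<Rightarrow> nat" where
  "num_jumps R t \<omega> = card {k. 1 \<le> k \<and> jump_time R k \<omega> \<le> t}"

definition phase_process :: "'a risk_model \<Rightarrow> real \<Rightarrow> 'a \<Rightarrow> nat" where
  "phase_process R t \<omega> = phase R (num_jumps R t \<omega>) \<omega>"

definition num_claims :: "'a risk_model \<Rightarrow> real \<Rightarrow> 'a \<Rightarrow> nat" where
  "num_claims R t \<omega> =
     card {k. 1 \<le> k \<and> jump_time R k \<omega> \<le> t \<and> target R k \<omega> = num_phases R + 1}"

text \<open>The process \<open>J\<close>-bar with absorption instead of restart.\<close>

definition absorbed_process :: "'a risk_model \<Rightarrow> real \<Rightarrow> 'a \<Rightarrow> nat" where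
  "absorbed_process R t \<omega> =
     (if num_claims R t \<omega> = 0 then phase_process R t \<omega> else num_phases R + 1)"

definition claim_times :: "'a risk_model \<Rightarrow> 'a \<Rightarrow> real set" where
  "claim_times R \<omega> =
     {jump_time R k \<omega> |k. 1 \<le> k \<and> target R k \<omega> = num_phases R + 1}"

definition aggregate_claims :: "'a risk_model \<Rightarrow> real \<Rightarrow> 'a \<Rightarrow> real" where
  "aggregate_claims R t \<omega> = (\<Sum>k = 1..num_claims R t \<omega>. claim R k \<omega>)"


subsection \<open>Law of the model\<close>

definition jump_prob :: "'a risk_model \<Rightarrow> nat \<Rightarrow> nat \<Rightarrow> real" where
  "jump_prob R i j = (if j = i then 0 else intensity R i j / total_intensity R i)"

definition restart_prob :: "'a risk_model \<Rightarrow> nat \<Rightarrow> nat \<Rightarrow> real" where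
  "restart_prob R z w =
     (if z = num_phases R + 1 then restart R w else if w = z then 1 else 0)"

text \<open>
  Given the past, the holding time in phase \<open>w\<close> is exponential with rate \<open>\<lambda>\<^sub>w\<close>, independently
  the next target is \<open>z\<close> with probability \<open>\<lambda>\<^sub>w\<^sub>z / \<lambda>\<^sub>w\<close>, and after a claim the new phase is drawn
  from the restart distribution. In \<open>phase_law\<close>, \<open>z k\<close> is the target of the \<open>(k+1)\<close>-st jump.
\<close>

definition phase_law :: "'a risk_model \<Rightarrow> nat \<Rightarrow> bool" where
  "phase_law R i \<longleftrightarrow>
     (\<forall>k. sojourn R k \<in> borel_measurable (law R i)) \<and>
     (\<forall>k. target R (Suc k) \<in> measurable (law R i) (count_space UNIV)) \<and>
     (\<forall>k. phase R k \<in> measurable (law R i) (count_space UNIV)) \<and>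
     (\<forall>m w z s.
        (\<forall>k\<le>m. w k \<in> {1..num_phases R}) \<longrightarrow>
        (\<forall>k<m. z k \<in> {1..num_phases R + 1} \<and> (0::real) \<le> s k) \<longrightarrow>
        measure (law R i)
          {\<omega> \<in> space (law R i). phase R 0 \<omega> = w 0 \<and>
             (\<forall>k<m. sojourn R k \<omega> > s k \<and> target R (Suc k) \<omega> = z k \<and>
                    phase R (Suc k) \<omega> = w (Suc k))} =
        (if w 0 = i then 1 else 0) *
          (\<Prod>k<m. exp (- total_intensity R (w k) * s k) * jump_prob R (w k) (z k) *
                 restart_prob R (z k) (w (Suc k))))"

definition transient_phase :: "'a risk_model \<Rightarrow> nat \<Rightarrow> bool" where
  "transient_phase R i \<longleftrightarrow>
     (AE \<omega> in law R i. bounded {t. 0 \<le> t \<and> absorbed_process R t \<omega> = i})"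

definition claim_law :: "'a risk_model \<Rightarrow> nat \<Rightarrow> bool" where
  "claim_law R i \<longleftrightarrow>
     prob_space.indep_vars (law R i) (\<lambda>_. borel) (claim R) {1..} \<and>
     (\<forall>k\<ge>1. \<forall>y\<ge>0. measure (law R i) {\<omega> \<in> space (law R i). claim R k \<omega> \<le> y}
                    = 1 - exp (- claim_rate R * y)) \<and>
     prob_space.indep_set (law R i)
       (sets (vimage_algebra (space (law R i))
          (\<lambda>\<omega> k. (phase R k \<omega>, target R (Suc k) \<omega>, sojourn R k \<omega>))
          (Pi\<^sub>M UNIV (\<lambda>_. count_space UNIV \<Otimes>\<^sub>M count_space UNIV \<Otimes>\<^sub>M borel))))
       (sets (vimage_algebra (space (law R i))
          (\<lambda>\<omega>. \<lambda>k\<in>{1..}. claim R k \<omega>) (Pi\<^sub>M {1..} (\<lambda>_. borel))))"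

definition phase_type_risk_model :: "'a risk_model \<Rightarrow> bool" where
  "phase_type_risk_model R \<longleftrightarrow>
     valid_parameters R \<and>
     (\<forall>i\<in>{1..num_phases R}.
        prob_space (law R i) \<and> sets (law R i) = sets (law R 1) \<and>
        phase_law R i \<and> transient_phase R i \<and> claim_law R i)"


subsection \<open>Admissible dividend strategies\<close>

text \<open>The completed filtration of the observed claims and phases.\<close>

definition observed_sigma :: "'a risk_model \<Rightarrow> nat \<Rightarrow> real \<Rightarrow> 'a measure" where
  "observed_sigma R i t = sigma (space (law R i))
     ({phase_process R s -` {j} \<inter> space (law R i) |s j. 0 \<le> s \<and> s \<le> t} \<union>
      {num_claims R s -` {m} \<inter> space (law R i) |s m. 0 \<le> s \<and> s \<le> t} \<union>
      {aggregate_claims R s -` B \<inter> space (law R i) |s B. 0 \<le> s \<and> s \<le> t \<and> B \<in> sets borel} \<union>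
      null_sets (completion (law R i)))"

definition predictable_sigma :: "'a risk_model \<Rightarrow> nat \<Rightarrow> (real \<times> 'a) measure" where
  "predictable_sigma R i = sigma ({0..} \<times> space (law R i))
     ({{0} \<times> A |A. A \<in> sets (observed_sigma R i 0)} \<union>
      {{s<..t} \<times> A |s t A. 0 \<le> s \<and> s \<le> t \<and> A \<in> sets (observed_sigma R i s)})"

text \<open>A strategy \<open>D\<close> is a process indexed by \<open>[0,\<infinity>)\<close>; its values at negative times are irrelevant.\<close>

definition surplus ::
  "'a risk_model \<Rightarrow> real \<Rightarrow> (real \<Rightarrow> 'a \<Rightarrow> real) \<Rightarrow> real \<Rightarrow> 'a \<Rightarrow> real" where
  "surplus R x D t \<omega> = x + premium R * t - aggregate_claims R t \<omega> - D t \<omega>"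

definition ruin_time ::
  "'a risk_model \<Rightarrow> real \<Rightarrow> (real \<Rightarrow> 'a \<Rightarrow> real) \<Rightarrow> 'a \<Rightarrow> ereal" where
  "ruin_time R x D \<omega> = Inf (ereal ` {t. 0 \<le> t \<and> surplus R x D t \<omega> < 0})"

text \<open>
  The budget constraint \<open>D\<^sub>t \<le> x + c t - Y\<^sub>1 - \<dots> - Y\<^bsub>N\<^sub>t\<^esub>\<close> says that dividends may not cause ruin.
  Imposed for \<open>t\<close> before \<open>inf {t. X\<^sub>t < 0}\<close> it would hold trivially, so it is imposed
  before the first claim after which the surplus is negative. For admissible strategies this time
  is (almost surely) \<open>ruin_time\<close>, because under the constraint the surplus is nonnegative until then.
\<close>

definition claim_ruin_time ::
  "'a risk_model \<Rightarrow> real \<Rightarrow> (real \<Rightarrow> 'a \<Rightarrow> real) \<Rightarrow> 'a \<Rightarrow> ereal" where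
  "claim_ruin_time R x D \<omega> = Inf (ereal ` {t \<in> claim_times R \<omega>. surplus R x D t \<omega> < 0})"

definition admissible ::
  "'a risk_model \<Rightarrow> nat \<Rightarrow> real \<Rightarrow> (real \<Rightarrow> 'a \<Rightarrow> real) \<Rightarrow> bool" where
  "admissible R i x D \<longleftrightarrow>
     (\<lambda>(t, \<omega>). D t \<omega>) \<in> borel_measurable (predictable_sigma R i) \<and>
     (AE \<omega> in law R i.
        D 0 \<omega> = 0 \<and>
        mono_on {0..} (\<lambda>t. D t \<omega>) \<and>
        (\<forall>t>0. continuous (at_left t) (\<lambda>s. D s \<omega>)) \<and>
        (\<forall>t\<ge>0. \<exists>l. ((\<lambda>s. D s \<omega>) \<longlongrightarrow> l) (at_right t)) \<and>
        (\<forall>t\<ge>0. ereal t < claim_ruin_time R x D \<omega> \<longrightarrow>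
                D t \<omega> \<le> x + premium R * t - aggregate_claims R t \<omega>))"


subsection \<open>Value functions\<close>

text \<open>
  The Stieltjes measure \<open>dD\<close> of a left-continuous nondecreasing path with \<open>D\<^sub>0 = 0\<close>: it gives mass
  \<open>D\<^sub>b - D\<^sub>a\<close> to \<open>[a, b)\<close> and mass \<open>D\<^bsub>t+\<^esub> - D\<^sub>t\<close> to \<open>{t}\<close>, including the lump sum \<open>D\<^bsub>0+\<^esub>\<close> at \<open>0\<close>.
  Since \<^const>\<open>interval_measure\<close> expects a right-continuous function, right limits are taken.
\<close>

definition dividend_measure :: "(real \<Rightarrow> 'a \<Rightarrow> real) \<Rightarrow> 'a \<Rightarrow> real measure" where
  "dividend_measure D \<omega> =
     interval_measure (\<lambda>t. if t < 0 then 0 else Lim (at_right t) (\<lambda>s. D s \<omega>))"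

text \<open>
  Discounted dividends paid during \<open>[0, T)\<close>. Payoffs are nonnegative, so all values are
  taken in \<^typ>\<open>ennreal\<close>; the value functions are finite, being bounded by \<open>x + c / \<delta>\<close>.
\<close>

definition discounted_dividends ::
  "'a risk_model \<Rightarrow> (real \<Rightarrow> 'a \<Rightarrow> real) \<Rightarrow> ereal \<Rightarrow> 'a \<Rightarrow> ennreal" where
  "discounted_dividends R D T \<omega> =
     (\<integral>\<^sup>+ t \<in> {t. 0 \<le> t \<and> ereal t < T}. ennreal (exp (- discount R * t)) \<partial>dividend_measure D \<omega>)"

definition strategy_value ::
  "'a risk_model \<Rightarrow> (real \<Rightarrow> 'a \<Rightarrow> real) \<Rightarrow> nat \<Rightarrow> real \<Rightarrow> ennreal" where
  "strategy_value R D i x =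
     (\<integral>\<^sup>+ \<omega>. discounted_dividends R D (ruin_time R x D \<omega>) \<omega> \<partial>completion (law R i))"

definition optimal_value :: "'a risk_model \<Rightarrow> nat \<Rightarrow> real \<Rightarrow> ennreal" where
  "optimal_value R i x = (SUP D\<in>{D. admissible R i x D}. strategy_value R D i x)"

definition first_jump_time :: "'a risk_model \<Rightarrow> 'a \<Rightarrow> real" where
  "first_jump_time R \<omega> =
     Inf {t. 0 \<le> t \<and> absorbed_process R t \<omega> \<noteq> absorbed_process R 0 \<omega>}"

text \<open>
  By left-continuity, \<open>D\<close> at the first jump time does not contain a payment made at that time.
\<close>

definition phase_iterate ::
  "'a risk_model \<Rightarrow> (nat \<Rightarrow> real \<Rightarrow> ennreal) \<Rightarrow> nat \<Rightarrow> real \<Rightarrow> ennreal" where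
  "phase_iterate R U i x =
     (SUP D\<in>{D. admissible R i x D}.
        \<integral>\<^sup>+ \<omega>. (let \<tau>1 = first_jump_time R \<omega> in
                 discounted_dividends R D (ereal \<tau>1) \<omega> +
                 ennreal (exp (- discount R * \<tau>1)) *
                   U (absorbed_process R \<tau>1 \<omega>) (x + premium R * \<tau>1 - D \<tau>1 \<omega>))
          \<partial>completion (law R i))"

definition claim_iterate ::
  "'a risk_model \<Rightarrow> (nat \<Rightarrow> real \<Rightarrow> ennreal) \<Rightarrow> real \<Rightarrow> ennreal" where
  "claim_iterate R W x =
     ennreal (claim_rate R * exp (- claim_rate R * x)) *
     (\<integral>\<^sup>+ y \<in> {0..x}. ennreal (exp (claim_rate R * y)) *
        (\<Sum>i = 1..num_phases R. ennreal (restart R i) * W i y) \<partial>lborel)"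

primrec value_iterate :: "'a risk_model \<Rightarrow> nat \<Rightarrow> nat \<Rightarrow> real \<Rightarrow> ennreal" where
  "value_iterate R 0 = (\<lambda>i x. 0)"
| "value_iterate R (Suc k) =
     (\<lambda>i x. if i = num_phases R + 1
            then claim_iterate R (phase_iterate R (value_iterate R k)) x
            else phase_iterate R (value_iterate R k) i x)"

end

theory Submission
  imports Defs
begin

text \<open>
  A trajectory of the model is encoded as the stream of its jumps. Under \<open>law i\<close> the first jump has
  an explicit law and, given this jump, the remaining stream is distributed as a trajectory started
  in the new phase. A process is predictable for the completed observed filtration iff, up to a null
  set, it is a Borel function of time and of the stream of past jumps. Hence strategies can be
  restarted at, and concatenated after, the first jump.

  Restarting shows by induction on \<open>k\<close> that the dividends paid by a strategy before the \<open>k\<close>-th jump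
  are worth at most \<open>V\<^sup>(\<^sup>k\<^sup>)\<close>; as the jump times tend to infinity, monotone convergence gives
  \<open>V \<le> sup\<^sub>k V\<^sup>(\<^sup>k\<^sup>)\<close>. Concatenating with nearly optimal strategies gives \<open>V\<^sup>(\<^sup>k\<^sup>) \<le> V\<close>, again by
  induction. Since the iterates increase in \<open>k\<close>, they converge to \<open>V\<close>.
\<close>

text \<open>Up to the first jump a predictable strategy has nothing to react to: it is a
  deterministic path followed by a family of continuations indexed by the first mark, and the
  one-step operator behind the iterates involves only the deterministic path. The lower bound thus
  reduces to the optimal value being a supersolution: one step followed by the optimal value is
  worth no more than the optimal value. The obstacle is that the continuation must be chosen
  measurably in the surplus left by the jump. Extra capital can be paid out at once, so the values
  increase with the surplus, and countably many surplus levels suffice; the same monotonicity makes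
  the value functions Borel. Payoffs are nonnegative, so limits pass through integrals by monotone
  convergence; finiteness of the optimal value enters where \<epsilon> is subtracted from it. A
  second obstacle is that feasibility concerns uncountably many times and need not be a measurable
  event. Hence the explicit null sets in the concatenation and the left-continuous modifications of
  strategies.\<close>

subsection \<open>Marked paths\<close>

text \<open>In a path \<open>h\<close>, the mark \<open>h !! k\<close> describes the \<open>(k+1)\<close>-st jump: the sojourn time before it, the
  state entered, the phase after a possible restart, and the claim size, which is \<open>0\<close> unless the
  state entered is \<open>n + 1\<close>.\<close>

type_synonym mark = "real \<times> nat \<times> nat \<times> real"

abbreviation hold :: "mark \<Rightarrow> real" where "hold e \<equiv> fst e"
abbreviation dest :: "mark \<Rightarrow> nat" where "dest e \<equiv> fst (snd e)"
abbreviation next_phase :: "mark \<Rightarrow> nat" where "next_phase e \<equiv> fst (snd (snd e))"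
abbreviation loss :: "mark \<Rightarrow> real" where "loss e \<equiv> snd (snd (snd e))"

definition jump_at :: "nat \<Rightarrow> mark stream \<Rightarrow> real" where
  "jump_at k h = (\<Sum>l<k. hold (h !! l))"

definition total_loss :: "nat \<Rightarrow> mark stream \<Rightarrow> real" where
  "total_loss k h = (\<Sum>l<k. loss (h !! l))"

text \<open>Almost every path is proper (\<open>AE_good_path\<close>). Divergence of the jump times
  makes the intervals between consecutive jumps a partition of the half-line, on which the pathwise
  arguments rest.\<close>

definition proper :: "mark stream \<Rightarrow> bool" where
  "proper h \<longleftrightarrow> (\<forall>k. hold (h !! k) > 0) \<and> filterlim (\<lambda>k. jump_at k h) at_top sequentially"

lemma jump_at_0 [simp]: "jump_at 0 h = 0"
  by (simp add: jump_at_def)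

lemma jump_at_Suc: "jump_at (Suc k) h = jump_at k h + hold (h !! k)"
  by (simp add: jump_at_def)

lemma jump_at_Stream [simp]: "jump_at (Suc k) (e ## h) = hold e + jump_at k h"
  by (simp add: jump_at_def sum.lessThan_Suc_shift del: sum.lessThan_Suc)

lemma total_loss_0 [simp]: "total_loss 0 h = 0"
  by (simp add: total_loss_def)

lemma total_loss_Suc: "total_loss (Suc k) h = total_loss k h + loss (h !! k)"
  by (simp add: total_loss_def)

lemma total_loss_Stream [simp]: "total_loss (Suc k) (e ## h) = loss e + total_loss k h"
  by (simp add: total_loss_def sum.lessThan_Suc_shift del: sum.lessThan_Suc)

lemma proper_hold: "proper h \<Longrightarrow> hold (h !! k) > 0"
  by (simp add: proper_def)

lemma proper_jump_at_strict: "proper h \<Longrightarrow> j < k \<Longrightarrow> jump_at j h < jump_at k h"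
proof (induction k)
  case (Suc k)
  then show ?case
    using proper_hold[OF Suc.prems(1), of k]
    by (cases "j = k") (auto simp: jump_at_Suc dest!: Suc.IH)
qed simp

lemma proper_jump_at_mono: "proper h \<Longrightarrow> j \<le> k \<Longrightarrow> jump_at j h \<le> jump_at k h"
  using proper_jump_at_strict[of h j k] by (cases "j = k") (auto intro: less_imp_le)

lemma proper_jump_at_nonneg: "proper h \<Longrightarrow> 0 \<le> jump_at k h"
  using proper_jump_at_mono[of h 0 k] by simp

lemma proper_jump_at_pos: "proper h \<Longrightarrow> 0 < jump_at (Suc k) h"
  using proper_jump_at_strict[of h 0 "Suc k"] by simp

lemma proper_Stream [simp]: "proper (e ## h) \<longleftrightarrow> hold e > 0 \<and> proper h"
proof -
  have 1: "filterlim (\<lambda>k. hold e + jump_at k h) at_top sequentially \<longleftrightarrow>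
     filterlim (\<lambda>k. jump_at k h) at_top sequentially"
  proof
    assume "filterlim (\<lambda>k. hold e + jump_at k h) at_top sequentially"
    from filterlim_tendsto_add_at_top[OF tendsto_const[of "- hold e"] this]
    show "filterlim (\<lambda>k. jump_at k h) at_top sequentially" by simp
  qed (rule filterlim_tendsto_add_at_top[OF tendsto_const])
  have "filterlim (\<lambda>k. jump_at k (e ## h)) at_top sequentially \<longleftrightarrow>
     filterlim (\<lambda>k. jump_at (Suc k) (e ## h)) at_top sequentially"
    by (rule filterlim_sequentially_Suc[symmetric])
  moreover have "(\<forall>k. hold ((e ## h) !! k) > 0) \<longleftrightarrow> hold e > 0 \<and> (\<forall>k. hold (h !! k) > 0)"
    by (metis snth.simps not0_implies_Suc stream.sel)
  ultimately show ?thesis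
    by (simp add: proper_def 1)
qed

lemma proper_ex_interval:
  assumes "proper h" "0 \<le> t"
  obtains k where "jump_at k h \<le> t" "t < jump_at (Suc k) h"
proof -
  have ex: "\<exists>k. t < jump_at k h"
    using assms(1) unfolding proper_def filterlim_at_top_dense
    by (meson eventually_sequentially order_refl)
  define m where "m = (LEAST k. t < jump_at k h)"
  have m: "t < jump_at m h" unfolding m_def by (rule LeastI_ex[OF ex])
  then have "m \<noteq> 0" using assms(2) by (cases m) auto
  then obtain k where k: "m = Suc k" by (cases m) auto
  have "\<not> t < jump_at k h" unfolding m_def by (rule not_less_Least) (use k m_def in simp)
  then show thesis using that[of k] m k by simp
qed

text \<open>By left-continuity \<open>d s\<close> excludes a payment at \<open>s\<close>, so such a
  payment becomes the initial lump sum of the shifted path. The value 0 at all nonpositive times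
  makes \<open>shift_strat_path\<close> an equality of functions on the whole line.\<close>

definition shift_path :: "(real \<Rightarrow> real) \<Rightarrow> real \<Rightarrow> real \<Rightarrow> real" where
  "shift_path d s t = (if t \<le> 0 then 0 else d (s + t) - d s)"

text \<open>The right limits demanded of an admissible strategy come from monotonicity, see
  \<open>right_lim_tendsto\<close>.\<close>

definition regular_path :: "(real \<Rightarrow> real) \<Rightarrow> bool" where
  "regular_path d \<longleftrightarrow> d 0 = 0 \<and> mono_on {0..} d \<and> (\<forall>t>0. continuous (at_left t) d)"

lemma regular_path_mono: "regular_path d \<Longrightarrow> 0 \<le> s \<Longrightarrow> s \<le> t \<Longrightarrow> d s \<le> d t"
  unfolding regular_path_def by (auto dest!: mono_onD[where r=s and s=t])

lemma regular_path_nonneg: "regular_path d \<Longrightarrow> 0 \<le> t \<Longrightarrow> 0 \<le> d t"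
  using regular_path_mono[of d 0 t] by (simp add: regular_path_def)

lemma continuous_at_left_cong:
  fixes d d' :: "real \<Rightarrow> real"
  assumes "a < t" "\<And>s. a < s \<Longrightarrow> s \<le> t \<Longrightarrow> d s = d' s"
  shows "continuous (at_left t) d \<longleftrightarrow> continuous (at_left t) d'"
proof -
  have "eventually (\<lambda>s. d s = d' s) (at_left t)"
    unfolding eventually_at_left_field using assms by (intro exI[of _ a]) auto
  moreover have "d t = d' t" using assms by auto
  ultimately show ?thesis
    unfolding continuous_within by (simp add: tendsto_cong)
qed

lemma continuous_at_left_shift:
  fixes d :: "real \<Rightarrow> real"
  shows "continuous (at_left t) (\<lambda>t. d (s + t)) \<longleftrightarrow> continuous (at_left (s + t)) d"
proof -
  have "at_left (s + t) = filtermap (\<lambda>x. s + x) (at_left t)"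
    using filtermap_at_left_shift[of "-s" t] by (simp add: add.commute)
  then have "((\<lambda>x. d x) \<longlongrightarrow> d (s + t)) (at_left (s + t)) \<longleftrightarrow> ((\<lambda>x. d (s + x)) \<longlongrightarrow> d (s + t)) (at_left t)"
    by (simp only: filterlim_filtermap)
  then show ?thesis by (simp add: continuous_within)
qed

lemma regular_path_shift:
  assumes "regular_path d" "0 \<le> s"
  shows "regular_path (shift_path d s)"
  unfolding regular_path_def
proof (intro conjI allI impI)
  show "shift_path d s 0 = 0" by (simp add: shift_path_def)
  show "mono_on {0..} (shift_path d s)"
  proof (rule mono_onI)
    fix r t :: real assume "r \<in> {0..}" "t \<in> {0..}" "r \<le> t"
    then show "shift_path d s r \<le> shift_path d s t"
      using regular_path_mono[OF assms(1), of "s + r" "s + t"] regular_path_mono[OF assms(1), of s "s + t"] assms(2)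
      by (auto simp: shift_path_def)
  qed
  fix t :: real assume "t > 0"
  have "continuous (at_left t) (\<lambda>t. d (s + t) - d s)"
    using assms \<open>t > 0\<close> by (intro continuous_intros iffD2[OF continuous_at_left_shift]) (auto simp: regular_path_def)
  then show "continuous (at_left t) (shift_path d s)"
    by (subst continuous_at_left_cong[OF \<open>t > 0\<close>, where d' = "\<lambda>t. d (s + t) - d s"]) (auto simp: shift_path_def)
qed

lemma regular_path_cong:
  assumes "\<And>t. 0 \<le> t \<Longrightarrow> d t = d' t"
  shows "regular_path d \<longleftrightarrow> regular_path d'"
proof -
  have "mono_on {0..} d \<longleftrightarrow> mono_on {0..} d'"
    using assms by (simp add: monotone_on_def)
  moreover have "continuous (at_left t) d \<longleftrightarrow> continuous (at_left t) d'" if "0 < t" for t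
    using assms that by (intro continuous_at_left_cong[where a=0]) auto
  ultimately show ?thesis
    unfolding regular_path_def using assms by auto
qed

text \<open>Left-continuity at the gluing time \<open>s\<close> belongs to the first piece, a lump
  sum at \<open>s\<close> to the shifted piece; hence the two pieces can be glued without any
  matching condition.\<close>

lemma regular_path_concat:
  assumes "0 < s" "d 0 = 0" "mono_on {0..s} d" "\<And>t. 0 < t \<Longrightarrow> t \<le> s \<Longrightarrow> continuous (at_left t) d"
    and "regular_path (shift_path d s)"
  shows "regular_path d"
  unfolding regular_path_def
proof (intro conjI allI impI mono_onI)
  show "d 0 = 0" by fact
next
  fix r t assume rt: "r \<in> {0..}" "t \<in> {0..}" "r \<le> (t::real)"
  have sh: "d s \<le> d t" if "s \<le> t" for t
    using regular_path_nonneg[OF assms(5), of "t - s"] that by (auto simp: shift_path_def split: if_splits)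
  consider "t \<le> s" | "r \<le> s" "s < t" | "s < r" by linarith
  then show "d r \<le> d t"
  proof cases
    case 1 then show ?thesis using rt mono_onD[OF assms(3), of r t] by auto
  next
    case 2 then show ?thesis using rt assms(1) mono_onD[OF assms(3), of r s] sh[of t] by auto
  next
    case 3 then show ?thesis using regular_path_mono[OF assms(5), of "r - s" "t - s"] rt
      by (auto simp: shift_path_def split: if_splits)
  qed
next
  fix t :: real assume "t > 0"
  show "continuous (at_left t) d"
  proof (cases "t \<le> s")
    case False
    have "continuous (at_left (t - s)) (\<lambda>u. shift_path d s u + d s)"
      using assms(5) False by (intro continuous_intros) (auto simp: regular_path_def)
    also have "?this \<longleftrightarrow> continuous (at_left (t - s)) (\<lambda>u. d (s + u))"
      using False by (intro continuous_at_left_cong[where a=0]) (auto simp: shift_path_def)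
    finally show ?thesis by (simp add: continuous_at_left_shift)
  qed (use \<open>t > 0\<close> assms in auto)
qed

lemma Inf_ereal_shift: "Inf (ereal ` (\<lambda>t. s + t) ` B) = ereal s + Inf (ereal ` B)"
proof (rule antisym)
  show "ereal s + Inf (ereal ` B) \<le> Inf (ereal ` (\<lambda>t. s + t) ` B)"
    by (rule Inf_greatest) (auto simp flip: plus_ereal.simps(1) intro!: add_left_mono Inf_lower)
  have "Inf (ereal ` (\<lambda>t. s + t) ` B) - ereal s \<le> Inf (ereal ` B)"
  proof (rule Inf_greatest)
    fix b assume "b \<in> ereal ` B"
    then obtain x where "x \<in> B" "b = ereal x" by auto
    then have "Inf (ereal ` (\<lambda>t. s + t) ` B) \<le> ereal s + b"
      by (auto intro!: Inf_lower)
    then show "Inf (ereal ` (\<lambda>t. s + t) ` B) - ereal s \<le> b"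
      by (simp add: ereal_minus_le_iff add.commute)
  qed
  then show "Inf (ereal ` (\<lambda>t. s + t) ` B) \<le> ereal s + Inf (ereal ` B)"
    by (simp add: ereal_minus_le_iff add.commute)
qed

text \<open>The lump sum \<open>a\<close> is paid immediately; as the path is left-continuous and
  starts at 0, it shows only at positive times.\<close>

definition lump_path :: "real \<Rightarrow> (real \<Rightarrow> real) \<Rightarrow> real \<Rightarrow> real" where
  "lump_path a d t = (if t \<le> 0 then 0 else a + d t)"

lemma regular_path_lump:
  assumes "regular_path d" "0 \<le> a"
  shows "regular_path (lump_path a d)"
  unfolding regular_path_def
proof (intro conjI allI impI)
  show "lump_path a d 0 = 0" by (simp add: lump_path_def)
  show "mono_on {0..} (lump_path a d)"
  proof (rule mono_onI)
    fix r t :: real assume "r \<in> {0..}" "t \<in> {0..}" "r \<le> t"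
    then show "lump_path a d r \<le> lump_path a d t"
      using regular_path_mono[OF assms(1), of r t] regular_path_nonneg[OF assms(1), of t] assms(2)
      by (auto simp: lump_path_def)
  qed
  fix t :: real assume "t > 0"
  have "continuous (at_left t) (\<lambda>t. a + d t)"
    using assms \<open>t > 0\<close> by (intro continuous_intros) (auto simp: regular_path_def)
  then show "continuous (at_left t) (lump_path a d)"
    by (subst continuous_at_left_cong[OF \<open>t > 0\<close>, where d' = "\<lambda>t. a + d t"]) (auto simp: lump_path_def)
qed

section \<open>Ruin and feasibility of a single dividend path\<close>

locale risk =
  fixes R :: "'a risk_model"
  assumes model: "phase_type_risk_model R"
begin

abbreviation "c \<equiv> premium R"
abbreviation "\<beta> \<equiv> claim_rate R"
abbreviation "\<delta> \<equiv> discount R"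
abbreviation "n \<equiv> num_phases R"
definition "claim_state = num_phases R + 1"

lemma pos: "0 < c" "0 < \<beta>" "0 < \<delta>"
  using model by (auto simp: phase_type_risk_model_def valid_parameters_def)

text \<open>Only claim times are tested, so that this is a countable infimum and measurable in the
  path (\<open>ruin_eq_INF\<close>); for feasible paths it is the actual ruin time
  (\<open>ruin_time_eq\<close>).\<close>

definition ruin :: "(real \<Rightarrow> real) \<Rightarrow> real \<Rightarrow> mark stream \<Rightarrow> ereal" where
  "ruin d x h = Inf (ereal ` {jump_at (Suc k) h | k. dest (h !! k) = claim_state \<and>
     x + c * jump_at (Suc k) h - total_loss (Suc k) h - d (jump_at (Suc k) h) < 0})"

text \<open>Between the \<open>k\<close>-th and the next jump the aggregate claims equal
  \<open>total_loss k h\<close>, so this is the condition that \<open>admissible\<close> imposes on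
  a path (\<open>admissible_path_iff\<close>).\<close>

definition feasible :: "(real \<Rightarrow> real) \<Rightarrow> real \<Rightarrow> mark stream \<Rightarrow> bool" where
  "feasible d x h \<longleftrightarrow> regular_path d \<and>
     (\<forall>k t. jump_at k h \<le> t \<longrightarrow> t < jump_at (Suc k) h \<longrightarrow> ereal t < ruin d x h \<longrightarrow>
        d t \<le> x + c * t - total_loss k h)"

text \<open>Integration by parts turns the discounted Stieltjes integral over
  \<open>[0, \<tau>)\<close> into this Lebesgue integral of the path stopped at
  \<open>\<tau>\<close> (\<open>discounted_dividends_eq_pay\<close>). Only values of
  \<open>d\<close> occur, so measurability and time shifts are elementary; left-continuity excludes
  a payment at \<open>\<tau>\<close>.\<close>

definition pay :: "(real \<Rightarrow> real) \<Rightarrow> ereal \<Rightarrow> ennreal" where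
  "pay d \<tau> = (\<integral>\<^sup>+ u \<in> {0..}. ennreal (\<delta> * exp (- \<delta> * u) * d (real_of_ereal (min (ereal u) \<tau>))) \<partial>lborel)"

definition surplus_after :: "(real \<Rightarrow> real) \<Rightarrow> real \<Rightarrow> mark \<Rightarrow> real" where
  "surplus_after d x e = x + c * hold e - loss e - d (hold e)"

definition ruined :: "(real \<Rightarrow> real) \<Rightarrow> real \<Rightarrow> mark \<Rightarrow> bool" where
  "ruined d x e \<longleftrightarrow> dest e = claim_state \<and> surplus_after d x e < 0"

lemma ruin_nonneg:
  assumes "proper h" shows "0 \<le> ruin d x h"
  unfolding ruin_def using proper_jump_at_pos[OF assms] by (auto intro!: Inf_greatest simp: less_imp_le)

text \<open>The test at index 0 is the one at the first jump; the tests at the later indices are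
  those of the shifted path with initial surplus \<open>surplus_after d x e\<close>, delayed by
  \<open>hold e\<close>.\<close>

lemma ruin_Stream:
  assumes "proper (e ## h)"
  shows "ruin d x (e ## h) = (if ruined d x e then ereal (hold e)
     else ereal (hold e) + ruin (shift_path d (hold e)) (surplus_after d x e) h)"
proof -
  let ?s = "hold e" and ?u = "surplus_after d x e"
  define B where "B = {jump_at (Suc k) h | k. dest (h !! k) = claim_state \<and>
     ?u + c * jump_at (Suc k) h - total_loss (Suc k) h - shift_path d ?s (jump_at (Suc k) h) < 0}"
  have h: "proper h" "0 < ?s" using assms by auto
  have eq: "{jump_at (Suc k) (e ## h) | k. dest ((e ## h) !! k) = claim_state \<and>
     x + c * jump_at (Suc k) (e ## h) - total_loss (Suc k) (e ## h) - d (jump_at (Suc k) (e ## h)) < 0}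
     = (if ruined d x e then {?s} else {}) \<union> (\<lambda>t. ?s + t) ` B" (is "?L = ?R")
  proof -
    have 1: "shift_path d ?s (jump_at (Suc k) h) = d (?s + jump_at (Suc k) h) - d ?s" for k
      using proper_jump_at_pos[OF h(1), of k] by (simp add: shift_path_def)
    have "{f k | k. P k} = (if P 0 then {f 0} else {}) \<union> {f (Suc k) | k. P (Suc k)}" for f :: "nat \<Rightarrow> real" and P
    proof (intro set_eqI iffI)
      fix y assume "y \<in> {f k | k. P k}"
      then obtain k where "y = f k" "P k" by auto
      then show "y \<in> (if P 0 then {f 0} else {}) \<union> {f (Suc k) | k. P (Suc k)}" by (cases k) auto
    qed (auto split: if_splits)
    from this[of "\<lambda>k. jump_at (Suc k) (e ## h)" "\<lambda>k. dest ((e ## h) !! k) = claim_state \<and>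
     x + c * jump_at (Suc k) (e ## h) - total_loss (Suc k) (e ## h) - d (jump_at (Suc k) (e ## h)) < 0"]
    have L: "?L = (if ruined d x e then {?s} else {}) \<union>
      {?s + jump_at (Suc k) h | k. dest (h !! k) = claim_state \<and>
       x + c * (?s + jump_at (Suc k) h) - (loss e + total_loss (Suc k) h) - d (?s + jump_at (Suc k) h) < 0}"
      by (simp add: ruined_def surplus_after_def diff_diff_eq)
    have "(\<lambda>t. ?s + t) ` B = {?s + jump_at (Suc k) h | k. dest (h !! k) = claim_state \<and>
       x + c * (?s + jump_at (Suc k) h) - (loss e + total_loss (Suc k) h) - d (?s + jump_at (Suc k) h) < 0}"
    proof -
      have "?u + c * jump_at (Suc k) h - total_loss (Suc k) h - shift_path d ?s (jump_at (Suc k) h) =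
        x + c * (?s + jump_at (Suc k) h) - (loss e + total_loss (Suc k) h) - d (?s + jump_at (Suc k) h)" for k
        unfolding 1 surplus_after_def by (simp only: algebra_simps)
      note eq2 = this
      show ?thesis unfolding B_def eq2 by auto
    qed
    with L show ?thesis by simp
  qed
  \<comment> \<open>Later claims come after the first jump, so a ruinous first claim attains the
    infimum.\<close>
  have Bpos: "0 \<le> Inf (ereal ` B)"
    unfolding B_def using proper_jump_at_pos[OF h(1)] by (auto intro!: Inf_greatest simp: less_imp_le)
  have "ruin d x (e ## h) = Inf (ereal ` ?R)" unfolding ruin_def eq ..
  also have "\<dots> = (if ruined d x e then inf (ereal ?s) (ereal ?s + Inf (ereal ` B)) else ereal ?s + Inf (ereal ` B))"
    by (simp add: image_Un Inf_union_distrib Inf_ereal_shift)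
  also have "inf (ereal ?s) (ereal ?s + Inf (ereal ` B)) = ereal ?s"
    using add_left_mono[OF Bpos, of "ereal ?s"] by (simp add: inf_absorb1 zero_ereal_def)
  finally show ?thesis by (simp add: ruin_def B_def)
qed

text \<open>Ruin is declared at claims only, hence never before the first jump.\<close>

lemma hold_le_ruin:
  assumes "proper (e ## h)" shows "ereal (hold e) \<le> ruin d x (e ## h)"
proof -
  have "0 \<le> ruin (shift_path d (hold e)) (surplus_after d x e) h"
    using assms by (intro ruin_nonneg) simp
  from add_left_mono[OF this, of "ereal (hold e)"] show ?thesis
    by (simp add: ruin_Stream[OF assms])
qed

lemma feasible_regular: "feasible d x h \<Longrightarrow> regular_path d"
  by (simp add: feasible_def)

lemma feasible_first:
  assumes "proper (e ## h)" "feasible d x (e ## h)" "0 \<le> t" "t < hold e"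
  shows "d t \<le> x + c * t"
proof -
  have "jump_at 0 (e ## h) \<le> t" "t < jump_at (Suc 0) (e ## h)" using assms by auto
  moreover have "ereal t < ruin d x (e ## h)"
    using assms(4) by (intro less_le_trans[OF _ hold_le_ruin[OF assms(1)]]) simp
  ultimately have "d t \<le> x + c * t - total_loss 0 (e ## h)" using assms(2) unfolding feasible_def by blast
  then show ?thesis by simp
qed

lemma feasible_Stream:
  assumes "proper (e ## h)" "feasible d x (e ## h)" "\<not> ruined d x e"
  shows "feasible (shift_path d (hold e)) (surplus_after d x e) h"
  unfolding feasible_def
proof (intro conjI allI impI)
  let ?s = "hold e"
  have h: "proper h" "0 < ?s" using assms by auto
  show "regular_path (shift_path d ?s)"
    using assms h by (intro regular_path_shift) (auto simp: feasible_def)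
  fix k t assume t: "jump_at k h \<le> t" "t < jump_at (Suc k) h"
    "ereal t < ruin (shift_path d ?s) (surplus_after d x e) h"
  have "0 \<le> t" using proper_jump_at_nonneg[OF h(1), of k] t by simp
  have "ereal ?s + ereal t < ereal ?s + ruin (shift_path d ?s) (surplus_after d x e) h"
    using t(3) by (cases "ruin (shift_path d ?s) (surplus_after d x e) h") auto
  then have "ereal (?s + t) < ruin d x (e ## h)"
    using assms by (simp add: ruin_Stream)
  moreover have "jump_at (Suc k) (e ## h) \<le> ?s + t" "?s + t < jump_at (Suc (Suc k)) (e ## h)"
    using t by auto
  ultimately have "d (?s + t) \<le> x + c * (?s + t) - total_loss (Suc k) (e ## h)"
    using assms(2) unfolding feasible_def by blast
  then show "shift_path d ?s t \<le> surplus_after d x e + c * t - total_loss k h"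
    using \<open>0 \<le> t\<close> by (cases "t = 0") (auto simp: shift_path_def surplus_after_def algebra_simps)
qed

text \<open>Converse of \<open>feasible_Stream\<close>, used to verify concatenated strategies. The
  shifted path has to be feasible only if the first claim is not ruinous, since otherwise the budget
  constraint is void from then on; regularity is required in either case because
  \<open>feasible\<close> demands it of the whole path.\<close>

lemma feasible_StreamI:
  assumes pr: "proper (e ## h)" and d: "d 0 = 0" "mono_on {0..hold e} d"
      "\<And>t. 0 < t \<Longrightarrow> t \<le> hold e \<Longrightarrow> continuous (at_left t) d"
    and first: "\<And>t. 0 \<le> t \<Longrightarrow> t < hold e \<Longrightarrow> d t \<le> x + c * t"
    and reg: "regular_path (shift_path d (hold e))"
    and rest: "\<not> ruined d x e \<Longrightarrow> feasible (shift_path d (hold e)) (surplus_after d x e) h"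
  shows "feasible d x (e ## h)"
  unfolding feasible_def
proof (intro conjI allI impI)
  let ?s = "hold e"
  have h: "proper h" "0 < ?s" using pr by auto
  show "regular_path d"
    by (rule regular_path_concat[OF h(2) d reg])
  fix k t assume t: "jump_at k (e ## h) \<le> t" "t < jump_at (Suc k) (e ## h)" "ereal t < ruin d x (e ## h)"
  show "d t \<le> x + c * t - total_loss k (e ## h)"
  proof (cases k)
    case 0
    then show ?thesis using first[of t] t(1,2) by simp
  next
    case (Suc j)
    have k: "jump_at j h \<le> t - ?s" "t - ?s < jump_at (Suc j) h" using t by (auto simp: Suc)
    have "0 \<le> t - ?s" using proper_jump_at_nonneg[OF h(1), of j] k by simp
    have nr: "\<not> ruined d x e"
    proof
      assume "ruined d x e"
      then have "ereal t < ereal ?s" using t(3) ruin_Stream[OF pr, of d x] by simp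
      then show False using \<open>0 \<le> t - ?s\<close> by simp
    qed
    then have "ereal (t - ?s) < ruin (shift_path d ?s) (surplus_after d x e) h"
    proof -
      have "ereal t < ereal ?s + ruin (shift_path d ?s) (surplus_after d x e) h"
        using t(3) nr ruin_Stream[OF pr, of d x] by simp
      then show ?thesis by (cases "ruin (shift_path d ?s) (surplus_after d x e) h") auto
    qed
    with rest[OF nr] k have "shift_path d ?s (t - ?s) \<le> surplus_after d x e + c * (t - ?s) - total_loss j h"
      unfolding feasible_def by blast
    moreover have "shift_path d ?s (t - ?s) = d t - d ?s"
      using \<open>0 \<le> t - ?s\<close> by (cases "t = ?s") (simp_all add: shift_path_def)
    ultimately show ?thesis
      by (simp add: Suc surplus_after_def right_diff_distrib)
  qed
qed

lemma ruin_cong: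
  assumes "proper h" "\<And>t. 0 \<le> t \<Longrightarrow> d t = d' t"
  shows "ruin d x h = ruin d' x h"
  unfolding ruin_def by (simp only: assms(2)[OF proper_jump_at_nonneg[OF assms(1)]])

lemma feasible_cong:
  assumes "proper h" "\<And>t. 0 \<le> t \<Longrightarrow> d t = d' t"
  shows "feasible d x h \<longleftrightarrow> feasible d' x h"
proof -
  have "d t = d' t" if "jump_at k h \<le> t" for k t
    using assms proper_jump_at_nonneg[OF assms(1), of k] that by simp
  moreover have "ruin d x h = ruin d' x h" by (rule ruin_cong[OF assms])
  ultimately show ?thesis
    unfolding feasible_def using regular_path_cong[of d d', OF assms(2)] by auto
qed

lemma real_min_nonneg: "0 \<le> u \<Longrightarrow> 0 \<le> \<tau> \<Longrightarrow> 0 \<le> real_of_ereal (min (ereal u) \<tau>)"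
  by (cases \<tau>) (auto simp: min_def)

lemma pay_cong:
  assumes "0 \<le> \<tau>" "\<And>t. 0 \<le> t \<Longrightarrow> d t = d' t"
  shows "pay d \<tau> = pay d' \<tau>"
  unfolding pay_def using assms
  by (intro nn_integral_cong) (simp add: real_min_nonneg split: split_indicator)

lemma pay_cong_upto:
  assumes "0 \<le> s" "\<And>t. 0 \<le> t \<Longrightarrow> t \<le> s \<Longrightarrow> d t = d' t"
  shows "pay d (ereal s) = pay d' (ereal s)"
  unfolding pay_def using assms
  by (intro nn_integral_cong) (auto simp: min_def split: split_indicator)

text \<open>Starting with \<open>a\<close> more and paying it at once leaves every later surplus
  unchanged. Together with \<open>feasible_lump\<close> and \<open>pay_lump\<close> this is the
  source of the monotonicity of the value functions in the surplus.\<close>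

lemma ruin_lump:
  assumes "proper h"
  shows "ruin (lump_path a d) (x + a) h = ruin d x h"
proof -
  have "lump_path a d (jump_at (Suc k) h) = a + d (jump_at (Suc k) h)" for k
    using proper_jump_at_pos[OF assms, of k] by (simp add: lump_path_def)
  then show ?thesis unfolding ruin_def by (simp add: algebra_simps)
qed

lemma feasible_lump:
  assumes "proper h" "feasible d x h" "0 \<le> a"
  shows "feasible (lump_path a d) (x + a) h"
  unfolding feasible_def
proof (intro conjI allI impI)
  show "regular_path (lump_path a d)"
    using assms by (intro regular_path_lump) (auto simp: feasible_def)
  fix k t assume t: "jump_at k h \<le> t" "t < jump_at (Suc k) h" "ereal t < ruin (lump_path a d) (x + a) h"
  have "0 \<le> t" using proper_jump_at_nonneg[OF assms(1), of k] t by simp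
  have "d t \<le> x + c * t - total_loss k h"
    using assms t unfolding feasible_def by (simp add: ruin_lump)
  then show "lump_path a d t \<le> x + a + c * t - total_loss k h"
    using regular_path_nonneg[of d t] \<open>0 \<le> t\<close> assms by (auto simp: lump_path_def feasible_def)
qed

lemma pay_lump:
  assumes "0 \<le> \<tau>" "d 0 = 0" "0 \<le> a"
  shows "pay d \<tau> \<le> pay (lump_path a d) \<tau>"
  unfolding pay_def
proof (intro nn_integral_mono)
  fix u
  have "d t \<le> lump_path a d t" if "0 \<le> t" for t
    using that assms by (auto simp: lump_path_def regular_path_def)
  then have "0 \<le> u \<Longrightarrow> d (real_of_ereal (min (ereal u) \<tau>)) \<le> lump_path a d (real_of_ereal (min (ereal u) \<tau>))"
    using assms(1) real_min_nonneg by blast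
  then have "0 \<le> u \<Longrightarrow> \<delta> * exp (- \<delta> * u) * d (real_of_ereal (min (ereal u) \<tau>))
     \<le> \<delta> * exp (- \<delta> * u) * lump_path a d (real_of_ereal (min (ereal u) \<tau>))"
    using pos(3) by (intro mult_left_mono) simp_all
  then show "ennreal (\<delta> * exp (- \<delta> * u) * d (real_of_ereal (min (ereal u) \<tau>))) * indicator {0..} u
    \<le> ennreal (\<delta> * exp (- \<delta> * u) * lump_path a d (real_of_ereal (min (ereal u) \<tau>))) * indicator {0..} u"
    by (auto intro!: ennreal_leI split: split_indicator)
qed

end

section \<open>Splitting and bounding the payoff\<close>

context risk begin

lemma regular_path_measurable:
  assumes "regular_path d"
  shows "(\<lambda>t. d (max 0 t)) \<in> borel_measurable borel"
proof (rule borel_measurable_mono)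
  show "mono (\<lambda>t. d (max 0 t))"
    by (intro monoI regular_path_mono[OF assms]) auto
qed

lemma pay_integrand_measurable:
  assumes "regular_path d" "0 \<le> \<tau>"
  shows "(\<lambda>u. ennreal (\<delta> * exp (- \<delta> * u) * d (real_of_ereal (min (ereal u) \<tau>))) * indicator {0..} u)
    \<in> borel_measurable borel"
proof -
  note [measurable] = measurable_compose[OF _ regular_path_measurable[OF assms(1)]]
  have "(\<lambda>u. ennreal (\<delta> * exp (- \<delta> * u) * d (max 0 (real_of_ereal (min (ereal u) \<tau>)))) * indicator {0..} u)
    \<in> borel_measurable borel"
    by measurable
  also have "?this \<longleftrightarrow> ?thesis"
    using assms(2) by (intro arg_cong2[where f="(\<in>)"] refl ext)
       (auto simp: max_absorb2 real_min_nonneg split: split_indicator)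
  finally show ?thesis .
qed

text \<open>Stopped at \<open>s + \<tau>\<close>, the path is the path stopped at \<open>s\<close>
  plus the increments after \<open>s\<close>; the substitution \<open>u - s\<close> pulls the
  discount factor at \<open>s\<close> out of the density.\<close>

lemma pay_shift:
  assumes "regular_path d" "0 \<le> s" "0 \<le> \<tau>"
  shows "pay d (ereal s + \<tau>) = pay d (ereal s) + ennreal (exp (- \<delta> * s)) * pay (shift_path d s) \<tau>"
proof -
  let ?sh = "shift_path d s"
  have reg: "regular_path ?sh" by (rule regular_path_shift) fact+
  define F where "F u = ennreal (\<delta> * exp (- \<delta> * u) * ?sh (real_of_ereal (min (ereal u) \<tau>))) * indicator {0..} u" for u
  have [measurable]: "F \<in> borel_measurable borel"
    unfolding F_def by (rule pay_integrand_measurable) fact+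
  have split: "d (real_of_ereal (min (ereal u) (ereal s + \<tau>))) =
      d (real_of_ereal (min (ereal u) (ereal s))) + (if s \<le> u then ?sh (real_of_ereal (min (ereal (u - s)) \<tau>)) else 0)"
    if "0 \<le> u" for u
  proof (cases "s \<le> u")
    case True
    have "real_of_ereal (min (ereal u) (ereal s + \<tau>)) = s + real_of_ereal (min (ereal (u - s)) \<tau>)"
      using assms(3) by (cases \<tau>) (auto simp: min_def)
    moreover have "0 \<le> real_of_ereal (min (ereal (u - s)) \<tau>)"
      using True assms by (intro real_min_nonneg) auto
    moreover have "min (ereal u) (ereal s) = ereal s" using True by (simp add: min_def)
    moreover have "d (s + t) = d s + ?sh t" if "0 \<le> t" for t
      using that by (cases "t = 0") (auto simp: shift_path_def)
    ultimately show ?thesis using True by simp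
  next
    case False
    then have "min (ereal u) (ereal s + \<tau>) = ereal u" using assms(3) by (cases \<tau>) (auto simp: min_def)
    then show ?thesis using False by (simp add: min_def)
  qed
  have "pay d (ereal s + \<tau>) = (\<integral>\<^sup>+ u. ennreal (\<delta> * exp (- \<delta> * u) * d (real_of_ereal (min (ereal u) (ereal s)))) * indicator {0..} u
      + ennreal (exp (- \<delta> * s)) * F (u - s) \<partial>lborel)"
    unfolding pay_def
  proof (intro nn_integral_cong)
    fix u :: real
    have e: "\<delta> * exp (- \<delta> * u) = exp (- \<delta> * s) * (\<delta> * exp (- \<delta> * (u - s)))"
      by (simp add: algebra_simps flip: exp_add)
    have nn: "0 \<le> d (real_of_ereal (min (ereal u) (ereal s)))" if "0 \<le> u"
      using that assms by (intro regular_path_nonneg[OF assms(1)] real_min_nonneg) auto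
    have nn2: "0 \<le> ?sh (real_of_ereal (min (ereal (u - s)) \<tau>))" if "s \<le> u"
      using that assms by (intro regular_path_nonneg[OF reg] real_min_nonneg) auto
    consider "u < 0" | "0 \<le> u" "u < s" | "0 \<le> u" "s \<le> u" by linarith
    then show "ennreal (\<delta> * exp (- \<delta> * u) * d (real_of_ereal (min (ereal u) (ereal s + \<tau>)))) * indicator {0..} u =
      ennreal (\<delta> * exp (- \<delta> * u) * d (real_of_ereal (min (ereal u) (ereal s)))) * indicator {0..} u
      + ennreal (exp (- \<delta> * s)) * F (u - s)"
    proof cases
      case 3
      have "\<delta> * exp (- \<delta> * u) * d (real_of_ereal (min (ereal u) (ereal s + \<tau>))) =
        \<delta> * exp (- \<delta> * u) * d (real_of_ereal (min (ereal u) (ereal s))) +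
        exp (- \<delta> * s) * (\<delta> * exp (- \<delta> * (u - s)) * ?sh (real_of_ereal (min (ereal (u - s)) \<tau>)))"
      proof -
        have "a * (b + (if s \<le> u then y else 0)) = a * b + a * y" for a b y :: real
          using 3 by (simp add: distrib_left)
        then show ?thesis unfolding split[OF 3(1)] e by (simp only: mult.assoc)
      qed
      then show ?thesis
        using 3 nn nn2 pos(3) by (simp add: F_def ennreal_plus flip: ennreal_mult)
    qed (use assms(2) in \<open>auto simp: F_def split\<close>)
  qed
  also have "\<dots> = pay d (ereal s) + ennreal (exp (- \<delta> * s)) * (\<integral>\<^sup>+ u. F (u - s) \<partial>lborel)"
    unfolding pay_def using assms
    by (subst nn_integral_add) (auto intro!: pay_integrand_measurable[simplified] simp: nn_integral_cmult)
  also have "(\<integral>\<^sup>+ u. F (u - s) \<partial>lborel) = (\<integral>\<^sup>+ u. F u \<partial>lborel)"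
    by (subst nn_integral_real_affine[where c=1 and t=s]) simp_all
  finally show ?thesis by (simp add: F_def pay_def)
qed

lemma pay_0: "d 0 = 0 \<Longrightarrow> pay d 0 = 0"
proof -
  assume d: "d 0 = 0"
  have "ennreal (\<delta> * exp (- \<delta> * u) * d (real_of_ereal (min (ereal u) 0))) * indicator {0..} u = 0" for u
    using d by (auto simp: min_def zero_ereal_def split: split_indicator)
  then show ?thesis unfolding pay_def by (simp only: nn_integral_0_iff_AE nn_integral_const mult_zero_left)
qed

text \<open>The version stopped at a jump time drives the induction for the upper bound
  (\<open>strat_val_upto_le_iter\<close>); the other one values concatenated strategies
  (\<open>pay_concat\<close>).\<close>

lemma pay_Stream:
  assumes pr: "proper (e ## h)" and d: "regular_path d"
  shows "pay d (min (ruin d x (e ## h)) (jump_at (Suc k) (e ## h))) =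
    pay d (ereal (hold e)) + (if ruined d x e then 0 else ennreal (exp (- \<delta> * hold e)) *
      pay (shift_path d (hold e)) (min (ruin (shift_path d (hold e)) (surplus_after d x e) h) (jump_at k h)))"
    and "pay d (ruin d x (e ## h)) =
    pay d (ereal (hold e)) + (if ruined d x e then 0 else ennreal (exp (- \<delta> * hold e)) *
      pay (shift_path d (hold e)) (ruin (shift_path d (hold e)) (surplus_after d x e) h))"
proof -
  let ?s = "hold e" and ?r = "ruin (shift_path d (hold e)) (surplus_after d x e) h"
  have h: "proper h" "0 \<le> ?s" using pr by auto
  have j: "0 \<le> jump_at k h" by (rule proper_jump_at_nonneg[OF h(1)])
  have r: "0 \<le> ?r" by (rule ruin_nonneg[OF h(1)])
  have "min (ereal ?s + ?r) (jump_at (Suc k) (e ## h)) = ereal ?s + min ?r (ereal (jump_at k h))"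
    by (cases ?r) (auto simp: min_def)
  moreover have "min (ereal ?s) (jump_at (Suc k) (e ## h)) = ereal ?s"
    using j by (simp add: min_def)
  ultimately show "pay d (min (ruin d x (e ## h)) (jump_at (Suc k) (e ## h))) =
    pay d (ereal (hold e)) + (if ruined d x e then 0 else ennreal (exp (- \<delta> * hold e)) *
      pay (shift_path d (hold e)) (min ?r (jump_at k h)))"
    using pay_shift[OF d h(2), of "min ?r (ereal (jump_at k h))"] r j by (simp add: ruin_Stream[OF pr])
  show "pay d (ruin d x (e ## h)) =
    pay d (ereal (hold e)) + (if ruined d x e then 0 else ennreal (exp (- \<delta> * hold e)) *
      pay (shift_path d (hold e)) ?r)"
    using pay_shift[OF d h(2) r] by (simp add: ruin_Stream[OF pr])
qed

text \<open>For fixed \<open>u\<close> the integrand is constant in \<open>k\<close> as soon as the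
  \<open>k\<close>-th jump time exceeds \<open>u\<close>, which happens because the path is proper;
  monotone convergence does the rest.\<close>

lemma pay_eq_SUP_jumps:
  assumes pr: "proper h" and d: "regular_path d" and \<tau>: "0 \<le> \<tau>"
  shows "pay d \<tau> = (SUP k. pay d (min \<tau> (jump_at k h)))"
proof -
  define F where "F k u = ennreal (\<delta> * exp (- \<delta> * u) * d (real_of_ereal (min (ereal u) (min \<tau> (ereal (jump_at k h)))))) * indicator {0..} u" for k u
  define G where "G u = ennreal (\<delta> * exp (- \<delta> * u) * d (real_of_ereal (min (ereal u) \<tau>))) * indicator {0..} u" for u
  have nn: "0 \<le> min \<tau> (ereal (jump_at k h))" for k
    using \<tau> proper_jump_at_nonneg[OF pr, of k] by simp
  have le: "d (real_of_ereal (min (ereal u) a)) \<le> d (real_of_ereal (min (ereal u) b))"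
    if "0 \<le> u" "0 \<le> a" "a \<le> b" for u a b
    using that by (intro regular_path_mono[OF d] real_min_nonneg real_of_ereal_positive_mono)
      (auto simp: min.coboundedI2 min.coboundedI1 min_def)
  have inc: "F k u \<le> F l u" if "k \<le> l" for k l u
    unfolding F_def using pos(3) nn[of k] proper_jump_at_mono[OF pr that]
    by (cases "0 \<le> u") (auto intro!: ennreal_leI mult_left_mono le min.mono)
  have F_le: "F k u \<le> G u" for k u
    unfolding F_def G_def using pos(3) nn[of k]
    by (cases "0 \<le> u") (auto intro!: ennreal_leI mult_left_mono le)
  have "(SUP k. F k u) = G u" for u
  proof (rule antisym)
    show "(SUP k. F k u) \<le> G u" by (intro SUP_least F_le)
    show "G u \<le> (SUP k. F k u)"
    proof (cases "0 \<le> u")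
      case True
      obtain k where "u < jump_at (Suc k) h" using proper_ex_interval[OF pr True] by auto
      then have "min (ereal u) (min \<tau> (ereal (jump_at (Suc k) h))) = min (ereal u) \<tau>"
        by (metis less_ereal.simps(1) min.absorb4 min.assoc min.commute)
      then have "F (Suc k) u = G u" by (simp add: F_def G_def)
      then show ?thesis by (metis SUP_upper UNIV_I)
    qed (simp add: G_def)
  qed
  then have "(\<integral>\<^sup>+ u. G u \<partial>lborel) = (\<integral>\<^sup>+ u. (SUP k. F k u) \<partial>lborel)" by simp
  also have "\<dots> = (SUP k. \<integral>\<^sup>+ u. F k u \<partial>lborel)"
  proof (rule nn_integral_monotone_convergence_SUP)
    show "incseq F" using inc by (auto simp: incseq_def le_fun_def)
    show "F k \<in> borel_measurable lborel" for k
      unfolding F_def using pay_integrand_measurable[OF d nn[of k]] by simp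
  qed
  finally show ?thesis by (simp add: pay_def F_def G_def)
qed

lemma pay_jump_mono:
  fixes \<tau> :: ereal
  assumes pr: "proper h" and d: "regular_path d" and \<tau>: "0 \<le> \<tau>" and kl: "k \<le> l"
  shows "pay d (min \<tau> (jump_at k h)) \<le> pay d (min \<tau> (jump_at l h))"
  unfolding pay_def
proof (rule nn_integral_mono)
  fix u :: real
  have "0 \<le> min \<tau> (ereal (jump_at k h))"
    using \<tau> proper_jump_at_nonneg[OF pr, of k] by simp
  then have "d (real_of_ereal (min (ereal u) (min \<tau> (ereal (jump_at k h))))) \<le> d (real_of_ereal (min (ereal u) (min \<tau> (ereal (jump_at l h)))))"
    if "0 \<le> u"
    using that proper_jump_at_mono[OF pr kl]
    by (intro regular_path_mono[OF d] real_min_nonneg real_of_ereal_positive_mono min.mono) (auto simp: min_def)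
  then show "ennreal (\<delta> * exp (- \<delta> * u) * d (real_of_ereal (min (ereal u) (min \<tau> (ereal (jump_at k h)))))) * indicator {0..} u
   \<le> ennreal (\<delta> * exp (- \<delta> * u) * d (real_of_ereal (min (ereal u) (min \<tau> (ereal (jump_at l h)))))) * indicator {0..} u"
    using pos(3) by (auto intro!: ennreal_leI mult_left_mono split: split_indicator)
qed

text \<open>Its value is \<open>\<bar>x\<bar> + c / \<delta>\<close>: the mean of
  \<open>\<bar>x\<bar> + c * u\<close> at an exponential time \<open>u\<close> of rate
  \<open>\<delta>\<close>.\<close>

definition value_bound :: "real \<Rightarrow> ennreal" where
  "value_bound x = (\<integral>\<^sup>+ u. ennreal (exponential_density \<delta> u * (\<bar>x\<bar> + c * u)) \<partial>lborel)"

lemma value_bound_finite: "value_bound x < \<top>"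
proof -
  have "value_bound x \<le> (\<integral>\<^sup>+ u. ennreal \<bar>x\<bar> * ennreal (exponential_density \<delta> u * u ^ 0) + ennreal c * ennreal (exponential_density \<delta> u * u ^ 1) \<partial>lborel)"
    unfolding value_bound_def using pos
    by (intro nn_integral_mono) (auto simp: erlang_density_def distrib_left algebra_simps ennreal_mult[symmetric] ennreal_plus[symmetric] simp del: ennreal_plus)
  also have "\<dots> = ennreal \<bar>x\<bar> * ennreal (fact (0 + 0) / (fact 0 * \<delta> ^ 0)) + ennreal c * ennreal (fact (0 + 1) / (fact 0 * \<delta> ^ 1))"
    using pos by (simp add: nn_integral_add nn_integral_cmult nn_integral_erlang_ith_moment[OF pos(3), of 0 0, simplified] nn_integral_erlang_ith_moment[OF pos(3), of 0 1, simplified])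
  also have "\<dots> < \<top>" by (simp add: ennreal_mult_less_top)
  finally show ?thesis .
qed

lemma pay_le_bound:
  assumes pr: "proper h" and f: "feasible d x h" and l: "\<And>k. 0 \<le> loss (h !! k)"
  shows "pay d (ruin d x h) \<le> value_bound x"
proof -
  let ?r = "ruin d x h"
  have d: "regular_path d" using f by (simp add: feasible_def)
  have tl: "0 \<le> total_loss k h" for k by (auto simp: total_loss_def intro!: sum_nonneg l)
  have before: "d t \<le> x + c * t" if t: "0 \<le> t" "ereal t < ?r" for t
  proof -
    obtain k where "jump_at k h \<le> t" "t < jump_at (Suc k) h" using proper_ex_interval[OF pr t(1)] .
    then have "d t \<le> x + c * t - total_loss k h" using f t unfolding feasible_def by blast
    then show ?thesis using tl[of k] by linarith
  qed
  \<comment> \<open>The budget constraint holds only strictly before ruin; left-continuity carries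
    the bound to the ruin time. At \<open>t = 0\<close> only \<open>d 0 = 0\<close> is available,
    whence \<open>\<bar>x\<bar>\<close>.\<close>
  have upto: "d t \<le> \<bar>x\<bar> + c * t" if t: "0 \<le> t" "ereal t \<le> ?r" for t
  proof (cases "t = 0")
    case True then show ?thesis using d by (simp add: regular_path_def)
  next
    case False
    then have t0: "0 < t" using t by simp
    have "(d \<longlongrightarrow> d t) (at_left t)" using d t0 by (auto simp: regular_path_def continuous_within)
    moreover have "eventually (\<lambda>s. d s \<le> x + c * t) (at_left t)"
      unfolding eventually_at_left_field
    proof (intro exI[of _ 0] conjI allI impI t0)
      fix s :: real assume s: "0 < s" "s < t"
      have "ereal s < ?r" using s(2) t(2) by (meson less_ereal.simps(1) less_le_trans)
      then have "d s \<le> x + c * s" using s by (intro before) auto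
      also have "\<dots> \<le> x + c * t" using s pos by simp
      finally show "d s \<le> x + c * t" .
    qed
    ultimately have "d t \<le> x + c * t"
      by (intro tendsto_upperbound[where F="at_left t"]) (auto simp: trivial_limit_at_left_real)
    then show ?thesis by linarith
  qed
  have r0: "0 \<le> ?r" by (rule ruin_nonneg[OF pr])
  show ?thesis
    unfolding pay_def value_bound_def
  proof (rule nn_integral_mono)
    fix u :: real
    show "ennreal (\<delta> * exp (- \<delta> * u) * d (real_of_ereal (min (ereal u) ?r))) * indicator {0..} u
      \<le> ennreal (exponential_density \<delta> u * (\<bar>x\<bar> + c * u))"
    proof (cases "0 \<le> u")
      case True
      let ?m = "real_of_ereal (min (ereal u) ?r)"
      have m: "0 \<le> ?m" "ereal ?m \<le> ?r" "?m \<le> u"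
        using True r0 by (cases ?r; auto simp: min_def)+
      have "d ?m \<le> \<bar>x\<bar> + c * ?m" by (rule upto) fact+
      also have "\<dots> \<le> \<bar>x\<bar> + c * u" using m pos by simp
      finally show ?thesis
        using True pos by (auto simp: exponential_density_def mult.commute[of u \<delta>] intro!: ennreal_leI mult_left_mono)
    qed simp
  qed
qed

end

subsection \<open>Discounted dividends without Stieltjes integrals\<close>

text \<open>The integrator of \<open>dividend_measure\<close>, for a single path.\<close>

definition right_lim :: "(real \<Rightarrow> real) \<Rightarrow> real \<Rightarrow> real" where
  "right_lim d t = (if t < 0 then 0 else Lim (at_right t) d)"

context
  fixes d :: "real \<Rightarrow> real" assumes d: "regular_path d"
begin

lemma right_lim_tendsto:
  assumes "0 \<le> t" shows "(d \<longlongrightarrow> right_lim d t) (at_right t)"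
proof -
  have "(d \<longlongrightarrow> Inf (d ` ({t<..} \<inter> UNIV))) (at t within ({t<..} \<inter> UNIV))"
    using assms by (intro Lim_right_bound[where K = "d t"]) (auto intro!: regular_path_mono[OF d])
  then have "(d \<longlongrightarrow> Inf (d ` {t<..})) (at_right t)" by simp
  moreover from this have "Lim (at_right t) d = Inf (d ` {t<..})"
    by (intro tendsto_Lim) (auto simp: trivial_limit_at_right_real)
  ultimately show ?thesis using assms by (simp add: right_lim_def)
qed

lemma right_lim_ge:
  assumes "0 \<le> t" shows "d t \<le> right_lim d t"
proof (rule tendsto_lowerbound[OF right_lim_tendsto[OF assms]])
  show "eventually (\<lambda>s. d t \<le> d s) (at_right t)"
    unfolding eventually_at_right_field
    by (intro exI[of _ "t + 1"] conjI allI impI regular_path_mono[OF d assms]) simp_all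
qed (simp add: trivial_limit_at_right_real)

lemma right_lim_le:
  assumes "0 \<le> t" "t < s" shows "right_lim d t \<le> d s"
proof (rule tendsto_upperbound[OF right_lim_tendsto[OF assms(1)]])
  show "eventually (\<lambda>r. d r \<le> d s) (at_right t)"
    unfolding eventually_at_right_field
    by (intro exI[of _ s] conjI allI impI regular_path_mono[OF d]) (use assms in simp_all)
qed (simp add: trivial_limit_at_right_real)

lemma right_lim_mono: "s \<le> t \<Longrightarrow> right_lim d s \<le> right_lim d t"
proof (cases "s < 0")
  case True
  then show ?thesis
    using right_lim_ge[of t] regular_path_nonneg[OF d, of t]
    by (cases "t < 0") (auto simp: right_lim_def[of d s] right_lim_def[of d t])
next
  case False
  assume "s \<le> t"
  then show ?thesis using False right_lim_le[of s t] right_lim_ge[of t] by (cases "s = t") auto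
qed

text \<open>Right-continuity and monotonicity are what \<open>interval_measure\<close> asks of an
  integrator.\<close>

lemma right_lim_continuous: "continuous (at_right t) (right_lim d)"
proof (cases "t < 0")
  case True
  have "eventually (\<lambda>s. right_lim d s = right_lim d t) (at_right t)"
    unfolding eventually_at_right_field using True by (intro exI[of _ 0]) (auto simp: right_lim_def)
  then show ?thesis unfolding continuous_within by (rule tendsto_eventually)
next
  case False
  then have t: "0 \<le> t" by simp
  show ?thesis unfolding continuous_within
  proof (rule order_tendstoI)
    fix a assume "a < right_lim d t"
    then have "a < right_lim d s" if "t < s" for s
      using right_lim_mono[of t s] that by simp
    then show "eventually (\<lambda>s. a < right_lim d s) (at_right t)"
      by (rule eventually_mono[OF eventually_at_right_less])
  next
    fix a assume "right_lim d t < a"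
    then have "eventually (\<lambda>s. d s < a) (at_right t)"
      using right_lim_tendsto[OF t] by (rule order_tendstoD(2)[rotated])
    then obtain b where b: "t < b" "\<And>s. t < s \<Longrightarrow> s < b \<Longrightarrow> d s < a"
      unfolding eventually_at_right_field by auto
    show "eventually (\<lambda>s. right_lim d s < a) (at_right t)"
      unfolding eventually_at_right_field
    proof (intro exI[of _ b] conjI allI impI b(1))
      fix s assume s: "t < s" "s < b"
      obtain r where "s < r" "r < b" using dense s by blast
      then show "right_lim d s < a"
        using right_lim_le[of s r] b(2)[of r] s t by simp
    qed
  qed
qed

text \<open>Exhaust the interval by \<open>(-1, r k]\<close>: \<open>right_lim d (r k)\<close> lies
  between \<open>d (r k)\<close> and \<open>d b\<close>, so left-continuity at \<open>b\<close>
  gives the limit. Starting at -1 rather than at 0 captures the atom at 0, the initial lump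
  sum.\<close>

lemma emeasure_interval_measure_right_lim:
  assumes "0 \<le> b"
  shows "emeasure (interval_measure (right_lim d)) {0..<b} = ennreal (d b)"
proof (cases "b = 0")
  case True
  then show ?thesis using d by (simp add: regular_path_def)
next
  case False
  then have b: "0 < b" using assms by simp
  let ?m = "interval_measure (right_lim d)"
  have Ioc: "emeasure ?m {-1<..r} = ennreal (right_lim d r)" if "0 \<le> r" for r
  proof -
    have "emeasure ?m {-1<..r} = ennreal (right_lim d r - right_lim d (-1))"
      using that by (intro emeasure_interval_measure_Ioc right_lim_mono right_lim_continuous) simp
    then show ?thesis by (simp add: right_lim_def[of d "-1"])
  qed
  \<comment> \<open>The integrator vanishes on the negative half-line, so the part of
    \<open>(-1, b)\<close> below 0 carries no mass.\<close>
  have neg: "emeasure ?m {-1<..<0} = 0"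
  proof -
    have "emeasure ?m {-1<..-1/real (Suc (Suc k))} = 0" for k
    proof -
      have "- 1 \<le> - (1 / real (Suc (Suc k)))" by simp
      then have "emeasure ?m {-1<..-1/real (Suc (Suc k))} = ennreal (right_lim d (-1/real (Suc (Suc k))) - right_lim d (-1))"
        by (intro emeasure_interval_measure_Ioc right_lim_mono right_lim_continuous) simp
      then show ?thesis by (simp add: right_lim_def divide_neg_pos)
    qed
    then have "emeasure ?m (\<Union>k. {-1<..-1/real (Suc (Suc k))}) = 0"
      by (intro emeasure_UN_eq_0) auto
    moreover have "{-1<..<0} \<subseteq> (\<Union>k. {-1<..-1/real (Suc (Suc k))})"
    proof
      fix x :: real assume x: "x \<in> {-1<..<0}"
      then obtain k where k: "1 / (- x) < real k" using reals_Archimedean2 by blast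
      then have "1 < real k * (- x)" using x by (simp only: pos_divide_less_eq neg_0_less_iff_less greaterThanLessThan_iff)
      also have "\<dots> \<le> real (Suc (Suc k)) * (- x)" using x by (intro mult_right_mono) auto
      finally have "1 / real (Suc (Suc k)) \<le> - x" by (simp add: pos_divide_le_eq mult.commute)
      then have "x \<le> - 1 / real (Suc (Suc k))" by simp
      then show "x \<in> (\<Union>k. {-1<..-1/real (Suc (Suc k))})" using x by auto
    qed
    ultimately show ?thesis
      using emeasure_mono[of "{-1<..<0}" "\<Union>k. {-1<..-1/real (Suc (Suc k))}" ?m] by simp
  qed
  \<comment> \<open>The points increase to \<open>b\<close> but stay strictly below it; only then is
    the right limit at \<open>r k\<close> at most \<open>d b\<close>.\<close>
  define r where "r k = b - b / real (Suc (Suc k))" for k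
  have r: "0 \<le> r k" "r k < b" for k
    using b divide_left_mono[of 1 "real (Suc (Suc k))" b] by (simp_all add: r_def)
  have r_mono: "r k \<le> r l" if "k \<le> l" for k l
    using divide_left_mono[of "real (Suc (Suc k))" "real (Suc (Suc l))" b] that b by (simp add: r_def)
  have r_lim: "r \<longlonglongrightarrow> b"
  proof -
    have "(\<lambda>k. b - b * inverse (real (Suc (Suc k)))) \<longlonglongrightarrow> b - b * 0"
      by (intro tendsto_intros LIMSEQ_Suc[OF LIMSEQ_inverse_real_of_nat])
    then show ?thesis by (simp add: r_def[abs_def] divide_inverse)
  qed
  have un: "(\<Union>k. {-1<..r k}) = {-1<..<b}"
  proof (intro equalityI subsetI)
    fix x assume x: "x \<in> {-1<..<b}"
    have "eventually (\<lambda>k. x < r k) sequentially"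
      using x r_lim by (intro order_tendstoD(1)) auto
    then obtain k where "x < r k" by (auto simp: eventually_sequentially)
    then show "x \<in> (\<Union>k. {-1<..r k})" using x by (auto intro: less_imp_le)
  next
    fix x assume "x \<in> (\<Union>k. {-1<..r k})"
    then obtain k where "-1 < x" "x \<le> r k" by auto
    then show "x \<in> {-1<..<b}" using r(2)[of k] by simp
  qed
  have "(SUP k. emeasure ?m {-1<..r k}) = emeasure ?m (\<Union>k. {-1<..r k})"
    by (intro SUP_emeasure_incseq) (auto simp: incseq_def dest!: r_mono)
  then have 1: "emeasure ?m {-1<..<b} = (SUP k. ennreal (right_lim d (r k)))"
    by (simp add: un Ioc r)
  have "filterlim r (at_left b) sequentially"
    by (intro tendsto_imp_filterlim_at_left r_lim always_eventually allI r(2))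
  moreover have "(d \<longlongrightarrow> d b) (at_left b)" using d b by (auto simp: regular_path_def continuous_within)
  ultimately have dl: "(\<lambda>k. d (r k)) \<longlonglongrightarrow> d b" by (rule filterlim_compose[rotated])
  have "(\<lambda>k. right_lim d (r k)) \<longlonglongrightarrow> d b"
    by (rule tendsto_sandwich[OF _ _ dl tendsto_const])
       (auto intro!: always_eventually right_lim_ge right_lim_le r)
  then have "(\<lambda>k. ennreal (right_lim d (r k))) \<longlonglongrightarrow> ennreal (d b)" by (rule tendsto_ennrealI)
  moreover have "(\<lambda>k. ennreal (right_lim d (r k))) \<longlonglongrightarrow> (SUP k. ennreal (right_lim d (r k)))"
    by (intro LIMSEQ_SUP) (auto simp: incseq_def intro!: ennreal_leI right_lim_mono r_mono)
  ultimately have 2: "emeasure ?m {-1<..<b} = ennreal (d b)" using 1 LIMSEQ_unique by metis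
  have "emeasure ?m {-1<..<0} + emeasure ?m {0..<b} = emeasure ?m ({-1<..<0} \<union> {0..<b})"
    by (intro plus_emeasure) auto
  also have "{-1<..<0} \<union> {0..<b} = {-1<..<b}" using b by auto
  finally have "emeasure ?m {-1<..<b} = emeasure ?m {-1<..<0} + emeasure ?m {0..<b}" ..
  then show ?thesis using 2 neg by simp
qed

end

context risk begin

text \<open>The left-hand side is the tail probability at \<open>t\<close> of the exponential law of
  rate \<open>\<delta>\<close>.\<close>

lemma nn_integral_discount:
  assumes "0 \<le> t"
  shows "(\<integral>\<^sup>+ u. ennreal (\<delta> * exp (- \<delta> * u)) * indicator {t<..} u \<partial>lborel) = ennreal (exp (- \<delta> * t))"
proof -
  interpret P: prob_space "density lborel (exponential_density \<delta>)"
    by (rule prob_space_exponential_density[OF pos(3)])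
  have "distributed (density lborel (exponential_density \<delta>)) lborel (\<lambda>x. x) (exponential_density \<delta>)"
    by (auto simp: distributed_def distr_id2)
  then have "P.prob {x. t < x} = exp (- t * \<delta>)"
    using P.exponential_distributedD_gt[OF _ assms pos(3)] by simp
  then have "emeasure (density lborel (exponential_density \<delta>)) {t<..} = ennreal (exp (- t * \<delta>))"
    by (simp add: P.emeasure_eq_measure greaterThan_def)
  moreover have "emeasure (density lborel (exponential_density \<delta>)) {t<..} =
    (\<integral>\<^sup>+ u. ennreal (\<delta> * exp (- \<delta> * u)) * indicator {t<..} u \<partial>lborel)"
    using assms by (subst emeasure_density) (auto intro!: nn_integral_cong simp: exponential_density_def mult.commute split: split_indicator)
  ultimately show ?thesis by (simp add: mult.commute)
qed

text \<open>Writing \<open>exp (- \<delta> t)\<close> as the integral of \<open>\<delta> exp (- \<delta> u)\<close> over \<open>u > t\<close> and exchanging the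
  integrals removes the Stieltjes measure.\<close>

lemma discounted_dividends_eq_pay:
  assumes d: "regular_path (\<lambda>t. D t \<omega>)" and T: "0 \<le> T"
  shows "discounted_dividends R D T \<omega> = pay (\<lambda>t. D t \<omega>) T"
proof -
  let ?d = "\<lambda>t. D t \<omega>"
  let ?m = "interval_measure (right_lim ?d)"
  interpret sigma_finite_measure ?m
    by (intro sigma_finite_interval_measure right_lim_mono right_lim_continuous d)
  interpret pair_sigma_finite ?m lborel ..
  have "discounted_dividends R D T \<omega> = (\<integral>\<^sup>+ t. ennreal (exp (- \<delta> * t)) * indicator {t. 0 \<le> t \<and> ereal t < T} t \<partial>?m)"
    by (simp add: discounted_dividends_def dividend_measure_def right_lim_def[abs_def])
  also have "\<dots> = (\<integral>\<^sup>+ t. (\<integral>\<^sup>+ u. ennreal (\<delta> * exp (- \<delta> * u)) * indicator {t<..} u * indicator {t. 0 \<le> t \<and> ereal t < T} t \<partial>lborel) \<partial>?m)"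
  proof (rule nn_integral_cong)
    fix t
    have "ennreal (exp (- \<delta> * t)) * indicator {t. 0 \<le> t \<and> ereal t < T} t =
      (\<integral>\<^sup>+ u. ennreal (\<delta> * exp (- \<delta> * u)) * indicator {t<..} u \<partial>lborel) * indicator {t. 0 \<le> t \<and> ereal t < T} t"
      using nn_integral_discount[of t] by (simp split: split_indicator)
    then show "ennreal (exp (- \<delta> * t)) * indicator {t. 0 \<le> t \<and> ereal t < T} t =
      (\<integral>\<^sup>+ u. ennreal (\<delta> * exp (- \<delta> * u)) * indicator {t<..} u * indicator {t. 0 \<le> t \<and> ereal t < T} t \<partial>lborel)"
      by (simp add: nn_integral_multc)
  qed
  also have "\<dots> = (\<integral>\<^sup>+ u. (\<integral>\<^sup>+ t. ennreal (\<delta> * exp (- \<delta> * u)) * indicator {t<..} u * indicator {t. 0 \<le> t \<and> ereal t < T} t \<partial>?m) \<partial>lborel)"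
  proof (rule Fubini'[symmetric])
    define A where "A = {p :: real \<times> real. fst p < snd p \<and> 0 \<le> fst p \<and> ereal (fst p) < T}"
    have "{p \<in> space (borel \<Otimes>\<^sub>M borel). fst p < snd p \<and> 0 \<le> fst p \<and> ereal (fst p) < T} \<in> sets ((borel :: real measure) \<Otimes>\<^sub>M (borel :: real measure))"
      by measurable
    then have A: "A \<in> sets (borel \<Otimes>\<^sub>M borel)" by (simp add: A_def space_pair_measure)
    have "(\<lambda>p. ennreal (\<delta> * exp (- \<delta> * snd p)) * indicator A p) \<in> borel_measurable (borel \<Otimes>\<^sub>M borel)"
      by (intro borel_measurable_times_ennreal borel_measurable_indicator A) measurable
    moreover have "(\<lambda>(t, u). ennreal (\<delta> * exp (- \<delta> * u)) * indicator {t<..} u * indicator {t. 0 \<le> t \<and> ereal t < T} t) =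
      (\<lambda>p. ennreal (\<delta> * exp (- \<delta> * snd p)) * indicator A p)"
      by (rule ext) (simp add: A_def indicator_def split: prod.split)
    moreover have "borel_measurable (?m \<Otimes>\<^sub>M lborel) = borel_measurable (borel \<Otimes>\<^sub>M borel)"
      by (intro measurable_cong_sets sets_pair_measure_cong) simp_all
    ultimately show "(\<lambda>(t, u). ennreal (\<delta> * exp (- \<delta> * u)) * indicator {t<..} u * indicator {t. 0 \<le> t \<and> ereal t < T} t)
      \<in> borel_measurable (?m \<Otimes>\<^sub>M lborel)" by simp
  qed
  also have "\<dots> = pay ?d T"
    unfolding pay_def
  proof (intro nn_integral_cong)
    fix u :: real
    show "(\<integral>\<^sup>+ t. ennreal (\<delta> * exp (- \<delta> * u)) * indicator {t<..} u * indicator {t. 0 \<le> t \<and> ereal t < T} t \<partial>?m) =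
      ennreal (\<delta> * exp (- \<delta> * u) * D (real_of_ereal (min (ereal u) T)) \<omega>) * indicator {0..} u"
    proof (cases "0 \<le> u")
      case True
      let ?b = "real_of_ereal (min (ereal u) T)"
      have b: "0 \<le> ?b" by (rule real_min_nonneg[OF True T])
      \<comment> \<open>The conditions \<open>t < u\<close>, \<open>0 \<le> t\<close> and
        \<open>t < T\<close> say that \<open>t\<close> lies in \<open>[0, min u T)\<close>, whose
        Stieltjes mass is the value of the path at the right end.\<close>
      have "indicator {t<..} u * indicator {t. 0 \<le> t \<and> ereal t < T} t = (indicator {0..<?b} t :: ennreal)" for t
        using True T by (cases T) (auto simp: min_def indicator_def)
      then have "(\<integral>\<^sup>+ t. ennreal (\<delta> * exp (- \<delta> * u)) * indicator {t<..} u * indicator {t. 0 \<le> t \<and> ereal t < T} t \<partial>?m) =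
        (\<integral>\<^sup>+ t. ennreal (\<delta> * exp (- \<delta> * u)) * indicator {0..<?b} t \<partial>?m)"
        by (simp add: mult.assoc)
      also have "\<dots> = ennreal (\<delta> * exp (- \<delta> * u)) * ennreal (?d ?b)"
        by (simp add: nn_integral_cmult_indicator emeasure_interval_measure_right_lim[OF d b])
      also have "\<dots> = ennreal (\<delta> * exp (- \<delta> * u) * ?d ?b)"
        using pos regular_path_nonneg[OF d b] by (intro ennreal_mult[symmetric]) auto
      finally show ?thesis using True by simp
    next
      case False
      then have "ennreal (\<delta> * exp (- \<delta> * u)) * indicator {t<..} u * indicator {t. 0 \<le> t \<and> ereal t < T} t = 0" for t
        by (auto split: split_indicator)
      then have "(\<integral>\<^sup>+ t. ennreal (\<delta> * exp (- \<delta> * u)) * indicator {t<..} u * indicator {t. 0 \<le> t \<and> ereal t < T} t \<partial>?m) = 0"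
        by (simp only: nn_integral_const mult_zero_left)
      then show ?thesis using False by simp
    qed
  qed
  finally show ?thesis .
qed

end

subsection \<open>Strategies as functions of the past jumps\<close>

abbreviation mark_space :: "mark measure" where
  "mark_space \<equiv> borel \<Otimes>\<^sub>M (count_space UNIV \<Otimes>\<^sub>M (count_space UNIV \<Otimes>\<^sub>M borel))"

abbreviation path_space :: "mark stream measure" where
  "path_space \<equiv> stream_space mark_space"

lemma space_mark_space [simp]: "space mark_space = UNIV"
  by (simp add: space_pair_measure)

lemma space_path_space [simp]: "space path_space = UNIV"
  by (simp add: space_stream_space)

definition no_mark :: mark where "no_mark = (0, 0, 0, 0)"

abbreviation no_marks :: "mark stream" where "no_marks \<equiv> sconst no_mark"

text \<open>Jumps at time \<open>t\<close> itself are not part of the past: a predictable strategy cannot react to them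
  at time \<open>t\<close>. Sojourn times are positive, so \<open>no_mark\<close> is recognizable.\<close>

definition past :: "real \<Rightarrow> mark stream \<Rightarrow> mark stream" where
  "past t h = to_stream (\<lambda>k. if jump_at (Suc k) h < t then h !! k else no_mark)"

lemma to_stream_snth [simp]: "to_stream X !! k = X k"
  by (simp add: to_stream_def)

lemma past_snth: "past t h !! k = (if jump_at (Suc k) h < t then h !! k else no_mark)"
  by (simp add: past_def)

lemma stream_eqI: "(\<And>k. s !! k = t !! k) \<Longrightarrow> s = t"
  by (metis ext stream_smap_nats)

lemma past_before:
  assumes "proper (e ## h)" "t \<le> hold e"
  shows "past t (e ## h) = no_marks"
proof (rule stream_eqI)
  fix k
  have "0 \<le> jump_at k h" using assms by (intro proper_jump_at_nonneg) simp
  then show "past t (e ## h) !! k = no_marks !! k" using assms by (simp add: past_snth)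
qed

lemma past_after:
  assumes "0 < t" shows "past (hold e + t) (e ## h) = e ## past t h"
proof (rule stream_eqI)
  fix k show "past (hold e + t) (e ## h) !! k = (e ## past t h) !! k"
    using assms unfolding past_snth[of "hold e + t"] by (cases k) (simp_all add: past_snth)
qed

type_synonym strat = "real \<times> mark stream \<Rightarrow> real"

definition strat_path :: "strat \<Rightarrow> mark stream \<Rightarrow> real \<Rightarrow> real" where
  "strat_path f h t = (if t \<le> 0 then 0 else f (t, past t h))"

text \<open>Up to and including the first jump time no jump is part of the past, so the strategy is
  a deterministic function of time there (\<open>strat_path_first\<close>).\<close>

definition first_path :: "strat \<Rightarrow> real \<Rightarrow> real" where
  "first_path f t = (if t \<le> 0 then 0 else f (t, no_marks))"

text \<open>The first mark stays in the past that the continuation sees; what has been paid by the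
  first jump time is subtracted.\<close>

definition continuation :: "strat \<Rightarrow> mark \<Rightarrow> strat" where
  "continuation f e = (\<lambda>(t, h). f (hold e + t, e ## h) - first_path f (hold e))"

text \<open>The case \<open>hold (shd h) \<le> 0\<close> is that of a past without jumps.\<close>

definition concat_strat :: "strat \<Rightarrow> (mark \<Rightarrow> strat) \<Rightarrow> strat" where
  "concat_strat f g = (\<lambda>(t, h). if hold (shd h) \<le> 0 then f (t, no_marks)
     else first_path f (hold (shd h)) +
       (if t \<le> hold (shd h) then 0 else g (shd h) (t - hold (shd h), stl h)))"

definition lump_strat :: "real \<Rightarrow> strat \<Rightarrow> strat" where
  "lump_strat a f = (\<lambda>p. a + f p)"

lemma strat_path_first:
  assumes "proper (e ## h)" "t \<le> hold e"
  shows "strat_path f (e ## h) t = first_path f t"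
  by (simp add: strat_path_def first_path_def past_before[OF assms])

lemma shift_strat_path:
  assumes "proper (e ## h)"
  shows "shift_path (strat_path f (e ## h)) (hold e) = strat_path (continuation f e) h"
proof
  fix t show "shift_path (strat_path f (e ## h)) (hold e) t = strat_path (continuation f e) h t"
  proof (cases "t \<le> 0")
    case False
    then have "0 < hold e + t" using assms by simp
    then show ?thesis using False
      by (simp add: shift_path_def strat_path_first[OF assms order_refl] continuation_def)
         (simp add: strat_path_def past_after)
  qed (simp add: shift_path_def strat_path_def)
qed

lemma concat_strat_first:
  assumes "proper (e ## h)" "t \<le> hold e"
  shows "strat_path (concat_strat f g) (e ## h) t = first_path f t"
  unfolding strat_path_first[OF assms] by (simp add: first_path_def concat_strat_def no_mark_def)

lemma shift_concat_strat:
  assumes "proper (e ## h)"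
  shows "shift_path (strat_path (concat_strat f g) (e ## h)) (hold e) = strat_path (g e) h"
proof
  fix t show "shift_path (strat_path (concat_strat f g) (e ## h)) (hold e) t = strat_path (g e) h t"
  proof (cases "t \<le> 0")
    case False
    then have "0 < hold e + t" "0 < hold e" using assms by auto
    then show ?thesis using False
      by (simp add: shift_path_def concat_strat_first[OF assms order_refl])
         (simp add: strat_path_def past_after concat_strat_def)
  qed (simp add: shift_path_def strat_path_def)
qed

lemma strat_path_lump: "strat_path (lump_strat a f) h = lump_path a (strat_path f h)"
  by (auto simp: strat_path_def lump_strat_def lump_path_def)

lemma first_path_lump: "first_path (lump_strat a f) = lump_path a (first_path f)"
  by (auto simp: first_path_def lump_strat_def lump_path_def)

lemma jump_at_measurable [measurable]: "jump_at k \<in> borel_measurable path_space"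
  unfolding jump_at_def[abs_def] by measurable

lemma total_loss_measurable [measurable]: "total_loss k \<in> borel_measurable path_space"
  unfolding total_loss_def[abs_def] by measurable

lemma past_measurable [measurable]:
  "(\<lambda>p. past (fst p) (snd p)) \<in> borel \<Otimes>\<^sub>M path_space \<rightarrow>\<^sub>M path_space"
proof (rule measurable_stream_space2)
  fix k
  have "(\<lambda>p. if jump_at (Suc k) (snd p) < fst p then snd p !! k else no_mark)
    \<in> borel \<Otimes>\<^sub>M path_space \<rightarrow>\<^sub>M mark_space"
    by measurable
  then show "(\<lambda>p. past (fst p) (snd p) !! k) \<in> borel \<Otimes>\<^sub>M path_space \<rightarrow>\<^sub>M mark_space"
    by (simp add: past_snth)
qed

lemma strat_path_measurable:
  assumes [measurable]: "f \<in> borel_measurable (borel \<Otimes>\<^sub>M path_space)"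
    "t \<in> borel_measurable M" "h \<in> M \<rightarrow>\<^sub>M path_space"
  shows "(\<lambda>x. strat_path f (h x) (t x)) \<in> borel_measurable M"
proof -
  have "(\<lambda>x. past (t x) (h x)) \<in> M \<rightarrow>\<^sub>M path_space"
    using measurable_compose[OF _ past_measurable, of "\<lambda>x. (t x, h x)"] by simp
  then have [measurable]: "(\<lambda>x. (t x, past (t x) (h x))) \<in> M \<rightarrow>\<^sub>M borel \<Otimes>\<^sub>M path_space" by measurable
  show ?thesis unfolding strat_path_def by measurable
qed

lemma continuation_measurable:
  assumes [measurable]: "f \<in> borel_measurable (borel \<Otimes>\<^sub>M path_space)"
  shows "continuation f e \<in> borel_measurable (borel \<Otimes>\<^sub>M path_space)"
  unfolding continuation_def split_beta'
  by (intro borel_measurable_diff measurable_compose[OF _ assms]) auto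

lemma first_path_measurable [measurable]:
  assumes [measurable]: "f \<in> borel_measurable (borel \<Otimes>\<^sub>M path_space)"
  shows "first_path f \<in> borel_measurable borel"
proof -
  have [measurable]: "(\<lambda>t. f (t, no_marks)) \<in> borel_measurable borel"
    by (rule measurable_compose[OF _ assms]) simp
  show ?thesis unfolding first_path_def[abs_def] by measurable
qed

text \<open>The continuations must be jointly measurable in the first mark and in the remaining
  arguments. Meeting this hypothesis is the purpose of the countable family of strategies in
  \<open>opt_step_le_opt_val_eps\<close>.\<close>

lemma concat_strat_measurable:
  assumes f [measurable]: "f \<in> borel_measurable (borel \<Otimes>\<^sub>M path_space)"
    and g: "(\<lambda>(e, p). g e p) \<in> borel_measurable (mark_space \<Otimes>\<^sub>M (borel \<Otimes>\<^sub>M path_space))"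
  shows "concat_strat f g \<in> borel_measurable (borel \<Otimes>\<^sub>M path_space)"
proof -
  have [measurable]: "(\<lambda>p. f (fst p, no_marks)) \<in> borel_measurable (borel \<Otimes>\<^sub>M path_space)"
    by (rule measurable_compose[OF _ f]) simp
  have [measurable]: "(\<lambda>p. g (shd (snd p)) (fst p - hold (shd (snd p)), stl (snd p))) \<in> borel_measurable (borel \<Otimes>\<^sub>M path_space)"
    using measurable_compose[OF _ g, of "\<lambda>p. (shd (snd p), (fst p - hold (shd (snd p)), stl (snd p)))" "borel \<Otimes>\<^sub>M path_space"]
    by simp
  have [measurable]: "(\<lambda>p. first_path f (hold (shd (snd p)))) \<in> borel_measurable (borel \<Otimes>\<^sub>M path_space)"
    by (rule measurable_compose[OF _ first_path_measurable[OF f]]) measurable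
  show ?thesis unfolding concat_strat_def split_beta' by measurable
qed

context risk begin

text \<open>The index set of the infimum no longer depends on the path, which yields
  measurability.\<close>

lemma ruin_eq_INF:
  "ruin d x h = (INF k. if dest (h !! k) = claim_state \<and>
     x + c * jump_at (Suc k) h - total_loss (Suc k) h - d (jump_at (Suc k) h) < 0 then ereal (jump_at (Suc k) h) else \<infinity>)"
  unfolding ruin_def
proof (rule antisym)
  let ?P = "\<lambda>k. dest (h !! k) = claim_state \<and> x + c * jump_at (Suc k) h - total_loss (Suc k) h - d (jump_at (Suc k) h) < 0"
  show "Inf (ereal ` {jump_at (Suc k) h |k. ?P k}) \<le> (INF k. if ?P k then ereal (jump_at (Suc k) h) else \<infinity>)"
    by (intro INF_greatest) (auto intro!: Inf_lower)
  show "(INF k. if ?P k then ereal (jump_at (Suc k) h) else \<infinity>) \<le> Inf (ereal ` {jump_at (Suc k) h |k. ?P k})"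
  proof (rule Inf_greatest)
    fix y assume "y \<in> ereal ` {jump_at (Suc k) h |k. ?P k}"
    then obtain k where "?P k" "y = ereal (jump_at (Suc k) h)" by auto
    then show "(INF k. if ?P k then ereal (jump_at (Suc k) h) else \<infinity>) \<le> y"
      by (intro INF_lower2[of k]) auto
  qed
qed

lemma ruin_measurable [measurable]:
  assumes f [measurable]: "f \<in> borel_measurable (borel \<Otimes>\<^sub>M path_space)"
  shows "(\<lambda>h. ruin (strat_path f h) x h) \<in> borel_measurable path_space"
proof -
  have [measurable]: "(\<lambda>h. strat_path f h (jump_at (Suc k) h)) \<in> borel_measurable path_space" for k
    by (rule strat_path_measurable[OF f]) measurable
  show ?thesis unfolding ruin_eq_INF by measurable
qed

lemma pay_measurable:
  assumes f: "f \<in> borel_measurable (borel \<Otimes>\<^sub>M path_space)" and [measurable]: "\<tau> \<in> borel_measurable path_space"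
  shows "(\<lambda>h. pay (strat_path f h) (\<tau> h)) \<in> borel_measurable path_space"
proof -
  have [measurable]: "(\<lambda>p. strat_path f (fst p) (real_of_ereal (min (ereal (snd p)) (\<tau> (fst p))))) \<in> borel_measurable (path_space \<Otimes>\<^sub>M lborel)"
    by (rule strat_path_measurable[OF f]) measurable
  show ?thesis unfolding pay_def by measurable
qed

lemma pay_first_measurable [measurable]:
  assumes f [measurable]: "f \<in> borel_measurable (borel \<Otimes>\<^sub>M path_space)"
  shows "(\<lambda>s. pay (first_path f) (ereal s)) \<in> borel_measurable borel"
  unfolding pay_def by measurable

end

subsection \<open>Law of the path\<close>

text \<open>Open from below in the sojourn time and closed from above in the loss, because the model
  prescribes the probabilities of \<open>sojourn > s\<close> and
  \<open>claim \<le> y\<close>.\<close>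

definition mark_box :: "real \<Rightarrow> nat \<Rightarrow> nat \<Rightarrow> real \<Rightarrow> mark set" where
  "mark_box a z w y = {a<..} \<times> {z} \<times> {w} \<times> {..y}"

lemma mem_mark_box [simp]:
  "e \<in> mark_box a z w y \<longleftrightarrow> a < hold e \<and> dest e = z \<and> next_phase e = w \<and> loss e \<le> y"
  by (cases e) (auto simp: mark_box_def)

lemma mark_box_sets [measurable]: "mark_box a z w y \<in> sets mark_space"
  unfolding mark_box_def by (intro pair_measureI) auto

text \<open>The empty set is added for stability under intersection.\<close>

definition mark_boxes :: "mark set set" where
  "mark_boxes = insert {} (range (\<lambda>(a, z, w, y). mark_box a z w y))"

lemma mark_box_in [simp]: "mark_box a z w y \<in> mark_boxes"
  unfolding mark_boxes_def by (rule insertI2, rule range_eqI[of _ _ "(a, z, w, y)"]) simp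

lemma Int_stable_mark_boxes: "Int_stable mark_boxes"
proof (rule Int_stableI)
  fix A B assume "A \<in> mark_boxes" "B \<in> mark_boxes"
  moreover have "mark_box a z w y \<inter> mark_box a' z' w' y' \<in> mark_boxes" for a z w y a' z' w' y'
  proof (cases "z = z' \<and> w = w'")
    case True
    then have "mark_box a z w y \<inter> mark_box a' z' w' y' = mark_box (max a a') z w (min y y')"
      by (auto simp: mark_box_def)
    then show ?thesis by simp
  next
    case False
    then have "mark_box a z w y \<inter> mark_box a' z' w' y' = {}" by (auto simp: mark_box_def)
    then show ?thesis by (simp add: mark_boxes_def)
  qed
  moreover have "C = {} \<or> (\<exists>a z w y. C = mark_box a z w y)" if "C \<in> mark_boxes" for C
    using that by (auto simp: mark_boxes_def)
  moreover have "{} \<in> mark_boxes" by (simp add: mark_boxes_def)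
  ultimately show "A \<inter> B \<in> mark_boxes" by (metis Int_empty_left Int_empty_right)
qed

text \<open>The generators of the factors are combined from the innermost product outwards; each use
  of \<open>sets_pair_eq\<close> needs a countable cover of both factors by generators.\<close>

lemma sets_mark_space_eq_boxes: "sets mark_space = sets (sigma UNIV mark_boxes)"
proof (rule antisym)
  let ?N = "range (\<lambda>z::nat. {z})"
  have 1: "sets (count_space UNIV \<Otimes>\<^sub>M (borel :: real measure)) = sets (sigma UNIV {a \<times> b |a b. a \<in> ?N \<and> b \<in> range (\<lambda>a. {..a})})"
  proof (subst sets_pair_eq[where Ea="?N" and Ca="?N" and Eb="range (\<lambda>a::real. {..a})" and Cb="range (\<lambda>k. {..real k})"])
    show "sets borel = sigma_sets (space borel) (range (\<lambda>a::real. {..a}))"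
      by (subst borel_eq_atMost) simp
    show "\<Union> (range (\<lambda>k. {..real k})) = space borel"
      using real_arch_simple by auto
  qed (auto simp: sigma_sets_singletons)
  have 2: "sets (count_space UNIV \<Otimes>\<^sub>M (count_space UNIV \<Otimes>\<^sub>M (borel :: real measure))) =
     sets (sigma UNIV {a \<times> b |a b. a \<in> ?N \<and> b \<in> {a \<times> b |a b. a \<in> ?N \<and> b \<in> range (\<lambda>a. {..a})}})"
  proof (subst sets_pair_eq[where Ea="?N" and Ca="?N" and Eb="{a \<times> b |a b. a \<in> ?N \<and> b \<in> range (\<lambda>a. {..a})}"
      and Cb="(\<lambda>(z, k). {z} \<times> {..real k}) ` UNIV"])
    show "sets (count_space UNIV \<Otimes>\<^sub>M borel) = sigma_sets (space (count_space UNIV \<Otimes>\<^sub>M borel)) {a \<times> b |a b. a \<in> ?N \<and> b \<in> range (\<lambda>a::real. {..a})}"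
      using 1 by (simp add: space_pair_measure)
    show "\<Union> ((\<lambda>(z::nat, k). {z} \<times> {..real k}) ` UNIV) = space (count_space UNIV \<Otimes>\<^sub>M borel)"
      using real_arch_simple by (auto simp: space_pair_measure)
  qed (auto simp: sigma_sets_singletons space_pair_measure)
  have 3: "sets mark_space =
     sets (sigma UNIV {a \<times> b |a b. a \<in> range (\<lambda>a. {a<..}) \<and> b \<in> {a \<times> b |a b. a \<in> ?N \<and> b \<in> {a \<times> b |a b. a \<in> ?N \<and> b \<in> range (\<lambda>a. {..a})}}})"
  proof (subst sets_pair_eq[where Ea="range (\<lambda>a::real. {a<..})" and Ca="range (\<lambda>k. {-real k<..})" and Eb="{a \<times> b |a b. a \<in> ?N \<and> b \<in> {a \<times> b |a b. a \<in> ?N \<and> b \<in> range (\<lambda>a. {..a})}}"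
      and Cb="(\<lambda>(z, w, k). {z} \<times> {w} \<times> {..real k}) ` UNIV"])
    show "sets borel = sigma_sets (space borel) (range (\<lambda>a::real. {a<..}))"
      by (subst borel_Ioi) simp
    show "sets (count_space UNIV \<Otimes>\<^sub>M (count_space UNIV \<Otimes>\<^sub>M borel)) = sigma_sets (space (count_space UNIV \<Otimes>\<^sub>M (count_space UNIV \<Otimes>\<^sub>M borel)))
       {a \<times> b |a b. a \<in> ?N \<and> b \<in> {a \<times> b |a b. a \<in> ?N \<and> b \<in> range (\<lambda>a::real. {..a})}}"
      using 2 by (simp add: space_pair_measure)
    show "\<Union> ((\<lambda>(z::nat, w::nat, k). {z} \<times> {w} \<times> {..real k}) ` UNIV) = space (count_space UNIV \<Otimes>\<^sub>M (count_space UNIV \<Otimes>\<^sub>M borel))"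
      using real_arch_simple by (auto simp: space_pair_measure)
    show "\<Union> (range (\<lambda>k. {- real k<..})) = space borel"
    proof (intro equalityI subsetI)
      fix x :: real
      obtain k where "- x < real k" using reals_Archimedean2 by blast
      then show "x \<in> \<Union> (range (\<lambda>k. {- real k<..}))" by (auto intro!: exI[of _ k])
    qed simp
    show "(\<lambda>(z::nat, w::nat, k). {z} \<times> {w} \<times> {..real k}) ` UNIV \<subseteq> {a \<times> b |a b. a \<in> ?N \<and> b \<in> {a \<times> b |a b. a \<in> ?N \<and> b \<in> range (\<lambda>a. {..a})}}"
    proof
      fix A assume "A \<in> (\<lambda>(z::nat, w::nat, k). {z} \<times> {w} \<times> {..real k}) ` UNIV"
      then obtain z w k where "A = {z} \<times> ({w} \<times> {..real k})" by auto
      then show "A \<in> {a \<times> b |a b. a \<in> ?N \<and> b \<in> {a \<times> b |a b. a \<in> ?N \<and> b \<in> range (\<lambda>a. {..a})}}"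
        by (intro CollectI exI[of _ "{z}"] exI[of _ "{w} \<times> {..real k}"] exI[of _ "{w}"] exI[of _ "{..real k}"] conjI) auto
    qed
  qed (auto simp: space_pair_measure)
  show "sets mark_space \<subseteq> sets (sigma UNIV mark_boxes)"
    unfolding 3
  proof (subst sigma_le_sets, simp, intro conjI)
    show "UNIV \<in> sets (sigma UNIV mark_boxes)" using sets.top[of "sigma UNIV mark_boxes"] by simp
    show "{a \<times> b |a b. a \<in> range (\<lambda>a. {a<..}) \<and> b \<in> {a \<times> b |a b. a \<in> ?N \<and> b \<in> {a \<times> b |a b. a \<in> ?N \<and> b \<in> range (\<lambda>a. {..a})}}} \<subseteq> sets (sigma UNIV mark_boxes)"
    proof
      fix A assume "A \<in> {a \<times> b |a b. a \<in> range (\<lambda>a::real. {a<..}) \<and> b \<in> {a \<times> b |a b. a \<in> ?N \<and> b \<in> {a \<times> b |a b. a \<in> ?N \<and> b \<in> range (\<lambda>a::real. {..a})}}}"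
      then obtain a z w y where "A = mark_box a z w y" unfolding mark_box_def by blast
      then show "A \<in> sets (sigma UNIV mark_boxes)" by (auto intro!: sigma_sets.Basic simp del: mem_mark_box)
    qed
  qed
  show "sets (sigma UNIV mark_boxes) \<subseteq> sets mark_space"
  proof -
    have "mark_boxes \<subseteq> sets mark_space"
      unfolding mark_boxes_def by (auto intro: mark_box_sets simp del: mem_mark_box)
    moreover have "UNIV \<in> sets mark_space" using sets.top[of mark_space] by simp
    ultimately show ?thesis by (subst sigma_le_sets) simp_all
  qed
qed

text \<open>Cylinders over boxes form an intersection-stable generator. A cylinder with an empty
  factor is empty, so only cylinders over genuine boxes have to be compared.\<close>

lemma path_measure_eqI:
  assumes "prob_space M" "prob_space N" "sets M = sets path_space" "sets N = sets path_space"
    and eq: "\<And>ps. emeasure M (scylinder UNIV (map (\<lambda>(a, z, w, y). mark_box a z w y) ps)) =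
       emeasure N (scylinder UNIV (map (\<lambda>(a, z, w, y). mark_box a z w y) ps))"
  shows "M = N"
proof (rule stream_space_eq_scylinder[OF assms(1,2) Int_stable_mark_boxes, where S=mark_space
    and C="(\<lambda>(k, z, w, l). mark_box (- real k) z w (real l)) ` UNIV"])
  show "\<Union> ((\<lambda>(k, z, w, l). mark_box (- real k) z w (real l)) ` UNIV) = space mark_space"
  proof (simp, intro equalityI subsetI)
    fix e :: mark
    obtain k where "- hold e < real k" using reals_Archimedean2 by blast
    moreover obtain l where "loss e \<le> real l" using real_arch_simple by blast
    ultimately have "e \<in> mark_box (- real k) (dest e) (next_phase e) (real l)" by simp
    then show "e \<in> (\<Union>(k, z, w, l). mark_box (- real k) z w (real l))" by blast
  qed simp
  show "(\<lambda>(k, z, w, l). mark_box (- real k) z w (real l)) ` UNIV \<subseteq> mark_boxes"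
    by (auto simp: mark_boxes_def image_iff)
  show "emeasure M (scylinder (space mark_space) xs) = emeasure N (scylinder (space mark_space) xs)"
    if "xs \<in> lists mark_boxes" for xs
  proof (cases "{} \<in> set xs")
    case True
    then have "scylinder UNIV xs = {}" by (induction xs) auto
    then show ?thesis by simp
  next
    case False
    with that have "set xs \<subseteq> range (\<lambda>(a, z, w, y). mark_box a z w y)" by (auto simp: mark_boxes_def)
    then have "xs \<in> map (\<lambda>(a, z, w, y). mark_box a z w y) ` lists UNIV"
      unfolding lists_image[symmetric] by auto
    then obtain ps where "xs = map (\<lambda>(a, z, w, y). mark_box a z w y) ps" by blast
    then show ?thesis using eq by simp
  qed
qed (use assms sets_mark_space_eq_boxes in \<open>auto simp: mark_boxes_def\<close>)

section \<open>The law of the first jump\<close>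

context risk begin

lemma rate_pos: "i \<in> {1..n} \<Longrightarrow> 0 < total_intensity R i"
  and intensity_nonneg: "i \<in> {1..n} \<Longrightarrow> z \<in> {1..n + 1} \<Longrightarrow> z \<noteq> i \<Longrightarrow> 0 \<le> intensity R i z"
  and restart_nonneg: "i \<in> {1..n} \<Longrightarrow> 0 \<le> restart R i"
  and restart_sum: "(\<Sum>i\<in>{1..n}. restart R i) = 1"
  using model by (auto simp: phase_type_risk_model_def valid_parameters_def)

text \<open>Joint probability of the target and of the phase after a possible restart; the value 0
  outside the legal states makes it a probability mass function on all pairs of naturals.\<close>

definition step_prob :: "nat \<Rightarrow> nat \<times> nat \<Rightarrow> real" where
  "step_prob i p = (if p \<in> {1..n + 1} \<times> {1..n} then jump_prob R i (fst p) * restart_prob R (fst p) (snd p) else 0)"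

lemma jump_prob_nonneg: "i \<in> {1..n} \<Longrightarrow> z \<in> {1..n + 1} \<Longrightarrow> 0 \<le> jump_prob R i z"
  using rate_pos[of i] intensity_nonneg[of i z] by (auto simp: jump_prob_def)

lemma restart_prob_nonneg: "w \<in> {1..n} \<Longrightarrow> 0 \<le> restart_prob R z w"
  using restart_nonneg by (auto simp: restart_prob_def)

lemma step_prob_nonneg: "i \<in> {1..n} \<Longrightarrow> 0 \<le> step_prob i p"
  by (auto simp: step_prob_def intro!: mult_nonneg_nonneg jump_prob_nonneg restart_prob_nonneg)

lemma restart_prob_sum:
  assumes "z \<in> {1..n + 1}" shows "(\<Sum>w\<in>{1..n}. restart_prob R z w) = 1"
proof (cases "z = n + 1")
  case False
  then have "(\<Sum>w\<in>{1..n}. restart_prob R z w) = (\<Sum>w\<in>{1..n}. if w = z then 1 else 0)"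
    by (intro sum.cong) (auto simp: restart_prob_def)
  then show ?thesis using False assms by simp
qed (use restart_sum in \<open>simp add: restart_prob_def\<close>)

lemma step_prob_sum:
  assumes i: "i \<in> {1..n}" shows "(\<Sum>p\<in>{1..n + 1} \<times> {1..n}. step_prob i p) = 1"
proof -
  have "(\<Sum>p\<in>{1..n + 1} \<times> {1..n}. step_prob i p) = (\<Sum>z\<in>{1..n+1}. \<Sum>w\<in>{1..n}. jump_prob R i z * restart_prob R z w)"
    by (simp add: sum.cartesian_product step_prob_def split_beta' del: sum.op_ivl_Suc)
  also have "\<dots> = (\<Sum>z\<in>{1..n+1}. jump_prob R i z)"
  proof (intro sum.cong refl)
    fix z assume "z \<in> {1..n + 1}"
    from restart_prob_sum[OF this] show "(\<Sum>w\<in>{1..n}. jump_prob R i z * restart_prob R z w) = jump_prob R i z"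
      by (simp only: sum_distrib_left[symmetric] mult_1_right)
  qed
  also have "\<dots> = (\<Sum>z\<in>{1..n+1} - {i}. intensity R i z / total_intensity R i)"
    using i by (intro sum.mono_neutral_cong_right) (auto simp: jump_prob_def)
  also have "\<dots> = 1"
    using rate_pos[OF i] by (simp add: total_intensity_def flip: sum_divide_distrib)
  finally show ?thesis .
qed

definition step_pmf :: "nat \<Rightarrow> (nat \<times> nat) pmf" where
  "step_pmf i = embed_pmf (step_prob i)"

lemma pmf_step:
  assumes i: "i \<in> {1..n}" shows "pmf (step_pmf i) p = step_prob i p"
  unfolding step_pmf_def
proof (rule pmf_embed_pmf)
  have "(\<integral>\<^sup>+x. ennreal (step_prob i x) \<partial>count_space UNIV) = (\<Sum>p\<in>{1..n + 1} \<times> {1..n}. ennreal (step_prob i p))"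
    by (rule nn_integral_count_space') (auto simp: step_prob_def)
  also have "\<dots> = 1"
    using step_prob_sum[OF i] step_prob_nonneg[OF i] by (subst sum_ennreal) auto
  finally show "(\<integral>\<^sup>+x. ennreal (step_prob i x) \<partial>count_space UNIV) = 1" .
qed (rule step_prob_nonneg[OF i])

abbreviation exp_law :: "real \<Rightarrow> real measure" where
  "exp_law r \<equiv> density lborel (exponential_density r)"

text \<open>A claim size is drawn at every jump but recorded only if a claim occurs; thus the mark
  is a function of three independent components.\<close>

definition mk_mark :: "(nat \<times> nat) \<times> real \<times> real \<Rightarrow> mark" where
  "mk_mark = (\<lambda>(p, s, y). (s, fst p, snd p, if fst p = claim_state then y else 0))"

definition first_law :: "nat \<Rightarrow> mark measure" where
  "first_law i = distr (measure_pmf (step_pmf i) \<Otimes>\<^sub>M (exp_law (total_intensity R i) \<Otimes>\<^sub>M exp_law \<beta>)) mark_space mk_mark"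

lemma mk_mark_measurable [measurable]:
  "mk_mark \<in> measure_pmf q \<Otimes>\<^sub>M (exp_law r \<Otimes>\<^sub>M exp_law s) \<rightarrow>\<^sub>M mark_space"
proof -
  have [measurable]: "(\<lambda>x. f (fst x)) \<in> measure_pmf q \<Otimes>\<^sub>M (exp_law r \<Otimes>\<^sub>M exp_law s) \<rightarrow>\<^sub>M count_space UNIV" for f :: "nat \<times> nat \<Rightarrow> nat"
    by (rule measurable_compose[OF measurable_fst]) simp
  show ?thesis unfolding mk_mark_def split_beta' by measurable
qed

lemma sets_first_law [simp, measurable_cong]: "sets (first_law i) = sets mark_space"
  by (simp add: first_law_def)

lemma space_first_law [simp]: "space (first_law i) = UNIV"
  by (simp add: first_law_def)

lemma prob_space_first_law:
  assumes "i \<in> {1..n}" shows "prob_space (first_law i)"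
  unfolding first_law_def using rate_pos[OF assms] pos
  by (intro prob_space.prob_space_distr prob_space_pair measure_pmf.prob_space_axioms prob_space_exponential_density mk_mark_measurable)

lemma nn_integral_first_law:
  assumes i: "i \<in> {1..n}" and F [measurable]: "F \<in> borel_measurable mark_space"
  shows "(\<integral>\<^sup>+e. F e \<partial>first_law i) = (\<Sum>p\<in>{1..n + 1} \<times> {1..n}. ennreal (step_prob i p) *
     (\<integral>\<^sup>+s. \<integral>\<^sup>+y. F (mk_mark (p, s, y)) \<partial>exp_law \<beta> \<partial>exp_law (total_intensity R i)))"
proof -
  let ?A = "exp_law (total_intensity R i)" and ?B = "exp_law \<beta>"
  interpret A: prob_space ?A by (rule prob_space_exponential_density[OF rate_pos[OF i]])
  interpret B: prob_space ?B by (rule prob_space_exponential_density[OF pos(2)])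
  interpret AB: pair_prob_space ?A ?B ..
  have "(\<integral>\<^sup>+e. F e \<partial>first_law i) = (\<integral>\<^sup>+q. F (mk_mark q) \<partial>(measure_pmf (step_pmf i) \<Otimes>\<^sub>M (?A \<Otimes>\<^sub>M ?B)))"
    unfolding first_law_def by (rule nn_integral_distr) measurable
  also have "\<dots> = (\<integral>\<^sup>+p. \<integral>\<^sup>+q. F (mk_mark (p, q)) \<partial>(?A \<Otimes>\<^sub>M ?B) \<partial>measure_pmf (step_pmf i))"
    by (rule AB.nn_integral_fst[symmetric]) measurable
  also have "\<dots> = (\<Sum>p\<in>{1..n + 1} \<times> {1..n}. (\<integral>\<^sup>+q. F (mk_mark (p, q)) \<partial>(?A \<Otimes>\<^sub>M ?B)) * ennreal (pmf (step_pmf i) p))"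
    by (rule nn_integral_measure_pmf_support) (auto simp: set_pmf_iff pmf_step[OF i] step_prob_def)
  also have "\<dots> = (\<Sum>p\<in>{1..n + 1} \<times> {1..n}. ennreal (step_prob i p) *
     (\<integral>\<^sup>+s. \<integral>\<^sup>+y. F (mk_mark (p, s, y)) \<partial>?B \<partial>?A))"
  proof (intro sum.cong refl)
    fix p
    have "(\<lambda>q. (fst q, fst p, snd p, if fst p = claim_state then snd q else 0)) \<in> ?A \<Otimes>\<^sub>M ?B \<rightarrow>\<^sub>M mark_space"
      by measurable
    then have "(\<lambda>q. mk_mark (p, q)) \<in> ?A \<Otimes>\<^sub>M ?B \<rightarrow>\<^sub>M mark_space"
      by (simp add: mk_mark_def split_beta' cong: if_cong)
    then have "(\<lambda>q. F (mk_mark (p, q))) \<in> borel_measurable (?A \<Otimes>\<^sub>M ?B)" by measurable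
    then show "(\<integral>\<^sup>+q. F (mk_mark (p, q)) \<partial>(?A \<Otimes>\<^sub>M ?B)) * ennreal (pmf (step_pmf i) p) =
      ennreal (step_prob i p) * (\<integral>\<^sup>+s. \<integral>\<^sup>+y. F (mk_mark (p, s, y)) \<partial>?B \<partial>?A)"
      by (simp add: B.nn_integral_fst[symmetric] pmf_step[OF i] mult.commute)
  qed
  finally show ?thesis .
qed

text \<open>The maxima with 0 admit arbitrary real thresholds for the nonnegative sojourn times and
  claims; without a claim the loss is 0, so its threshold only has to be nonnegative.\<close>

definition box_prob :: "nat \<Rightarrow> real \<Rightarrow> nat \<Rightarrow> nat \<Rightarrow> real \<Rightarrow> real" where
  "box_prob i a z w y = exp (- total_intensity R i * max 0 a) * step_prob i (z, w) *
     (if z = claim_state then 1 - exp (- \<beta> * max 0 y) else if 0 \<le> y then 1 else 0)"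

lemma emeasure_exp_law_atMost:
  assumes "0 < r" shows "emeasure (exp_law r) {..y} = ennreal (1 - exp (- r * max 0 y))"
proof -
  have "emeasure (exp_law r) {..y} = (\<integral>\<^sup>+ x. ennreal (erlang_density 0 r x) * indicator {..y} x \<partial>lborel)"
    by (subst emeasure_density) auto
  then show ?thesis using nn_integral_erlang_density[OF assms, of 0 y] by (auto simp: erlang_CDF_0 max_def)
qed

lemma emeasure_exp_law_greaterThan:
  assumes r: "0 < r" shows "emeasure (exp_law r) {a<..} = ennreal (exp (- r * max 0 a))"
proof -
  interpret prob_space "exp_law r" by (rule prob_space_exponential_density[OF r])
  have "{a<..} = space (exp_law r) - {..a}" by auto
  then have "emeasure (exp_law r) {a<..} = ennreal (1 - prob {..a})"
    using prob_compl[of "{..a}"] by (simp add: emeasure_eq_measure)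
  moreover have "prob {..a} = 1 - exp (- r * max 0 a)"
    using r unfolding measure_def emeasure_exp_law_atMost[OF r] by (simp add: enn2real_ennreal)
  ultimately show ?thesis by simp
qed

lemma emeasure_first_law_box:
  assumes i: "i \<in> {1..n}"
  shows "emeasure (first_law i) (mark_box a z w y) = ennreal (box_prob i a z w y)"
proof -
  let ?A = "exp_law (total_intensity R i)" and ?B = "exp_law \<beta>"
  interpret A: prob_space ?A by (rule prob_space_exponential_density[OF rate_pos[OF i]])
  interpret B: prob_space ?B by (rule prob_space_exponential_density[OF pos(2)])
  let ?y = "if z = claim_state then {..y} else if 0 \<le> y then UNIV else {}"
  have "emeasure (first_law i) (mark_box a z w y) = (\<integral>\<^sup>+e. indicator (mark_box a z w y) e \<partial>first_law i)"
    by (simp add: mark_box_sets)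
  also have "\<dots> = (\<Sum>p\<in>{1..n + 1} \<times> {1..n}. ennreal (step_prob i p) *
     (\<integral>\<^sup>+s. \<integral>\<^sup>+v. indicator (mark_box a z w y) (mk_mark (p, s, v)) \<partial>?B \<partial>?A))"
    by (rule nn_integral_first_law[OF i]) (simp add: mark_box_sets)
  also have "\<dots> = (\<Sum>p\<in>{1..n + 1} \<times> {1..n}. if p = (z, w) then ennreal (step_prob i p) * (emeasure ?A {a<..} * emeasure ?B ?y) else 0)"
  proof (intro sum.cong refl)
    fix p
    have "indicator (mark_box a z w y) (mk_mark (p, s, v)) =
      (if p = (z, w) then indicator {a<..} s * indicator ?y v else 0 :: ennreal)" for s v
      by (cases p) (auto simp: mk_mark_def indicator_def)
    then show "ennreal (step_prob i p) * (\<integral>\<^sup>+s. \<integral>\<^sup>+v. indicator (mark_box a z w y) (mk_mark (p, s, v)) \<partial>?B \<partial>?A) =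
      (if p = (z, w) then ennreal (step_prob i p) * (emeasure ?A {a<..} * emeasure ?B ?y) else 0)"
      by (auto simp: nn_integral_cmult nn_integral_multc)
  qed
  also have "\<dots> = ennreal (step_prob i (z, w)) * (emeasure ?A {a<..} * emeasure ?B ?y)"
    by (auto simp: step_prob_def)
  also have "emeasure ?B ?y = ennreal (if z = claim_state then 1 - exp (- \<beta> * max 0 y) else if 0 \<le> y then 1 else 0)"
    using B.emeasure_space_1 emeasure_exp_law_atMost[OF pos(2)] by auto
  finally show ?thesis
    using step_prob_nonneg[OF i] pos(2)
    by (simp add: emeasure_exp_law_greaterThan[OF rate_pos[OF i]] box_prob_def ennreal_mult[symmetric] mult_ac)
qed

section \<open>From the probability space of the model to the law of the path\<close>

lemma model_law:
  assumes "i \<in> {1..n}"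
  shows "prob_space (law R i)" "sets (law R i) = sets (law R 1)" "phase_law R i" "claim_law R i"
  using model assms unfolding phase_type_risk_model_def by blast+

lemma one_phase: "1 \<in> {1..n}"
  using restart_sum by (cases "n = 0") auto

lemma law_measurable:
  assumes "i \<in> {1..n}"
  shows "sojourn R k \<in> borel_measurable (law R i)"
    "target R (Suc k) \<in> measurable (law R i) (count_space UNIV)"
    "phase R k \<in> measurable (law R i) (count_space UNIV)"
    "0 < k \<Longrightarrow> claim R k \<in> borel_measurable (law R i)"
proof -
  show "sojourn R k \<in> borel_measurable (law R i)" "target R (Suc k) \<in> measurable (law R i) (count_space UNIV)"
    "phase R k \<in> measurable (law R i) (count_space UNIV)"
    using model_law(3)[OF assms] by (simp_all add: phase_law_def)
  have "prob_space.indep_vars (law R i) (\<lambda>_. borel) (claim R) {1..}"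
    using model_law(4)[OF assms] by (simp add: claim_law_def)
  then show "0 < k \<Longrightarrow> claim R k \<in> borel_measurable (law R i)"
    unfolding prob_space.indep_vars_def2[OF model_law(1)[OF assms]] by simp
qed

definition claim_count :: "nat \<Rightarrow> 'a \<Rightarrow> nat" where
  "claim_count k \<omega> = (\<Sum>l<k. if target R (Suc l) \<omega> = claim_state then 1 else 0)"

text \<open>Claims are numbered by their order, not by jumps: a claim at jump \<open>Suc k\<close>
  has the random number \<open>Suc (claim_count k \<omega>)\<close>.\<close>

definition mark_at :: "nat \<Rightarrow> 'a \<Rightarrow> mark" where
  "mark_at k \<omega> = (sojourn R k \<omega>, target R (Suc k) \<omega>, phase R (Suc k) \<omega>,
     if target R (Suc k) \<omega> = claim_state then claim R (Suc (claim_count k \<omega>)) \<omega> else 0)"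

definition marks :: "'a \<Rightarrow> mark stream" where
  "marks \<omega> = to_stream (\<lambda>k. mark_at k \<omega>)"

lemma marks_snth: "marks \<omega> !! k = mark_at k \<omega>"
  by (simp add: marks_def)

lemma claim_count_measurable:
  assumes "i \<in> {1..n}" shows "claim_count k \<in> measurable (law R i) (count_space UNIV)"
proof -
  note [measurable] = law_measurable[OF assms]
  show ?thesis unfolding claim_count_def[abs_def] by measurable
qed

lemma marks_measurable:
  assumes i: "i \<in> {1..n}" shows "marks \<in> law R i \<rightarrow>\<^sub>M path_space"
proof (rule measurable_stream_space2)
  fix k
  note [measurable] = law_measurable(1-3)[OF i] claim_count_measurable[OF i]
  \<comment> \<open>The claim number is random but takes countably many values.\<close>
  have [measurable]: "(\<lambda>\<omega>. claim R (Suc (claim_count k \<omega>)) \<omega>) \<in> borel_measurable (law R i)"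
    by (rule measurable_compose_countable[OF law_measurable(4)[OF i]]) (simp, measurable)
  have "mark_at k \<in> law R i \<rightarrow>\<^sub>M mark_space"
    unfolding mark_at_def[abs_def] by measurable
  then show "(\<lambda>\<omega>. marks \<omega> !! k) \<in> law R i \<rightarrow>\<^sub>M mark_space" by (simp add: marks_snth)
qed

text \<open>Indices that are not phases are sent to phase \<open>1\<close>, so that \<open>path_law\<close> is a probability measure for
  every index.\<close>

definition path_law :: "nat \<Rightarrow> mark stream measure" where
  "path_law i = distr (law R (if i \<in> {1..n} then i else 1)) path_space marks"

lemma sets_path_law [simp, measurable_cong]: "sets (path_law i) = sets path_space"
  by (simp add: path_law_def)

lemma space_path_law [simp]: "space (path_law i) = UNIV"
  by (simp add: path_law_def)

lemma prob_space_path_law: "prob_space (path_law i)"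
  unfolding path_law_def using one_phase
  by (intro prob_space.prob_space_distr marks_measurable model_law) auto

text \<open>The marks in the list serve as thresholds: \<open>(a, z, w, y)\<close> asks for a
  sojourn above \<open>a\<close>, target \<open>z\<close>, new phase \<open>w\<close> and, in
  \<open>claim_event\<close> and \<open>cyl\<close>, a loss of at most \<open>y\<close>.\<close>

definition phase_event :: "nat \<Rightarrow> mark list \<Rightarrow> 'a set" where
  "phase_event i ps = {\<omega> \<in> space (law R i). phase R 0 \<omega> = i \<and>
     (\<forall>k<length ps. sojourn R k \<omega> > fst (ps ! k) \<and> target R (Suc k) \<omega> = fst (snd (ps ! k)) \<and>
        phase R (Suc k) \<omega> = fst (snd (snd (ps ! k))))}"

text \<open>Recursive form of the product in \<open>phase_law\<close>: the phase reached in the head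
  is the starting phase of the tail, which fits the decomposition at the first jump.\<close>

primrec phase_event_prob :: "nat \<Rightarrow> mark list \<Rightarrow> real" where
  "phase_event_prob i [] = 1"
| "phase_event_prob i (p # ps) =
     exp (- total_intensity R i * fst p) * (jump_prob R i (fst (snd p)) * restart_prob R (fst (snd p)) (fst (snd (snd p)))) *
     phase_event_prob (fst (snd (snd p))) ps"

lemma phase_event_prob_eq_prod:
  "phase_event_prob i ps = (\<Prod>k<length ps. exp (- total_intensity R (case k of 0 \<Rightarrow> i | Suc j \<Rightarrow> fst (snd (snd (ps ! j)))) * fst (ps ! k)) *
     jump_prob R (case k of 0 \<Rightarrow> i | Suc j \<Rightarrow> fst (snd (snd (ps ! j)))) (fst (snd (ps ! k))) *
     restart_prob R (fst (snd (ps ! k))) (fst (snd (snd (ps ! k)))))"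
proof (induction ps arbitrary: i)
  case (Cons p ps)
  have eq: "(case k of 0 \<Rightarrow> fst (snd (snd p)) | Suc j \<Rightarrow> fst (snd (snd (ps ! j)))) = fst (snd (snd ((p # ps) ! k)))" for k
    by (cases k) auto
  show ?case
    by (simp add: prod.lessThan_Suc_shift Cons.IH[of "fst (snd (snd p))", unfolded eq] del: prod.lessThan_Suc)
qed simp

text \<open>The thresholds for which \<open>phase_law\<close> prescribes a probability.\<close>

definition legal :: "mark list \<Rightarrow> bool" where
  "legal ps \<longleftrightarrow> (\<forall>p\<in>set ps. 0 \<le> fst p \<and> fst (snd p) \<in> {1..n + 1} \<and> fst (snd (snd p)) \<in> {1..n})"

lemma measure_phase_event:
  assumes i: "i \<in> {1..n}" and ps: "legal ps"
  shows "measure (law R i) (phase_event i ps) = phase_event_prob i ps"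
proof -
  let ?w = "\<lambda>k. case k of 0 \<Rightarrow> i | Suc j \<Rightarrow> fst (snd (snd (ps ! j)))"
  have "\<forall>k\<le>length ps. ?w k \<in> {1..n}"
    using i ps by (auto simp: legal_def split: nat.split)
  moreover have "\<forall>k<length ps. fst (snd (ps ! k)) \<in> {1..n + 1} \<and> (0::real) \<le> fst (ps ! k)"
    using ps by (auto simp: legal_def dest!: nth_mem)
  moreover have "measure (law R i)
          {\<omega> \<in> space (law R i). phase R 0 \<omega> = ?w 0 \<and>
             (\<forall>k<length ps. sojourn R k \<omega> > fst (ps ! k) \<and> target R (Suc k) \<omega> = fst (snd (ps ! k)) \<and>
                    phase R (Suc k) \<omega> = ?w (Suc k))} =
        (if ?w 0 = i then 1 else 0) *
          (\<Prod>k<length ps. exp (- total_intensity R (?w k) * fst (ps ! k)) * jump_prob R (?w k) (fst (snd (ps ! k))) *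
                 restart_prob R (fst (snd (ps ! k))) (?w (Suc k)))"
    if "\<forall>k\<le>length ps. ?w k \<in> {1..n}" "\<forall>k<length ps. fst (snd (ps ! k)) \<in> {1..n + 1} \<and> (0::real) \<le> fst (ps ! k)"
    using model_law(3)[OF i, unfolded phase_law_def, THEN conjunct2, THEN conjunct2, THEN conjunct2,
      THEN spec, of "length ps", THEN spec, of ?w, THEN spec, of "\<lambda>k. fst (snd (ps ! k))", THEN spec, of "\<lambda>k. fst (ps ! k)",
      THEN mp, OF that(1), THEN mp, OF that(2)] .
  ultimately show ?thesis by (simp add: phase_event_def phase_event_prob_eq_prod)
qed

lemma phase_event_sets:
  assumes i: "i \<in> {1..n}" shows "phase_event i ps \<in> sets (law R i)"
proof -
  note [measurable] = law_measurable(1-3)[OF i]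
  show ?thesis unfolding phase_event_def by measurable
qed

text \<open>Summing over the tails first leaves \<open>step_prob i\<close>, whose total mass is 1.
  The threshold 0 asks only for positive sojourn times.\<close>

lemma sum_phase_event_prob:
  "i \<in> {1..n} \<Longrightarrow> (\<Sum>qs\<in>{qs. set qs \<subseteq> {1..n + 1} \<times> {1..n} \<and> length qs = m}. phase_event_prob i (map (\<lambda>(z, w). (0, z, w, 0)) qs)) = 1"
proof (induction m arbitrary: i)
  case 0
  have "{qs. set qs \<subseteq> {1..n + 1} \<times> {1..n} \<and> length qs = 0} = {[]}" by auto
  then show ?case by simp
next
  case (Suc m)
  let ?S = "\<lambda>m. {qs. set qs \<subseteq> {1..n + 1} \<times> {1..n} \<and> length qs = m}"
  have "?S (Suc m) = (\<lambda>(p, qs). p # qs) ` (({1..n + 1} \<times> {1..n}) \<times> ?S m)"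
    by (auto simp: length_Suc_conv image_iff)
  moreover have "inj_on (\<lambda>(p, qs). p # qs) (({1..n + 1} \<times> {1..n}) \<times> ?S m)" by (auto simp: inj_on_def)
  ultimately have "(\<Sum>qs\<in>?S (Suc m). phase_event_prob i (map (\<lambda>(z, w). (0, z, w, 0)) qs)) =
     (\<Sum>(p, qs)\<in>({1..n + 1} \<times> {1..n}) \<times> ?S m. jump_prob R i (fst p) * restart_prob R (fst p) (snd p) * phase_event_prob (snd p) (map (\<lambda>(z, w). (0, z, w, 0)) qs))"
    by (simp add: sum.reindex split_beta')
  also have "\<dots> = (\<Sum>p\<in>{1..n + 1} \<times> {1..n}. jump_prob R i (fst p) * restart_prob R (fst p) (snd p) *
      (\<Sum>qs\<in>?S m. phase_event_prob (snd p) (map (\<lambda>(z, w). (0, z, w, 0)) qs)))"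
    by (simp add: sum_distrib_left flip: sum.cartesian_product)
  also have "\<dots> = (\<Sum>p\<in>{1..n + 1} \<times> {1..n}. step_prob i p)"
  proof (intro sum.cong refl)
    fix p assume p: "p \<in> {1..n + 1} \<times> {1..n}"
    then have "snd p \<in> {1..n}" by auto
    from Suc.IH[OF this] p show "jump_prob R i (fst p) * restart_prob R (fst p) (snd p) *
      (\<Sum>qs\<in>?S m. phase_event_prob (snd p) (map (\<lambda>(z, w). (0, z, w, 0)) qs)) = step_prob i p"
      by (simp only: step_prob_def if_True mult_1_right)
  qed
  finally show ?case using step_prob_sum[OF Suc.prems] by simp
qed

definition in_range :: "nat \<Rightarrow> 'a \<Rightarrow> bool" where
  "in_range i \<omega> \<longleftrightarrow> phase R 0 \<omega> = i \<and> (\<forall>k. 0 < sojourn R k \<omega> \<and> target R (Suc k) \<omega> \<in> {1..n + 1} \<and> phase R (Suc k) \<omega> \<in> {1..n})"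

text \<open>\<open>phase_law\<close> speaks only of legal states. For each length the events of the
  legal sequences are disjoint with total probability 1, so almost surely no other states
  occur.\<close>

lemma AE_in_range:
  assumes i: "i \<in> {1..n}" shows "AE \<omega> in law R i. in_range i \<omega>"
proof -
  interpret P: prob_space "law R i" by (rule model_law(1)[OF i])
  let ?S = "\<lambda>m. {qs. set qs \<subseteq> {1..n + 1} \<times> {1..n} \<and> length qs = m}"
  let ?g = "map (\<lambda>(z, w). (0::real, z, w, 0::real)) :: (nat \<times> nat) list \<Rightarrow> _"
  have "AE \<omega> in law R i. \<omega> \<in> (\<Union>qs\<in>?S m. phase_event i (?g qs))" for m
  proof -
    have fin: "finite (?S m)" by (rule finite_lists_length_eq) simp
    have dis: "disjoint_family_on (\<lambda>qs. phase_event i (?g qs)) (?S m)"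
      unfolding disjoint_family_on_def
    proof (intro ballI impI)
      fix q r assume qr: "q \<in> ?S m" "r \<in> ?S m" "q \<noteq> r"
      then obtain k where k: "k < m" "q ! k \<noteq> r ! k" by (metis (mono_tags, lifting) mem_Collect_eq nth_equalityI)
      show "phase_event i (?g q) \<inter> phase_event i (?g r) = {}"
      proof (rule ccontr)
        assume "\<not> ?thesis"
        then obtain \<omega> where "\<omega> \<in> phase_event i (?g q)" "\<omega> \<in> phase_event i (?g r)" by auto
        then have "fst (q ! k) = fst (r ! k)" "snd (q ! k) = snd (r ! k)"
          using k qr by (auto simp: phase_event_def split_beta')
        then show False using k by (simp add: prod_eq_iff)
      qed
    qed
    have "P.prob (\<Union>qs\<in>?S m. phase_event i (?g qs)) = (\<Sum>qs\<in>?S m. P.prob (phase_event i (?g qs)))"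
      using fin dis phase_event_sets[OF i] by (intro P.finite_measure_finite_Union) auto
    also have "\<dots> = (\<Sum>qs\<in>?S m. phase_event_prob i (?g qs))"
      by (intro sum.cong refl measure_phase_event[OF i]) (auto simp: legal_def)
    also have "\<dots> = 1" by (rule sum_phase_event_prob[OF i])
    finally show ?thesis
      using fin phase_event_sets[OF i] by (intro P.AE_prob_1) auto
  qed
  then have "AE \<omega> in law R i. \<forall>m. \<omega> \<in> (\<Union>qs\<in>?S m. phase_event i (?g qs))" by (simp add: AE_all_countable)
  then show ?thesis
  proof eventually_elim
    case (elim \<omega>)
    have "0 < sojourn R k \<omega> \<and> target R (Suc k) \<omega> \<in> {1..n + 1} \<and> phase R (Suc k) \<omega> \<in> {1..n}" for k
    proof -
      obtain qs where qs: "qs \<in> ?S (Suc k)" "\<omega> \<in> phase_event i (?g qs)" using elim by blast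
      then have "qs ! k \<in> {1..n + 1} \<times> {1..n}" by (metis (mono_tags, lifting) lessI mem_Collect_eq nth_mem subsetD)
      then show ?thesis using qs by (auto simp: phase_event_def split_beta' mem_Times_iff)
    qed
    moreover have "phase R 0 \<omega> = i" using elim[rule_format, of 0] by (auto simp: phase_event_def)
    ultimately show ?case by (simp add: in_range_def)
  qed
qed

text \<open>The counterpart of \<open>claim_count\<close> for prescribed targets; being
  deterministic, it makes the claim numbers in \<open>claim_event\<close> fixed indices.\<close>

definition claim_pos :: "mark list \<Rightarrow> nat \<Rightarrow> nat" where
  "claim_pos ps k = (\<Sum>l<k. if fst (snd (ps ! l)) = claim_state then 1 else 0)"

lemma claim_pos_mono: "k \<le> l \<Longrightarrow> claim_pos ps k \<le> claim_pos ps l"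
  unfolding claim_pos_def by (rule sum_mono2) auto

lemma claim_pos_strict: "k < l \<Longrightarrow> fst (snd (ps ! k)) = claim_state \<Longrightarrow> claim_pos ps k < claim_pos ps l"
  using claim_pos_mono[of "Suc k" l ps] by (simp add: claim_pos_def)

definition claim_event :: "nat \<Rightarrow> mark list \<Rightarrow> 'a set" where
  "claim_event i ps = {\<omega> \<in> space (law R i). \<forall>k<length ps. fst (snd (ps ! k)) = claim_state \<longrightarrow>
      claim R (Suc (claim_pos ps k)) \<omega> \<le> snd (snd (snd (ps ! k)))}"

lemma measure_claim_le:
  assumes i: "i \<in> {1..n}" and k: "1 \<le> k"
  shows "measure (law R i) {\<omega> \<in> space (law R i). claim R k \<omega> \<le> y} = 1 - exp (- \<beta> * max 0 y)"
proof -
  interpret P: prob_space "law R i" by (rule model_law(1)[OF i])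
  have 1: "measure (law R i) {\<omega> \<in> space (law R i). claim R k \<omega> \<le> y} = 1 - exp (- \<beta> * y)" if "0 \<le> y" for y
    using model_law(4)[OF i] k that by (simp add: claim_law_def)
  show ?thesis
  proof (cases "0 \<le> y")
    case False
    have [measurable]: "claim R k \<in> borel_measurable (law R i)" using law_measurable(4)[OF i] k by simp
    have "measure (law R i) {\<omega> \<in> space (law R i). claim R k \<omega> \<le> y} \<le> measure (law R i) {\<omega> \<in> space (law R i). claim R k \<omega> \<le> 0}"
      using False by (intro P.finite_measure_mono) auto
    then show ?thesis using 1[of 0] False by (simp add: measure_le_0_iff max_def)
  qed (use 1 in \<open>simp add: max_def\<close>)
qed

text \<open>Different jumps with a claim have different claim numbers, so independence of the claims
  gives the product.\<close>

lemma measure_claim_event: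
  assumes i: "i \<in> {1..n}"
  shows "measure (law R i) (claim_event i ps) =
    (\<Prod>k<length ps. if fst (snd (ps ! k)) = claim_state then 1 - exp (- \<beta> * max 0 (snd (snd (snd (ps ! k))))) else 1)"
proof -
  interpret P: prob_space "law R i" by (rule model_law(1)[OF i])
  define K where "K = {k. k < length ps \<and> fst (snd (ps ! k)) = claim_state}"
  have fin: "finite K" by (simp add: K_def)
  let ?f = "\<lambda>k. Suc (claim_pos ps k)"
  have inj: "inj_on ?f K"
  proof (rule inj_onI)
    fix k l assume "k \<in> K" "l \<in> K" "?f k = ?f l"
    then show "k = l" using claim_pos_strict[of k l ps] claim_pos_strict[of l k ps]
      by (cases k l rule: linorder_cases) (auto simp: K_def)
  qed
  \<comment> \<open>The threshold of a jump, reindexed by the number of its claim.\<close>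
  define Y where "Y j = snd (snd (snd (ps ! the_inv_into K ?f j)))" for j
  have Y: "Y (?f k) = snd (snd (snd (ps ! k)))" if "k \<in> K" for k
    using that by (simp only: Y_def the_inv_into_f_f[OF inj that])
  have rhs: "(\<Prod>k<length ps. if fst (snd (ps ! k)) = claim_state then 1 - exp (- \<beta> * max 0 (snd (snd (snd (ps ! k))))) else 1) =
    (\<Prod>k\<in>K. 1 - exp (- \<beta> * max 0 (snd (snd (snd (ps ! k))))))"
    by (intro prod.mono_neutral_cong_right) (auto simp: K_def)
  show ?thesis
  proof (cases "K = {}")
    case True
    then have "claim_event i ps = space (law R i)" by (auto simp: claim_event_def K_def)
    then show ?thesis unfolding rhs True by (simp add: P.prob_space)
  next
    case False
    have ind: "P.indep_vars (\<lambda>_. borel) (claim R) {1..}"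
      using model_law(4)[OF i] by (simp add: claim_law_def)
    have "claim_event i ps = (\<Inter>j\<in>?f ` K. claim R j -` {..Y j} \<inter> space (law R i))"
      using False Y by (auto simp: claim_event_def K_def)
    also have "P.prob \<dots> = (\<Prod>j\<in>?f ` K. P.prob (claim R j -` {..Y j} \<inter> space (law R i)))"
      using False fin by (intro P.indep_varsD[OF ind]) auto
    also have "\<dots> = (\<Prod>j\<in>?f ` K. 1 - exp (- \<beta> * max 0 (Y j)))"
    proof (intro prod.cong refl)
      fix j assume "j \<in> ?f ` K"
      then have "1 \<le> j" by auto
      moreover have "claim R j -` {..Y j} \<inter> space (law R i) = {\<omega> \<in> space (law R i). claim R j \<omega> \<le> Y j}" by auto
      ultimately show "P.prob (claim R j -` {..Y j} \<inter> space (law R i)) = 1 - exp (- \<beta> * max 0 (Y j))"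
        using measure_claim_le[OF i] by simp
    qed
    also have "\<dots> = (\<Prod>k\<in>K. 1 - exp (- \<beta> * max 0 (Y (?f k))))"
      using inj by (subst prod.reindex) simp_all
    also have "\<dots> = (\<Prod>k\<in>K. 1 - exp (- \<beta> * max 0 (snd (snd (snd (ps ! k))))))"
      using Y by (intro prod.cong refl) simp
    finally show ?thesis unfolding rhs .
  qed
qed

text \<open>Both events are exhibited as preimages in the two independent sigma-algebras of
  \<open>claim_law\<close>; this works because the claim numbers in \<open>claim_event\<close> do
  not depend on the outcome.\<close>

lemma measure_phase_claim_event:
  assumes i: "i \<in> {1..n}"
  shows "measure (law R i) (phase_event i ps \<inter> claim_event i ps) =
    measure (law R i) (phase_event i ps) * measure (law R i) (claim_event i ps)"
proof -
  interpret P: prob_space "law R i" by (rule model_law(1)[OF i])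
  let ?X = "\<lambda>\<omega> k. (phase R k \<omega>, target R (Suc k) \<omega>, sojourn R k \<omega>)"
  let ?M = "Pi\<^sub>M UNIV (\<lambda>_::nat. count_space UNIV \<Otimes>\<^sub>M count_space UNIV \<Otimes>\<^sub>M borel) :: (nat \<Rightarrow> nat \<times> nat \<times> real) measure"
  let ?Y = "\<lambda>\<omega>. \<lambda>k\<in>{1..}. claim R k \<omega>"
  let ?N = "Pi\<^sub>M {1..} (\<lambda>_. borel) :: (nat \<Rightarrow> real) measure"
  have ind: "P.indep_set (sets (vimage_algebra (space (law R i)) ?X ?M)) (sets (vimage_algebra (space (law R i)) ?Y ?N))"
    using model_law(4)[OF i] by (simp add: claim_law_def)
  have "{x \<in> space ?M. fst (x 0) = i \<and> (\<forall>k<length ps. fst (ps ! k) < snd (snd (x k)) \<and> fst (snd (x k)) = fst (snd (ps ! k)) \<and>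
      fst (x (Suc k)) = fst (snd (snd (ps ! k))))} \<in> sets ?M"
    by measurable
  then have "?X -` {x \<in> space ?M. fst (x 0) = i \<and> (\<forall>k<length ps. fst (ps ! k) < snd (snd (x k)) \<and> fst (snd (x k)) = fst (snd (ps ! k)) \<and>
      fst (x (Suc k)) = fst (snd (snd (ps ! k))))} \<inter> space (law R i) \<in> sets (vimage_algebra (space (law R i)) ?X ?M)"
    by (rule in_vimage_algebra)
  also have "?X -` {x \<in> space ?M. fst (x 0) = i \<and> (\<forall>k<length ps. fst (ps ! k) < snd (snd (x k)) \<and> fst (snd (x k)) = fst (snd (ps ! k)) \<and>
      fst (x (Suc k)) = fst (snd (snd (ps ! k))))} \<inter> space (law R i) = phase_event i ps"
    by (auto simp: phase_event_def space_PiM space_pair_measure)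
  finally have A: "phase_event i ps \<in> sets (vimage_algebra (space (law R i)) ?X ?M)" .
  have [measurable]: "(\<lambda>x. x (Suc k)) \<in> borel_measurable ?N" for k
    by (rule measurable_component_singleton) simp
  have "{x \<in> space ?N. \<forall>k<length ps. fst (snd (ps ! k)) = claim_state \<longrightarrow> x (Suc (claim_pos ps k)) \<le> snd (snd (snd (ps ! k)))} \<in> sets ?N"
    by measurable
  then have "?Y -` {x \<in> space ?N. \<forall>k<length ps. fst (snd (ps ! k)) = claim_state \<longrightarrow> x (Suc (claim_pos ps k)) \<le> snd (snd (snd (ps ! k)))} \<inter> space (law R i)
     \<in> sets (vimage_algebra (space (law R i)) ?Y ?N)"
    by (rule in_vimage_algebra)
  also have "?Y -` {x \<in> space ?N. \<forall>k<length ps. fst (snd (ps ! k)) = claim_state \<longrightarrow> x (Suc (claim_pos ps k)) \<le> snd (snd (snd (ps ! k)))} \<inter> space (law R i) = claim_event i ps"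
    by (auto simp: claim_event_def space_PiM)
  finally have B: "claim_event i ps \<in> sets (vimage_algebra (space (law R i)) ?Y ?N)" .
  show ?thesis by (rule P.indep_setD[OF ind A B])
qed

text \<open>The probability of \<open>cyl ps\<close> if each jump is drawn from
  \<open>first_law\<close> of the current phase.\<close>

primrec cyl_prob :: "nat \<Rightarrow> mark list \<Rightarrow> real" where
  "cyl_prob i [] = 1"
| "cyl_prob i (p # ps) = box_prob i (fst p) (fst (snd p)) (fst (snd (snd p))) (snd (snd (snd p))) * cyl_prob (fst (snd (snd p))) ps"

abbreviation cyl :: "mark list \<Rightarrow> mark stream set" where
  "cyl ps \<equiv> scylinder UNIV (map (\<lambda>(a, z, w, y). mark_box a z w y) ps)"

lemma mem_cyl: "h \<in> cyl ps \<longleftrightarrow> (\<forall>k<length ps. fst (ps ! k) < hold (h !! k) \<and> dest (h !! k) = fst (snd (ps ! k)) \<and>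
    next_phase (h !! k) = fst (snd (snd (ps ! k))) \<and> loss (h !! k) \<le> snd (snd (snd (ps ! k))))"
proof (induction ps arbitrary: h)
  case (Cons p ps)
  show ?case by (cases p) (auto simp: Cons.IH All_less_Suc2)
qed simp

lemma cyl_sets: "cyl ps \<in> sets path_space"
proof -
  have "\<forall>A\<in>set (map (\<lambda>(a, z, w, y). mark_box a z w y) ps). A \<in> sets mark_space"
    by (auto simp del: mem_mark_box)
  from sets_scylinder[OF this] show ?thesis by simp
qed

lemma cyl_prob_eq:
  "legal ps \<Longrightarrow> cyl_prob i ps = phase_event_prob i ps *
    (\<Prod>k<length ps. if fst (snd (ps ! k)) = claim_state then 1 - exp (- \<beta> * max 0 (snd (snd (snd (ps ! k)))))
      else if 0 \<le> snd (snd (snd (ps ! k))) then 1 else 0)"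
proof (induction ps arbitrary: i)
  case (Cons p ps)
  have "legal ps" "0 \<le> fst p" "(fst (snd p), fst (snd (snd p))) \<in> {1..n + 1} \<times> {1..n}" using Cons.prems by (auto simp: legal_def)
  then show ?case
    using Cons.IH[of "fst (snd (snd p))"]
    by (simp only: cyl_prob.simps phase_event_prob.simps list.size add_0_right add_Suc_right prod.lessThan_Suc_shift nth_Cons_0 nth_Cons_Suc box_prob_def step_prob_def if_True max_absorb2 fst_conv snd_conv mult_ac)
qed simp

text \<open>\<open>phase_law\<close> requires nonnegative sojourn thresholds; as sojourn times are
  positive almost surely, a negative threshold may be replaced by 0.\<close>

definition clip :: "mark list \<Rightarrow> mark list" where
  "clip = map (\<lambda>p. (max 0 (fst p), snd p))"

lemma cyl_prob_clip: "cyl_prob i (clip ps) = cyl_prob i ps"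
  by (induction ps arbitrary: i) (simp_all add: clip_def box_prob_def)

lemma cyl_prob_illegal:
  assumes "\<not> legal (clip ps)" shows "cyl_prob i ps = 0"
  using assms
proof (induction ps arbitrary: i)
  case (Cons p ps)
  then show ?case
    by (cases "legal (clip ps)") (auto simp: clip_def legal_def box_prob_def step_prob_def)
qed (simp add: legal_def clip_def)

lemma in_range_marks:
  assumes "in_range i \<omega>"
  shows "0 < hold (marks \<omega> !! k)" "dest (marks \<omega> !! k) \<in> {1..n + 1}" "next_phase (marks \<omega> !! k) \<in> {1..n}"
  using assms by (auto simp: marks_snth mark_at_def in_range_def)

text \<open>A cylinder event splits into a phase part and a claim part of known probabilities
  because it fixes the targets, and thereby the numbers of the claims involved.\<close>

lemma marks_cyl_iff:
  assumes i: "i \<in> {1..n}" and \<omega>: "\<omega> \<in> space (law R i)" "in_range i \<omega>"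
  shows "marks \<omega> \<in> cyl ps \<longleftrightarrow> legal (clip ps) \<and> \<omega> \<in> phase_event i (clip ps) \<inter> claim_event i (clip ps) \<and>
    (\<forall>k<length ps. fst (snd (ps ! k)) \<noteq> claim_state \<longrightarrow> 0 \<le> snd (snd (snd (ps ! k))))" (is "?L \<longleftrightarrow> ?R")
proof
  have cc: "claim_count k \<omega> = claim_pos (clip ps) k"
    if "\<forall>k<length ps. target R (Suc k) \<omega> = fst (snd (ps ! k))" "k < length ps" for k
    unfolding claim_count_def claim_pos_def using that by (intro sum.cong refl) (simp add: clip_def)
  {
    assume L: ?L
    have t: "\<forall>k<length ps. target R (Suc k) \<omega> = fst (snd (ps ! k))"
      using L by (auto simp: mem_cyl marks_snth mark_at_def)
    have "legal (clip ps)"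
      unfolding legal_def
    proof
      fix p assume "p \<in> set (clip ps)"
      then obtain k where k: "k < length ps" "p = (max 0 (fst (ps ! k)), snd (ps ! k))"
        by (auto simp: clip_def in_set_conv_nth)
      then have "fst (snd p) = dest (marks \<omega> !! k)" "fst (snd (snd p)) = next_phase (marks \<omega> !! k)"
        using L by (auto simp: mem_cyl)
      moreover have "0 \<le> fst p" using k by simp
      ultimately show "0 \<le> fst p \<and> fst (snd p) \<in> {1..n + 1} \<and> fst (snd (snd p)) \<in> {1..n}"
        using in_range_marks[OF \<omega>(2), of k] by simp
    qed
    moreover have "\<omega> \<in> phase_event i (clip ps)"
      using L \<omega> by (auto simp: phase_event_def in_range_def mem_cyl marks_snth mark_at_def clip_def)
    moreover have "\<omega> \<in> claim_event i (clip ps)"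
      unfolding claim_event_def
    proof (intro CollectI conjI \<omega>(1) allI impI)
      fix k assume k: "k < length (clip ps)" "fst (snd (clip ps ! k)) = claim_state"
      then have k': "k < length ps" by (simp add: clip_def)
      have "loss (marks \<omega> !! k) \<le> snd (snd (snd (ps ! k)))" using L k' by (simp add: mem_cyl)
      then show "claim R (Suc (claim_pos (clip ps) k)) \<omega> \<le> snd (snd (snd (clip ps ! k)))"
        using k k' t cc[OF t k'] by (simp add: marks_snth mark_at_def clip_def)
    qed
    moreover have "0 \<le> snd (snd (snd (ps ! k)))" if "k < length ps" "fst (snd (ps ! k)) \<noteq> claim_state" for k
    proof -
      have "loss (marks \<omega> !! k) \<le> snd (snd (snd (ps ! k)))" using L that by (simp add: mem_cyl)
      then show ?thesis using that t by (simp add: marks_snth mark_at_def)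
    qed
    ultimately show ?R by blast
  }
  assume r: ?R
  then have t: "\<forall>k<length ps. target R (Suc k) \<omega> = fst (snd (ps ! k))"
    by (auto simp: phase_event_def clip_def)
  show ?L
    unfolding mem_cyl
  proof (intro allI impI)
    fix k assume k: "k < length ps"
    have "loss (marks \<omega> !! k) \<le> snd (snd (snd (ps ! k)))"
      using r k t cc[OF t k] by (auto simp: marks_snth mark_at_def claim_event_def clip_def)
    then show "fst (ps ! k) < hold (marks \<omega> !! k) \<and> dest (marks \<omega> !! k) = fst (snd (ps ! k)) \<and>
      next_phase (marks \<omega> !! k) = fst (snd (snd (ps ! k))) \<and> loss (marks \<omega> !! k) \<le> snd (snd (snd (ps ! k)))"
      using r k by (auto simp: marks_snth mark_at_def phase_event_def clip_def)
  qed
qed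

lemma phase_claim_event_sets:
  assumes i: "i \<in> {1..n}" shows "claim_event i ps \<in> sets (law R i)"
proof -
  have [measurable]: "claim R (Suc k) \<in> borel_measurable (law R i)" for k using law_measurable(4)[OF i] by simp
  show ?thesis unfolding claim_event_def by measurable
qed

lemma emeasure_path_law_cyl:
  assumes i: "i \<in> {1..n}"
  shows "emeasure (path_law i) (cyl ps) = ennreal (cyl_prob i ps)"
proof -
  interpret P: prob_space "law R i" by (rule model_law(1)[OF i])
  let ?L = "\<forall>k<length ps. fst (snd (ps ! k)) \<noteq> claim_state \<longrightarrow> 0 \<le> snd (snd (snd (ps ! k)))"
  let ?E = "if legal (clip ps) \<and> ?L then phase_event i (clip ps) \<inter> claim_event i (clip ps) else {}"
  have "emeasure (path_law i) (cyl ps) = emeasure (law R i) (marks -` cyl ps \<inter> space (law R i))"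
    using i unfolding path_law_def by (simp add: emeasure_distr marks_measurable cyl_sets)
  also have "\<dots> = emeasure (law R i) ?E"
  proof (rule emeasure_eq_AE)
    show "AE \<omega> in law R i. (\<omega> \<in> marks -` cyl ps \<inter> space (law R i)) = (\<omega> \<in> ?E)"
      using AE_in_range[OF i] AE_space
    proof eventually_elim
      case (elim \<omega>)
      then show ?case using marks_cyl_iff[OF i elim(2,1), of ps] by auto
    qed
    show "marks -` cyl ps \<inter> space (law R i) \<in> sets (law R i)"
      by (rule measurable_sets[OF marks_measurable[OF i] cyl_sets])
    show "?E \<in> sets (law R i)" using phase_event_sets[OF i] phase_claim_event_sets[OF i] by auto
  qed
  also have "\<dots> = ennreal (cyl_prob i ps)"
  proof (cases "legal (clip ps)")
    case False
    then show ?thesis by (simp add: cyl_prob_illegal)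
  next
    case legal: True
    have len: "length (clip ps) = length ps" and nth: "k < length ps \<Longrightarrow> snd (clip ps ! k) = snd (ps ! k)" for k
      by (simp_all add: clip_def)
    have cp: "cyl_prob i ps = phase_event_prob i (clip ps) *
      (\<Prod>k<length ps. if fst (snd (ps ! k)) = claim_state then 1 - exp (- \<beta> * max 0 (snd (snd (snd (ps ! k)))))
       else if 0 \<le> snd (snd (snd (ps ! k))) then 1 else 0)"
    proof -
      have "(\<Prod>k<length (clip ps). if fst (snd (clip ps ! k)) = claim_state then 1 - exp (- \<beta> * max 0 (snd (snd (snd (clip ps ! k)))))
         else if 0 \<le> snd (snd (snd (clip ps ! k))) then 1 else 0) =
        (\<Prod>k<length ps. if fst (snd (ps ! k)) = claim_state then 1 - exp (- \<beta> * max 0 (snd (snd (snd (ps ! k)))))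
         else if 0 \<le> snd (snd (snd (ps ! k))) then 1 else 0)"
        unfolding len by (intro prod.cong refl) (simp only: lessThan_iff nth)
      then show ?thesis using cyl_prob_eq[OF legal, of i] by (simp only: cyl_prob_clip)
    qed
    show ?thesis
    proof (cases ?L)
      case True
      have "measure (law R i) (phase_event i (clip ps) \<inter> claim_event i (clip ps)) = phase_event_prob i (clip ps) *
        (\<Prod>k<length ps. if fst (snd (ps ! k)) = claim_state then 1 - exp (- \<beta> * max 0 (snd (snd (snd (ps ! k))))) else 1)"
        unfolding measure_phase_claim_event[OF i] measure_phase_event[OF i legal] measure_claim_event[OF i]
        unfolding len by (intro arg_cong2[where f="(*)"] refl prod.cong) (simp only: lessThan_iff nth)
      also have "\<dots> = cyl_prob i ps"
        unfolding cp using True by (intro arg_cong2[where f="(*)"] refl prod.cong) auto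
      finally show ?thesis using True legal by (simp add: P.emeasure_eq_measure)
    next
      case False
      then have "cyl_prob i ps = 0"
        unfolding cp by (auto intro!: prod_zero)
      then show ?thesis using False by auto
    qed
  qed
  finally show ?thesis .
qed

text \<open>The mark enters \<open>path_law\<close> only through the discrete next phase, so
  measurability of that factor is automatic.\<close>

lemma path_law_kernel:
  "(\<lambda>e. distr (path_law (next_phase e)) path_space (\<lambda>h. e ## h)) \<in> mark_space \<rightarrow>\<^sub>M prob_algebra path_space"
proof (rule measurable_distr_prob_space2)
  have "path_law \<in> count_space UNIV \<rightarrow>\<^sub>M prob_algebra path_space"
    by (simp add: space_prob_algebra prob_space_path_law)
  then show "(\<lambda>e. path_law (next_phase e)) \<in> mark_space \<rightarrow>\<^sub>M prob_algebra path_space"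
    by (rule measurable_compose[rotated]) measurable
qed measurable

text \<open>The Markov property at the first jump: on cylinders both sides satisfy the recursion
  that defines \<open>cyl_prob\<close>.\<close>

theorem path_law_eq_bind:
  assumes i: "i \<in> {1..n}"
  shows "path_law i = first_law i \<bind> (\<lambda>e. distr (path_law (next_phase e)) path_space (\<lambda>h. e ## h))"
proof (rule path_measure_eqI)
  let ?B = "first_law i \<bind> (\<lambda>e. distr (path_law (next_phase e)) path_space (\<lambda>h. e ## h))"
  have K: "first_law i \<in> space (prob_algebra mark_space)"
    by (simp add: space_prob_algebra prob_space_first_law[OF i])
  interpret B: prob_space ?B by (rule prob_space_bind'[OF K path_law_kernel])
  show "prob_space ?B" by (rule B.prob_space_axioms)
  show "prob_space (path_law i)" by (rule prob_space_path_law)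
  show "sets (path_law i) = sets path_space" by simp
  show "sets ?B = sets path_space" by (rule sets_bind'[OF K path_law_kernel])
  fix ps
  show "emeasure (path_law i) (cyl ps) = emeasure ?B (cyl ps)"
  proof (cases ps)
    case Nil
    interpret Q: prob_space "path_law i" by (rule prob_space_path_law)
    have "space ?B = UNIV" using sets_eq_imp_space_eq[OF sets_bind'[OF K path_law_kernel]] by simp
    then show ?thesis using Nil Q.emeasure_space_1 B.emeasure_space_1 by (simp add: streams_UNIV)
  next
    case (Cons p qs)
    obtain a z w y where p: "p = (a, z, w, y)" by (cases p)
    have "emeasure ?B (cyl ps) = (\<integral>\<^sup>+e. emeasure (distr (path_law (next_phase e)) path_space (\<lambda>h. e ## h)) (cyl ps) \<partial>first_law i)"
      by (rule emeasure_bind_prob_algebra[OF K path_law_kernel cyl_sets])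
    also have "\<dots> = (\<integral>\<^sup>+e. indicator (mark_box a z w y) e * emeasure (path_law w) (cyl qs) \<partial>first_law i)"
    proof (rule nn_integral_cong)
      fix e
      have "emeasure (distr (path_law (next_phase e)) path_space (\<lambda>h. e ## h)) (cyl ps) =
        emeasure (path_law (next_phase e)) ((\<lambda>h. e ## h) -` cyl ps \<inter> space (path_law (next_phase e)))"
        by (rule emeasure_distr) (use cyl_sets in auto)
      also have "(\<lambda>h. e ## h) -` cyl ps \<inter> space (path_law (next_phase e)) = (if e \<in> mark_box a z w y then cyl qs else {})"
        by (auto simp: Cons p streams_UNIV)
      finally show "emeasure (distr (path_law (next_phase e)) path_space (\<lambda>h. e ## h)) (cyl ps) =
        indicator (mark_box a z w y) e * emeasure (path_law w) (cyl qs)"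
        by (auto simp: indicator_def)
    qed
    also have "\<dots> = ennreal (box_prob i a z w y) * emeasure (path_law w) (cyl qs)"
      using emeasure_first_law_box[OF i, of a z w y] by (simp add: nn_integral_multc mark_box_sets)
    also have "\<dots> = ennreal (cyl_prob i ps)"
    \<comment> \<open>Outside the phases \<open>path_law w\<close> is an arbitrary default, which
      does no harm because such a box has probability 0 under \<open>first_law\<close>.\<close>
    proof (cases "w \<in> {1..n}")
      case True
      have "0 \<le> box_prob i a z w y"
        using step_prob_nonneg[OF i] pos by (simp add: box_prob_def)
      then show ?thesis
        by (simp add: emeasure_path_law_cyl[OF True] Cons p ennreal_mult')
    next
      case False
      then have "step_prob i (z, w) = 0" by (auto simp: step_prob_def)
      then have "box_prob i a z w y = 0" by (simp add: box_prob_def)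
      then show ?thesis by (simp add: Cons p)
    qed
    finally show ?thesis using emeasure_path_law_cyl[OF i, of ps] by simp
  qed
qed

lemma nn_integral_path_law:
  assumes i: "i \<in> {1..n}" and F: "F \<in> borel_measurable path_space"
  shows "(\<integral>\<^sup>+h. F h \<partial>path_law i) = (\<integral>\<^sup>+e. \<integral>\<^sup>+h. F (e ## h) \<partial>path_law (next_phase e) \<partial>first_law i)"
proof -
  have "(\<integral>\<^sup>+h. F h \<partial>path_law i) = (\<integral>\<^sup>+e. \<integral>\<^sup>+h. F h \<partial>distr (path_law (next_phase e)) path_space (\<lambda>h. e ## h) \<partial>first_law i)"
    unfolding path_law_eq_bind[OF i]
    using measurable_prob_algebraD[OF path_law_kernel]
    by (intro nn_integral_bind[OF F]) (simp cong: measurable_cong_sets)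
  also have "\<dots> = (\<integral>\<^sup>+e. \<integral>\<^sup>+h. F (e ## h) \<partial>path_law (next_phase e) \<partial>first_law i)"
    by (intro nn_integral_cong nn_integral_distr) (use F in \<open>auto cong: measurable_cong_sets\<close>)
  finally show ?thesis .
qed

lemma nn_integral_kernel_measurable:
  assumes F: "(\<lambda>(e, h). F e h) \<in> borel_measurable (mark_space \<Otimes>\<^sub>M path_space)"
  shows "(\<lambda>e. \<integral>\<^sup>+h. F e h \<partial>path_law (next_phase e)) \<in> borel_measurable mark_space"
proof -
  have "(\<lambda>e. \<integral>\<^sup>+h. F e h \<partial>path_law w) \<in> borel_measurable mark_space" for w
  proof -
    interpret prob_space "path_law w" by (rule prob_space_path_law)
    show ?thesis
      by (rule borel_measurable_nn_integral) (use F in \<open>simp cong: measurable_cong_sets\<close>)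
  qed
  from measurable_compose_countable[OF this, of next_phase] show ?thesis by measurable
qed

text \<open>Apply \<open>nn_integral_path_law\<close> to the indicator of a measurable null set
  covering the exceptional set; \<open>P\<close> itself may be non-measurable, as feasibility may
  be.\<close>

lemma AE_path_lawD:
  assumes i: "i \<in> {1..n}" and ae: "AE h in path_law i. P h"
  shows "AE e in first_law i. AE h in path_law (next_phase e). P (e ## h)"
proof -
  from ae obtain N where N: "{h \<in> space (path_law i). \<not> P h} \<subseteq> N" "emeasure (path_law i) N = 0" "N \<in> sets (path_law i)"
    by (rule AE_E)
  then have [measurable]: "N \<in> sets path_space" by simp
  have "(\<integral>\<^sup>+e. \<integral>\<^sup>+h. indicator N (e ## h) \<partial>path_law (next_phase e) \<partial>first_law i) = 0"
    using N by (subst nn_integral_path_law[OF i, symmetric]) auto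
  moreover have m: "(\<lambda>e. \<integral>\<^sup>+h. indicator N (e ## h) \<partial>path_law (next_phase e)) \<in> borel_measurable mark_space"
    by (rule nn_integral_kernel_measurable) measurable
  ultimately have "AE e in first_law i. (\<integral>\<^sup>+h. indicator N (e ## h) \<partial>path_law (next_phase e)) = 0"
    by (subst (asm) nn_integral_0_iff_AE) (simp_all cong: measurable_cong_sets)
  then show ?thesis
  proof eventually_elim
    case (elim e)
    have "(\<lambda>h. indicator N (e ## h) :: ennreal) \<in> borel_measurable (path_law (next_phase e))" by measurable
    with elim have "AE h in path_law (next_phase e). indicator N (e ## h) = (0 :: ennreal)"
      by (simp add: nn_integral_0_iff_AE)
    then show ?case
    proof eventually_elim
      case (elim h)
      then show ?case using N(1) by (auto simp: indicator_def split: if_splits)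
    qed
  qed
qed

text \<open>In this direction \<open>P\<close> has to be measurable: that its sections are null says
  nothing about an exceptional set that is not measurable.\<close>

lemma AE_path_lawI:
  assumes i: "i \<in> {1..n}" and N [measurable]: "Measurable.pred path_space P"
    and ae: "AE e in first_law i. AE h in path_law (next_phase e). P (e ## h)"
  shows "AE h in path_law i. P h"
proof -
  have "{h \<in> space path_space. \<not> P h} \<in> sets path_space" by measurable
  then have [measurable]: "{h. \<not> P h} \<in> sets path_space" by simp
  have "(\<integral>\<^sup>+h. indicator {h. \<not> P h} h \<partial>path_law i) =
     (\<integral>\<^sup>+e. \<integral>\<^sup>+h. indicator {h. \<not> P h} (e ## h) \<partial>path_law (next_phase e) \<partial>first_law i)"
    by (rule nn_integral_path_law[OF i]) measurable
  also have "\<dots> = (\<integral>\<^sup>+e. 0 \<partial>first_law i)"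
  proof (rule nn_integral_cong_AE)
    show "AE e in first_law i. (\<integral>\<^sup>+h. indicator {h. \<not> P h} (e ## h) \<partial>path_law (next_phase e)) = 0"
      using ae
    proof eventually_elim
      case (elim e)
      then have "(\<integral>\<^sup>+h. indicator {h. \<not> P h} (e ## h) \<partial>path_law (next_phase e)) = (\<integral>\<^sup>+h. 0 \<partial>path_law (next_phase e))"
        by (intro nn_integral_cong_AE) (auto elim!: eventually_mono)
      then show ?case by simp
    qed
  qed
  finally have "(\<integral>\<^sup>+h. indicator {h. \<not> P h} h \<partial>path_law i) = 0" by simp
  then have "AE h in path_law i. indicator {h. \<not> P h} h = (0 :: ennreal)"
    by (subst (asm) nn_integral_0_iff_AE) simp_all
  then show ?thesis by eventually_elim (auto simp: indicator_def split: if_splits)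
qed

end

lemma pred_eq_countable:
  fixes f g :: "'a \<Rightarrow> 'b :: countable"
  assumes f: "f \<in> M \<rightarrow>\<^sub>M count_space UNIV" and g: "g \<in> M \<rightarrow>\<^sub>M count_space UNIV"
  shows "Measurable.pred M (\<lambda>x. f x = g x)"
proof (rule measurable_compose_countable[OF _ g])
  fix k
  have "Measurable.pred M (\<lambda>x. f x \<in> {k})" by (rule pred_sets2[OF _ f]) simp
  then show "Measurable.pred M (\<lambda>x. f x = k)" by simp
qed

section \<open>Almost sure properties of paths\<close>

context risk begin

text \<open>The properties that a jump out of phase \<open>i\<close> has almost surely. The clause
  \<open>dest e \<noteq> i\<close> makes each jump observable; without a claim there is no restart
  and no loss.\<close>

definition good_mark :: "nat \<Rightarrow> mark \<Rightarrow> bool" where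
  "good_mark i e \<longleftrightarrow> 0 < hold e \<and> dest e \<in> {1..n + 1} \<and> next_phase e \<in> {1..n} \<and> dest e \<noteq> i \<and> 0 \<le> loss e \<and>
     (dest e \<noteq> claim_state \<longrightarrow> next_phase e = dest e \<and> loss e = 0)"

lemma good_mark_measurable [measurable]:
  assumes [measurable]: "j \<in> M \<rightarrow>\<^sub>M count_space UNIV" "e \<in> M \<rightarrow>\<^sub>M mark_space"
  shows "Measurable.pred M (\<lambda>x. good_mark (j x) (e x))"
proof -
  have [measurable]: "(\<lambda>x. dest (e x)) \<in> M \<rightarrow>\<^sub>M count_space UNIV" "(\<lambda>x. next_phase (e x)) \<in> M \<rightarrow>\<^sub>M count_space UNIV"
    "(\<lambda>x. hold (e x)) \<in> borel_measurable M" "(\<lambda>x. loss (e x)) \<in> borel_measurable M"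
    by measurable
  have [measurable]: "Measurable.pred M (\<lambda>x. dest (e x) \<in> A)" "Measurable.pred M (\<lambda>x. next_phase (e x) \<in> A)" for A
    by (rule pred_sets2[where N="count_space UNIV"]; simp)+
  have [measurable]: "Measurable.pred M (\<lambda>x. dest (e x) = j x)" "Measurable.pred M (\<lambda>x. next_phase (e x) = dest (e x))"
    "Measurable.pred M (\<lambda>x. dest (e x) = claim_state)"
    by (intro pred_eq_countable; simp)+
  show ?thesis unfolding good_mark_def by measurable
qed

lemma AE_exp_law_pos:
  assumes "0 < r" shows "AE x in exp_law r. 0 < x"
proof -
  have "AE x in lborel. x \<noteq> (0::real)" by (rule AE_lborel_singleton)
  then show ?thesis
    by (subst AE_density) (auto simp: exponential_density_def elim!: eventually_mono)
qed

lemma AE_good_mark: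
  assumes i: "i \<in> {1..n}" shows "AE e in first_law i. good_mark i e"
proof -
  have "{e \<in> space mark_space. \<not> good_mark i e} \<in> sets mark_space" by measurable
  then have B [measurable]: "{e. \<not> good_mark i e} \<in> sets mark_space" by simp
  have "(\<integral>\<^sup>+e. indicator {e. \<not> good_mark i e} e \<partial>first_law i) = (\<Sum>p\<in>{1..n + 1} \<times> {1..n}. ennreal (step_prob i p) *
     (\<integral>\<^sup>+s. \<integral>\<^sup>+y. indicator {e. \<not> good_mark i e} (mk_mark (p, s, y)) \<partial>exp_law \<beta> \<partial>exp_law (total_intensity R i)))"
    by (rule nn_integral_first_law[OF i]) measurable
  also have "\<dots> = 0"
  proof (intro sum.neutral ballI)
    fix p assume p: "p \<in> {1..n + 1} \<times> {1..n}"
    show "ennreal (step_prob i p) * (\<integral>\<^sup>+s. \<integral>\<^sup>+y. indicator {e. \<not> good_mark i e} (mk_mark (p, s, y)) \<partial>exp_law \<beta> \<partial>exp_law (total_intensity R i)) = 0"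
    proof (cases "step_prob i p = 0")
      case False
      have g: "good_mark i (mk_mark (p, s, y))" if "0 < s" "0 < y" for s y
        using False p that by (auto simp: good_mark_def mk_mark_def step_prob_def jump_prob_def restart_prob_def claim_state_def split: if_splits)
      have "(\<integral>\<^sup>+s. \<integral>\<^sup>+y. indicator {e. \<not> good_mark i e} (mk_mark (p, s, y)) \<partial>exp_law \<beta> \<partial>exp_law (total_intensity R i)) = (\<integral>\<^sup>+s. 0 \<partial>exp_law (total_intensity R i))"
      proof (rule nn_integral_cong_AE)
        show "AE s in exp_law (total_intensity R i). (\<integral>\<^sup>+y. indicator {e. \<not> good_mark i e} (mk_mark (p, s, y)) \<partial>exp_law \<beta>) = 0"
          using AE_exp_law_pos[OF rate_pos[OF i]]
        proof eventually_elim
          case (elim s)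
          have "(\<integral>\<^sup>+y. indicator {e. \<not> good_mark i e} (mk_mark (p, s, y)) \<partial>exp_law \<beta>) = (\<integral>\<^sup>+y. 0 \<partial>exp_law \<beta>)"
            using AE_exp_law_pos[OF pos(2)] g[OF elim] by (intro nn_integral_cong_AE) (auto elim!: eventually_mono)
          then show ?case by simp
        qed
      qed
      then show ?thesis by simp
    qed simp
  qed
  finally have "AE e in first_law i. indicator {e. \<not> good_mark i e} e = (0 :: ennreal)"
    by (subst (asm) nn_integral_0_iff_AE) simp_all
  then show ?thesis by eventually_elim (auto simp: indicator_def split: if_splits)
qed

definition cur_phase :: "nat \<Rightarrow> mark stream \<Rightarrow> nat \<Rightarrow> nat" where
  "cur_phase i h k = (case k of 0 \<Rightarrow> i | Suc j \<Rightarrow> next_phase (h !! j))"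

definition good_path :: "nat \<Rightarrow> mark stream \<Rightarrow> bool" where
  "good_path i h \<longleftrightarrow> proper h \<and> (\<forall>k. good_mark (cur_phase i h k) (h !! k))"

lemma AE_good_mark_nth:
  "i \<in> {1..n} \<Longrightarrow> AE h in path_law i. good_mark (cur_phase i h k) (h !! k)"
proof (induction k arbitrary: i)
  case 0
  have "AE h in path_law i. good_mark i (shd h)"
    using AE_good_mark[OF 0] by (intro AE_path_lawI[OF 0]) (auto elim!: eventually_mono)
  then show ?case by (simp add: cur_phase_def)
next
  case (Suc k)
  have "AE h in path_law i. good_mark (next_phase (h !! k)) (h !! Suc k)"
  proof (rule AE_path_lawI[OF Suc.prems])
    show "AE e in first_law i. AE h in path_law (next_phase e). good_mark (next_phase ((e ## h) !! k)) ((e ## h) !! Suc k)"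
      using AE_good_mark[OF Suc.prems]
    proof eventually_elim
      case (elim e)
      then have "next_phase e \<in> {1..n}" by (simp add: good_mark_def)
      from Suc.IH[OF this] show ?case
      proof eventually_elim
        case (elim h)
        then show ?case by (cases k) (auto simp: cur_phase_def)
      qed
    qed
  qed measurable
  then show ?case by (simp add: cur_phase_def)
qed

text \<open>The Laplace transform of the exponential law at 1, obtained by recognizing the density
  of rate \<open>r + 1\<close>.\<close>

lemma nn_integral_exp_law_discount:
  assumes r: "0 < r"
  shows "(\<integral>\<^sup>+s. ennreal (exp (- s)) \<partial>exp_law r) = ennreal (r / (r + 1))"
proof -
  have "(\<integral>\<^sup>+s. ennreal (exp (- s)) \<partial>exp_law r) = (\<integral>\<^sup>+s. ennreal (exponential_density r s) * ennreal (exp (- s)) \<partial>lborel)"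
    by (rule nn_integral_density) measurable
  also have "\<dots> = (\<integral>\<^sup>+s. ennreal (r / (r + 1)) * ennreal (exponential_density (r + 1) s) \<partial>lborel)"
  proof (rule nn_integral_cong)
    fix s
    have "exponential_density r s * exp (- s) = r / (r + 1) * exponential_density (r + 1) s"
      using r by (simp add: exponential_density_def field_simps flip: exp_add)
    then show "ennreal (exponential_density r s) * ennreal (exp (- s)) = ennreal (r / (r + 1)) * ennreal (exponential_density (r + 1) s)"
      using r by (simp add: ennreal_mult'[symmetric] ennreal_mult''[symmetric] exponential_density_nonneg)
  qed
  also have "\<dots> = ennreal (r / (r + 1)) * (\<integral>\<^sup>+s. ennreal (exponential_density (r + 1) s * s ^ 0) \<partial>lborel)"
    by (simp add: nn_integral_cmult)
  also have "\<dots> = ennreal (r / (r + 1))"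
    using r by (subst nn_integral_erlang_ith_moment) simp_all
  finally show ?thesis .
qed

text \<open>Jumps do not accumulate: the expectation of \<open>exp (- jump_at k h)\<close> is at
  most \<open>\<rho> ^ k\<close> with \<open>\<rho> < 1\<close>, because each sojourn contributes a
  factor \<open>r / (r + 1)\<close> and the finitely many rates \<open>r\<close> are
  bounded.\<close>

lemma AE_path_infinite_time:
  assumes i: "i \<in> {1..n}"
  shows "AE h in path_law i. (INF k. ennreal (exp (- jump_at k h))) = 0"
proof -
  \<comment> \<open>The sum of the rates bounds each of them, and \<open>r / (r + 1)\<close>
    increases in \<open>r\<close>.\<close>
  define S where "S = (\<Sum>i\<in>{1..n}. total_intensity R i)"
  define \<rho> where "\<rho> = S / (S + 1)"
  have le_S: "total_intensity R j \<le> S" if "j \<in> {1..n}" for j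
    unfolding S_def using that rate_pos by (intro member_le_sum) (auto intro: less_imp_le)
  have S: "0 < S" using le_S[OF i] rate_pos[OF i] by simp
  have \<rho>: "0 \<le> \<rho>" "\<rho> < 1" using S by (auto simp: \<rho>_def)
  have le_\<rho>: "total_intensity R j / (total_intensity R j + 1) \<le> \<rho>" if "j \<in> {1..n}" for j
    using le_S[OF that] rate_pos[OF that] S by (auto simp: \<rho>_def field_simps)
  have bound: "(\<integral>\<^sup>+h. ennreal (exp (- jump_at k h)) \<partial>path_law j) \<le> ennreal (\<rho> ^ k)" if "j \<in> {1..n}" for j k
    using that
  proof (induction k arbitrary: j)
    case 0
    interpret prob_space "path_law j" by (rule prob_space_path_law)
    show ?case using emeasure_space_1 by simp
  next
    case (Suc k)
    have "(\<integral>\<^sup>+h. ennreal (exp (- jump_at (Suc k) h)) \<partial>path_law j) =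
       (\<integral>\<^sup>+e. \<integral>\<^sup>+h. ennreal (exp (- jump_at (Suc k) (e ## h))) \<partial>path_law (next_phase e) \<partial>first_law j)"
      by (rule nn_integral_path_law[OF Suc.prems]) measurable
    also have "\<dots> = (\<integral>\<^sup>+e. ennreal (exp (- hold e)) * (\<integral>\<^sup>+h. ennreal (exp (- jump_at k h)) \<partial>path_law (next_phase e)) \<partial>first_law j)"
      by (simp add: exp_add exp_diff ennreal_mult' nn_integral_cmult divide_inverse exp_minus)
    also have "\<dots> \<le> (\<integral>\<^sup>+e. ennreal (exp (- hold e)) * ennreal (\<rho> ^ k) \<partial>first_law j)"
    proof (rule nn_integral_mono_AE, use AE_good_mark[OF Suc.prems] in eventually_elim)
      case (elim e)
      then have "next_phase e \<in> {1..n}" by (simp add: good_mark_def)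
      from Suc.IH[OF this] show ?case by (rule mult_left_mono) simp
    qed
    also have "\<dots> = (\<integral>\<^sup>+e. ennreal (exp (- hold e)) \<partial>first_law j) * ennreal (\<rho> ^ k)"
      by (rule nn_integral_multc) measurable
    also have "(\<integral>\<^sup>+e. ennreal (exp (- hold e)) \<partial>first_law j) \<le> ennreal \<rho>"
    proof -
      interpret B: prob_space "exp_law \<beta>" by (rule prob_space_exponential_density[OF pos(2)])
      have "(\<integral>\<^sup>+e. ennreal (exp (- hold e)) \<partial>first_law j) = (\<Sum>p\<in>{1..n + 1} \<times> {1..n}. ennreal (step_prob j p) *
        (\<integral>\<^sup>+s. \<integral>\<^sup>+y. ennreal (exp (- hold (mk_mark (p, s, y)))) \<partial>exp_law \<beta> \<partial>exp_law (total_intensity R j)))"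
        by (rule nn_integral_first_law[OF Suc.prems]) measurable
      also have "\<dots> = (\<Sum>p\<in>{1..n + 1} \<times> {1..n}. ennreal (step_prob j p)) * ennreal (total_intensity R j / (total_intensity R j + 1))"
        using B.emeasure_space_1
        by (simp add: mk_mark_def split_beta' nn_integral_exp_law_discount[OF rate_pos[OF Suc.prems]] sum_distrib_right del: sum.op_ivl_Suc)
      also have "(\<Sum>p\<in>{1..n + 1} \<times> {1..n}. ennreal (step_prob j p)) = 1"
        using step_prob_sum[OF Suc.prems] step_prob_nonneg[OF Suc.prems] by (subst sum_ennreal) auto
      finally show ?thesis using le_\<rho>[OF Suc.prems] by (simp add: ennreal_leI)
    qed
    then have "(\<integral>\<^sup>+e. ennreal (exp (- hold e)) \<partial>first_law j) * ennreal (\<rho> ^ k) \<le> ennreal \<rho> * ennreal (\<rho> ^ k)"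
      by (rule mult_right_mono) simp
    finally show ?case using \<rho> by (simp add: ennreal_mult)
  qed
  have "(\<integral>\<^sup>+h. (INF k. ennreal (exp (- jump_at k h))) \<partial>path_law i) \<le> ennreal (\<rho> ^ k)" for k
    by (rule order_trans[OF nn_integral_mono bound[OF i]]) (rule INF_lower, simp)
  moreover have "(\<lambda>k. ennreal (\<rho> ^ k)) \<longlonglongrightarrow> ennreal 0"
    using \<rho> by (intro tendsto_ennrealI LIMSEQ_realpow_zero) auto
  ultimately have "(\<integral>\<^sup>+h. (INF k. ennreal (exp (- jump_at k h))) \<partial>path_law i) \<le> 0"
    using LIMSEQ_le_const by fastforce
  then have "(\<integral>\<^sup>+h. (INF k. ennreal (exp (- jump_at k h))) \<partial>path_law i) = 0" by simp
  moreover have "(\<lambda>h. INF k. ennreal (exp (- jump_at k h))) \<in> borel_measurable (path_law i)" by measurable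
  ultimately show ?thesis by (simp add: nn_integral_0_iff_AE)
qed

lemma AE_good_path:
  assumes i: "i \<in> {1..n}" shows "AE h in path_law i. good_path i h"
proof -
  have "AE h in path_law i. \<forall>k. good_mark (cur_phase i h k) (h !! k)"
    unfolding AE_all_countable using AE_good_mark_nth[OF i] by simp
  then show ?thesis using AE_path_infinite_time[OF i]
  proof eventually_elim
    case (elim h)
    have pos: "0 < hold (h !! k)" for k using elim(1) by (simp add: good_mark_def)
    have mono: "jump_at k h \<le> jump_at l h" if "k \<le> l" for k l
      unfolding jump_at_def using that pos by (intro sum_mono2) (auto intro: less_imp_le)
    have "filterlim (\<lambda>k. jump_at k h) at_top sequentially"
      unfolding filterlim_at_top_dense
    proof
      fix B :: real
      have "(INF k. ennreal (exp (- jump_at k h))) < ennreal (exp (- B))" using elim(2) by simp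
      then obtain k where "ennreal (exp (- jump_at k h)) < ennreal (exp (- B))" by (auto simp: INF_less_iff)
      then have "B < jump_at k h" by (simp add: ennreal_less_iff)
      then show "\<forall>\<^sub>F k in sequentially. B < jump_at k h"
        unfolding eventually_sequentially using mono by (intro exI[of _ k]) (auto intro: less_le_trans)
    qed
    then show ?case using elim(1) pos by (simp add: good_path_def proper_def)
  qed
qed

lemma good_path_Stream: "good_path i (e ## h) \<longleftrightarrow> good_mark i e \<and> good_path (next_phase e) h"
proof -
  have "(\<forall>k. good_mark (cur_phase i (e ## h) k) ((e ## h) !! k)) \<longleftrightarrow>
    good_mark i e \<and> (\<forall>k. good_mark (cur_phase (next_phase e) h k) (h !! k))"
  proof -
    have c: "cur_phase i (e ## h) (Suc k) = cur_phase (next_phase e) h k" "cur_phase i (e ## h) 0 = i" for k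
      by (cases k; simp add: cur_phase_def)+
    have all: "(\<forall>k. P k) \<longleftrightarrow> P 0 \<and> (\<forall>k. P (Suc k))" for P :: "nat \<Rightarrow> bool"
    proof (intro iffI conjI allI)
      fix k assume "P 0 \<and> (\<forall>k. P (Suc k))"
      then show "P k" by (cases k) simp_all
    qed simp_all
    show ?thesis
      unfolding all[of "\<lambda>k. good_mark (cur_phase i (e ## h) k) ((e ## h) !! k)"] c by simp
  qed
  then show ?thesis by (auto simp: good_path_def good_mark_def)
qed

lemma AE_marks_good:
  assumes i: "i \<in> {1..n}" shows "AE \<omega> in law R i. in_range i \<omega> \<and> good_path i (marks \<omega>)"
proof -
  have pl: "path_law i = distr (law R i) path_space marks"
    using i by (simp only: path_law_def if_True)
  have "AE \<omega> in law R i. good_path i (marks \<omega>)"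
    by (rule AE_distrD[OF marks_measurable[OF i] AE_good_path[OF i, unfolded pl]])
  then show ?thesis using AE_in_range[OF i] by eventually_elim auto
qed

text \<open>Expectation of \<open>u\<close> at the surplus that an exponential claim leaves of
  \<open>x\<close>, ruin counting as 0.\<close>

definition claim_average :: "(real \<Rightarrow> ennreal) \<Rightarrow> real \<Rightarrow> ennreal" where
  "claim_average u x = (\<integral>\<^sup>+y. (if y \<le> x then u (x - y) else 0) \<partial>exp_law \<beta>)"

lemma claim_average_measurable [measurable]:
  assumes [measurable]: "u \<in> borel_measurable borel"
  shows "claim_average u \<in> borel_measurable borel"
proof -
  interpret prob_space "exp_law \<beta>" by (rule prob_space_exponential_density[OF pos(2)])
  show ?thesis unfolding claim_average_def[abs_def] by measurable
qed

text \<open>Substituting \<open>x - y\<close> for \<open>y\<close> turns the average over the claim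
  size into the integral over the remaining surplus that appears in
  \<open>claim_iterate\<close>.\<close>

lemma claim_average_eq:
  assumes [measurable]: "u \<in> borel_measurable borel"
  shows "claim_average u x = ennreal (\<beta> * exp (- \<beta> * x)) * (\<integral>\<^sup>+y. ennreal (exp (\<beta> * y)) * u y * indicator {0..x} y \<partial>lborel)"
proof -
  have "claim_average u x = (\<integral>\<^sup>+y. ennreal (exponential_density \<beta> y) * (if y \<le> x then u (x - y) else 0) \<partial>lborel)"
    unfolding claim_average_def by (rule nn_integral_density) measurable
  also have "\<dots> = (\<integral>\<^sup>+y. ennreal (exponential_density \<beta> (x - y)) * (if x - y \<le> x then u (x - (x - y)) else 0) \<partial>lborel)"
    by (subst nn_integral_real_affine[where c="-1" and t=x]) (simp_all cong: if_cong)
  also have "\<dots> = (\<integral>\<^sup>+y. ennreal (\<beta> * exp (- \<beta> * x)) * (ennreal (exp (\<beta> * y)) * u y * indicator {0..x} y) \<partial>lborel)"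
  proof (rule nn_integral_cong)
    fix y
    have "ennreal (exponential_density \<beta> (x - y)) = ennreal (\<beta> * exp (- \<beta> * x)) * ennreal (exp (\<beta> * y))" if "y \<le> x"
    proof -
      have "exponential_density \<beta> (x - y) = \<beta> * exp (- \<beta> * x) * exp (\<beta> * y)"
        using that by (simp add: exponential_density_def algebra_simps flip: exp_add)
      then show ?thesis using pos(2) by (simp add: ennreal_mult')
    qed
    then show "ennreal (exponential_density \<beta> (x - y)) * (if x - y \<le> x then u (x - (x - y)) else 0) =
      ennreal (\<beta> * exp (- \<beta> * x)) * (ennreal (exp (\<beta> * y)) * u y * indicator {0..x} y)"
      by (cases "y \<le> x") (auto simp: exponential_density_def mult.assoc split: split_indicator)
  qed
  also have "\<dots> = ennreal (\<beta> * exp (- \<beta> * x)) * (\<integral>\<^sup>+y. ennreal (exp (\<beta> * y)) * u y * indicator {0..x} y \<partial>lborel)"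
    by (rule nn_integral_cmult) measurable
  finally show ?thesis .
qed

lemma claim_iterate_eq:
  assumes [measurable]: "\<And>j. j \<in> {1..n} \<Longrightarrow> U j \<in> borel_measurable borel"
  shows "claim_iterate R U x = (\<Sum>j\<in>{1..n}. ennreal (restart R j) * claim_average (U j) x)"
proof -
  have "claim_iterate R U x = ennreal (\<beta> * exp (- \<beta> * x)) * (\<integral>\<^sup>+y. (\<Sum>j\<in>{1..n}. ennreal (restart R j) * (ennreal (exp (\<beta> * y)) * U j y * indicator {0..x} y)) \<partial>lborel)"
    unfolding claim_iterate_def
    by (intro arg_cong2[where f="(*)"] refl nn_integral_cong) (simp add: sum_distrib_left sum_distrib_right mult_ac)
  also have "\<dots> = ennreal (\<beta> * exp (- \<beta> * x)) * (\<Sum>j\<in>{1..n}. ennreal (restart R j) * (\<integral>\<^sup>+y. ennreal (exp (\<beta> * y)) * U j y * indicator {0..x} y \<partial>lborel))"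
    by (subst nn_integral_sum, measurable) (intro arg_cong2[where f="(*)"] refl sum.cong nn_integral_cmult, measurable)
  finally show ?thesis
    by (simp add: sum_distrib_left claim_average_eq mult_ac)
qed

lemma claim_iterate_measurable [measurable]:
  assumes [measurable]: "\<And>j. j \<in> {1..n} \<Longrightarrow> U j \<in> borel_measurable borel"
  shows "claim_iterate R U \<in> borel_measurable borel"
proof -
  have "claim_iterate R U = (\<lambda>x. \<Sum>j\<in>{1..n}. ennreal (restart R j) * claim_average (U j) x)"
    by (rule ext, rule claim_iterate_eq) (rule assms)
  also have "\<dots> \<in> borel_measurable borel" by measurable
  finally show ?thesis .
qed

definition extended_value :: "(nat \<Rightarrow> real \<Rightarrow> ennreal) \<Rightarrow> nat \<Rightarrow> real \<Rightarrow> ennreal" where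
  "extended_value U z x = (if z = claim_state then claim_iterate R U x else U z x)"

lemma extended_value_measurable:
  assumes "\<And>j. j \<in> {1..n} \<Longrightarrow> U j \<in> borel_measurable borel" "z \<in> {1..n + 1}"
  shows "extended_value U z \<in> borel_measurable borel"
  using assms claim_iterate_measurable[of U] by (cases "z = claim_state") (auto simp: extended_value_def[abs_def] claim_state_def)

text \<open>Links the two ways of accounting for a claim: the iterate at state \<open>n + 1\<close>
  has already averaged over claim size and restart phase (\<open>F1\<close>), whereas the mark of a
  path carries both (\<open>F2\<close>). Prescribing \<open>F1\<close> and \<open>F2\<close> only on
  good marks leaves room for measurable versions that vanish at illegal states.\<close>

lemma nn_integral_extended_value:
  assumes i: "i \<in> {1..n}" and U: "\<And>j. j \<in> {1..n} \<Longrightarrow> U j \<in> borel_measurable borel"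
    and g [measurable]: "g \<in> borel_measurable borel" and v [measurable]: "v \<in> borel_measurable borel"
    and F1: "F1 \<in> borel_measurable mark_space" "\<And>e. good_mark i e \<Longrightarrow> F1 e = g (hold e) * extended_value U (dest e) (v (hold e))"
    and F2: "F2 \<in> borel_measurable mark_space" "\<And>e. good_mark i e \<Longrightarrow>
      F2 e = g (hold e) * (if dest e = claim_state \<and> v (hold e) - loss e < 0 then 0 else U (next_phase e) (v (hold e) - loss e))"
  shows "(\<integral>\<^sup>+e. F1 e \<partial>first_law i) = (\<integral>\<^sup>+e. F2 e \<partial>first_law i)"
proof -
  let ?A = "exp_law (total_intensity R i)" and ?B = "exp_law \<beta>"
  interpret A: prob_space ?A by (rule prob_space_exponential_density[OF rate_pos[OF i]])
  interpret B: prob_space ?B by (rule prob_space_exponential_density[OF pos(2)])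
  note [measurable] = U
  have gm: "good_mark i (mk_mark ((z, w), s, y))" if "step_prob i (z, w) \<noteq> 0" "0 < s" "0 < y" for z w s y
    using that by (auto simp: good_mark_def mk_mark_def step_prob_def jump_prob_def restart_prob_def claim_state_def split: if_splits)
  have posA: "AE s in ?A. 0 < s" by (rule AE_exp_law_pos[OF rate_pos[OF i]])
  have posB: "AE y in ?B. 0 < y" by (rule AE_exp_law_pos[OF pos(2)])
  define G where "G z = (\<integral>\<^sup>+s. g s * U z (v s) \<partial>?A)" for z
  define H where "H w = (\<integral>\<^sup>+s. g s * claim_average (U w) (v s) \<partial>?A)" for w
  have I1: "(\<integral>\<^sup>+s. \<integral>\<^sup>+y. F1 (mk_mark ((z, w), s, y)) \<partial>?B \<partial>?A) =
     (if z = claim_state then (\<Sum>j\<in>{1..n}. ennreal (restart R j) * H j) else G z)"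
    if sp: "step_prob i (z, w) \<noteq> 0" for z w
  proof -
    have "(\<integral>\<^sup>+s. \<integral>\<^sup>+y. F1 (mk_mark ((z, w), s, y)) \<partial>?B \<partial>?A) = (\<integral>\<^sup>+s. \<integral>\<^sup>+y. g s * extended_value U z (v s) \<partial>?B \<partial>?A)"
    proof (intro nn_integral_cong_AE, use posA in eventually_elim)
      case (elim s)
      show ?case
      proof (rule nn_integral_cong_AE, use posB in eventually_elim)
        case (elim y)
        show ?case using F1(2)[OF gm[OF sp \<open>0 < s\<close> elim]] by (simp add: mk_mark_def)
      qed
    qed
    also have "\<dots> = (\<integral>\<^sup>+s. g s * extended_value U z (v s) \<partial>?A)" using B.emeasure_space_1 by simp
    also have "\<dots> = (if z = claim_state then (\<Sum>j\<in>{1..n}. ennreal (restart R j) * H j) else G z)"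
    proof (cases "z = claim_state")
      case True
      have "(\<integral>\<^sup>+s. g s * extended_value U z (v s) \<partial>?A) = (\<integral>\<^sup>+s. (\<Sum>j\<in>{1..n}. ennreal (restart R j) * (g s * claim_average (U j) (v s))) \<partial>?A)"
      proof (rule nn_integral_cong)
        fix s
        have "claim_iterate R U (v s) = (\<Sum>j\<in>{1..n}. ennreal (restart R j) * claim_average (U j) (v s))"
          by (rule claim_iterate_eq) (rule U)
        then show "g s * extended_value U z (v s) = (\<Sum>j\<in>{1..n}. ennreal (restart R j) * (g s * claim_average (U j) (v s)))"
          using True by (simp add: extended_value_def sum_distrib_left mult_ac)
      qed
      also have "\<dots> = (\<Sum>j\<in>{1..n}. ennreal (restart R j) * H j)"
        unfolding H_def by (subst nn_integral_sum, measurable) (intro sum.cong refl nn_integral_cmult, measurable)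
      finally show ?thesis using True by simp
    qed (simp add: extended_value_def G_def)
    finally show ?thesis .
  qed
  have I2: "(\<integral>\<^sup>+s. \<integral>\<^sup>+y. F2 (mk_mark ((z, w), s, y)) \<partial>?B \<partial>?A) = (if z = claim_state then H w else G z)"
    if sp: "step_prob i (z, w) \<noteq> 0" for z w
  proof (cases "z = claim_state")
    case True
    have w: "w \<in> {1..n}" using sp by (auto simp: step_prob_def split: if_splits)
    note [measurable] = U[OF w]
    have "(\<integral>\<^sup>+s. \<integral>\<^sup>+y. F2 (mk_mark ((z, w), s, y)) \<partial>?B \<partial>?A) = (\<integral>\<^sup>+s. \<integral>\<^sup>+y. g s * (if y \<le> v s then U w (v s - y) else 0) \<partial>?B \<partial>?A)"
    proof (intro nn_integral_cong_AE, use posA in eventually_elim)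
      case (elim s)
      show ?case
      proof (rule nn_integral_cong_AE, use posB in eventually_elim)
        case (elim y)
        show ?case using F2(2)[OF gm[OF sp \<open>0 < s\<close> elim]] True by (simp add: mk_mark_def)
      qed
    qed
    also have "\<dots> = H w" unfolding H_def claim_average_def by (intro nn_integral_cong nn_integral_cmult) measurable
    finally show ?thesis using True by simp
  next
    case False
    have wz: "w = z" using sp False by (auto simp: step_prob_def restart_prob_def claim_state_def split: if_splits)
    have "(\<integral>\<^sup>+s. \<integral>\<^sup>+y. F2 (mk_mark ((z, w), s, y)) \<partial>?B \<partial>?A) = (\<integral>\<^sup>+s. \<integral>\<^sup>+y. g s * U z (v s) \<partial>?B \<partial>?A)"
    proof (intro nn_integral_cong_AE, use posA in eventually_elim)
      case (elim s)
      show ?case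
      proof (rule nn_integral_cong_AE, use posB in eventually_elim)
        case (elim y)
        show ?case using F2(2)[OF gm[OF sp \<open>0 < s\<close> elim]] False wz by (simp add: mk_mark_def)
      qed
    qed
    also have "\<dots> = G z" using B.emeasure_space_1 by (simp add: G_def)
    finally show ?thesis using False by simp
  qed
  let ?Z = "{1..n + 1}" and ?W = "{1..n}"
  have claim_sum: "(\<Sum>w\<in>?W. ennreal (step_prob i (claim_state, w)) * S w) = ennreal (jump_prob R i claim_state) * (\<Sum>w\<in>?W. ennreal (restart R w) * S w)" for S :: "nat \<Rightarrow> ennreal"
  proof -
    have "ennreal (step_prob i (claim_state, w)) = ennreal (jump_prob R i claim_state) * ennreal (restart R w)" if "w \<in> ?W" for w
      using that restart_nonneg[OF that] jump_prob_nonneg[OF i, of claim_state]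
      by (simp add: step_prob_def restart_prob_def claim_state_def ennreal_mult del: One_nat_def)
    then show ?thesis unfolding sum_distrib_left by (intro sum.cong refl) (simp only: mult.assoc)
  qed
  have restart1: "(\<Sum>w\<in>?W. ennreal (restart R w)) = 1"
    using restart_sum restart_nonneg by (subst sum_ennreal) auto
  have split: "(\<Sum>p\<in>?Z \<times> ?W. X p) = (\<Sum>z\<in>?Z. \<Sum>w\<in>?W. X (z, w))" for X :: "nat \<times> nat \<Rightarrow> ennreal"
    unfolding sum.cartesian_product by (rule sum.cong) auto
  have "(\<integral>\<^sup>+e. F1 e \<partial>first_law i) = (\<Sum>z\<in>?Z. \<Sum>w\<in>?W. ennreal (step_prob i (z, w)) * (if z = claim_state then (\<Sum>j\<in>{1..n}. ennreal (restart R j) * H j) else G z))"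
    unfolding nn_integral_first_law[OF i F1(1)] split
  proof (intro sum.cong refl)
    fix z w
    show "ennreal (step_prob i (z, w)) * (\<integral>\<^sup>+s. \<integral>\<^sup>+y. F1 (mk_mark ((z, w), s, y)) \<partial>?B \<partial>?A) =
      ennreal (step_prob i (z, w)) * (if z = claim_state then (\<Sum>j\<in>{1..n}. ennreal (restart R j) * H j) else G z)"
    proof (cases "step_prob i (z, w) = 0")
      case False show ?thesis unfolding I1[OF False] ..
    qed simp
  qed
  also have "\<dots> = (\<Sum>z\<in>?Z. \<Sum>w\<in>?W. ennreal (step_prob i (z, w)) * (if z = claim_state then H w else G z))"
  proof (rule sum.cong[OF refl])
    fix z assume "z \<in> ?Z"
    show "(\<Sum>w\<in>?W. ennreal (step_prob i (z, w)) * (if z = claim_state then (\<Sum>j\<in>{1..n}. ennreal (restart R j) * H j) else G z)) =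
      (\<Sum>w\<in>?W. ennreal (step_prob i (z, w)) * (if z = claim_state then H w else G z))"
    proof (cases "z = claim_state")
      case True
      \<comment> \<open>\<open>F1\<close> ignores the restart phase of the mark, so the restart
        probabilities sum to 1 there; for \<open>F2\<close> they are the weights of the
        average.\<close>
      have "(\<Sum>w\<in>?W. ennreal (step_prob i (claim_state, w)) * (\<Sum>j\<in>{1..n}. ennreal (restart R j) * H j)) =
        ennreal (jump_prob R i claim_state) * ((\<Sum>w\<in>?W. ennreal (restart R w)) * (\<Sum>j\<in>{1..n}. ennreal (restart R j) * H j))"
        unfolding claim_sum by (simp only: sum_distrib_right)
      also have "\<dots> = (\<Sum>w\<in>?W. ennreal (step_prob i (claim_state, w)) * H w)"
        unfolding claim_sum restart1 by simp
      finally show ?thesis using True by simp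
    qed simp
  qed
  also have "\<dots> = (\<integral>\<^sup>+e. F2 e \<partial>first_law i)"
    unfolding nn_integral_first_law[OF i F2(1)] split
  proof (intro sum.cong refl)
    fix z w
    show "ennreal (step_prob i (z, w)) * (if z = claim_state then H w else G z) =
      ennreal (step_prob i (z, w)) * (\<integral>\<^sup>+s. \<integral>\<^sup>+y. F2 (mk_mark ((z, w), s, y)) \<partial>?B \<partial>?A)"
    proof (cases "step_prob i (z, w) = 0")
      case False show ?thesis unfolding I2[OF False] ..
    qed simp
  qed
  finally show ?thesis .
qed

end

subsection \<open>Dynamic programming\<close>

text \<open>A superlevel set is upward closed: it is the union of the half-lines starting at its
  rational points and of its least element, if there is one.\<close>

lemma borel_measurable_mono_ennreal:
  fixes f :: "real \<Rightarrow> ennreal"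
  assumes f: "mono f"
  shows "f \<in> borel_measurable borel"
proof (rule borel_measurableI_greater)
  fix a
  let ?S = "{u. a < f u}" and ?M = "{u. a < f u \<and> (\<forall>v. a < f v \<longrightarrow> u \<le> v)}"
  have up: "v \<in> ?S" if "u \<in> ?S" "u \<le> v" for u v
    using that monoD[OF f, of u v] by auto
  have eq: "?S = (\<Union>q\<in>\<rat> \<inter> ?S. {q..}) \<union> ?M"
  proof (intro equalityI subsetI)
    fix u assume u: "u \<in> ?S"
    show "u \<in> (\<Union>q\<in>\<rat> \<inter> ?S. {q..}) \<union> ?M"
    proof (cases "u \<in> ?M")
      case False
      then obtain v where v: "v \<in> ?S" "v < u" using u by force
      then obtain q where "q \<in> \<rat>" "v < q" "q < u" using Rats_dense_in_real by blast
      then show ?thesis using up[OF v(1), of q] by (intro UnI1 UN_I[of q]) auto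
    qed simp
  next
    fix u assume "u \<in> (\<Union>q\<in>\<rat> \<inter> ?S. {q..}) \<union> ?M"
    then show "u \<in> ?S" using up by auto
  qed
  have 1: "(\<Union>q\<in>\<rat> \<inter> ?S. {q..}) \<in> sets borel"
    by (intro sets.countable_UN'') (auto intro: countable_Int1 countable_rat)
  have 2: "?M \<in> sets borel"
  proof (cases "\<exists>u. u \<in> ?M")
    case True
    then obtain u where "u \<in> ?M" ..
    then have "?M = {u}" by (auto intro: antisym)
    then show ?thesis by simp
  next
    case False
    then have "?M = {}" by blast
    then show ?thesis by (simp only: sets.empty_sets)
  qed
  have "?S \<in> sets borel" by (subst eq) (rule sets.Un[OF 1 2])
  then show "{x \<in> space borel. a < f x} \<in> sets borel" by simp
qed

text \<open>Besides the rationals, \<open>G\<close> contains the least element of each superlevel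
  set at a rational level that has one: where \<open>f\<close> jumps upwards and already takes the
  higher value, rational points to the left give values that are too small.\<close>

lemma mono_ennreal_countable_approx:
  fixes f :: "real \<Rightarrow> ennreal"
  assumes f: "mono f"
  obtains G where "countable G" "G \<noteq> {}"
    "\<And>u a. a < f u \<Longrightarrow> \<exists>q\<in>G. \<exists>r::rat. q \<le> u \<and> a < ennreal (real_of_rat r) \<and> ennreal (real_of_rat r) < f q"
proof -
  define M where "M r = {u. ennreal (real_of_rat r) < f u \<and> (\<forall>v. ennreal (real_of_rat r) < f v \<longrightarrow> u \<le> v)}" for r
  have "countable (M r)" for r
  proof (cases "\<exists>u. u \<in> M r")
    case True
    then obtain u where "u \<in> M r" ..
    then have "M r = {u}" by (auto simp: M_def intro: antisym)
    then show ?thesis by simp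
  next
    case False
    then have "M r = {}" by blast
    then show ?thesis by simp
  qed
  then have "countable (\<rat> \<union> (\<Union>r. M r))" by (intro countable_Un countable_rat countable_UN) auto
  moreover have "\<rat> \<union> (\<Union>r. M r) \<noteq> ({} :: real set)" using Rats_0 by blast
  moreover have "\<exists>q\<in>\<rat> \<union> (\<Union>r. M r). \<exists>r::rat. q \<le> u \<and> a < ennreal (real_of_rat r) \<and> ennreal (real_of_rat r) < f q"
    if a: "a < f u" for u a
  proof -
    obtain r where r: "a < ennreal (real_of_rat r)" "ennreal (real_of_rat r) < f u"
      using ennreal_rat_dense[OF a] by auto
    show ?thesis
    proof (cases "u \<in> M r")
      case True
      then show ?thesis using r by (intro bexI[of _ u] exI[of _ r]) auto
    next
      case False
      then obtain v where v: "ennreal (real_of_rat r) < f v" "v < u"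
        using r(2) by (auto simp: M_def not_le)
      then obtain q where q: "q \<in> \<rat>" "v < q" "q < u" using Rats_dense_in_real by blast
      then have "ennreal (real_of_rat r) < f q" using v(1) monoD[OF f, of v q] by (auto intro: less_le_trans)
      then show ?thesis using q r(1) by (intro bexI[of _ q] exI[of _ r]) auto
    qed
  qed
  ultimately show thesis by (rule that)
qed

section \<open>Value functions on path space\<close>

context risk begin

abbreviation borel_strat :: "strat \<Rightarrow> bool" where
  "borel_strat f \<equiv> f \<in> borel_measurable (borel \<Otimes>\<^sub>M path_space)"

text \<open>With \<open>strat_val\<close>, \<open>opt_val\<close> and \<open>opt_step\<close> this
  is the path-space counterpart of \<open>admissible\<close>, \<open>strategy_value\<close>,
  \<open>optimal_value\<close> and \<open>phase_iterate\<close>; the identification is made in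
  \<open>optimal_value_eq\<close> and \<open>phase_iterate_eq\<close>.\<close>

definition adm :: "nat \<Rightarrow> real \<Rightarrow> strat \<Rightarrow> bool" where
  "adm i x f \<longleftrightarrow> borel_strat f \<and> (AE h in path_law i. feasible (strat_path f h) x h)"

definition strat_val :: "nat \<Rightarrow> real \<Rightarrow> strat \<Rightarrow> ennreal" where
  "strat_val i x f = (\<integral>\<^sup>+h. pay (strat_path f h) (ruin (strat_path f h) x h) \<partial>path_law i)"

definition opt_val :: "nat \<Rightarrow> real \<Rightarrow> ennreal" where
  "opt_val i x = (SUP f\<in>{f. adm i x f}. strat_val i x f)"

definition first_payoff :: "(nat \<Rightarrow> real \<Rightarrow> ennreal) \<Rightarrow> real \<Rightarrow> strat \<Rightarrow> mark \<Rightarrow> ennreal" where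
  "first_payoff U x f e = pay (first_path f) (ereal (hold e)) +
     ennreal (exp (- \<delta> * hold e)) * U (dest e) (x + c * hold e - first_path f (hold e))"

definition opt_step :: "(nat \<Rightarrow> real \<Rightarrow> ennreal) \<Rightarrow> nat \<Rightarrow> real \<Rightarrow> ennreal" where
  "opt_step U i x = (SUP f\<in>{f. adm i x f}. \<integral>\<^sup>+e. first_payoff U x f e \<partial>first_law i)"

lemma pay_val_measurable [measurable]:
  assumes [measurable]: "borel_strat f"
  shows "(\<lambda>h. pay (strat_path f h) (ruin (strat_path f h) x h)) \<in> borel_measurable path_space"
    "(\<lambda>h. pay (strat_path f h) (min (ruin (strat_path f h) x h) (ereal (jump_at k h)))) \<in> borel_measurable path_space"
  by (intro pay_measurable assms ruin_measurable, measurable)+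

lemma adm_lump:
  assumes i: "i \<in> {1..n}" and f: "adm i x f" and a: "0 \<le> a"
  shows "adm i (x + a) (lump_strat a f)"
  unfolding adm_def
proof
  have [measurable]: "borel_strat f" using f by (simp add: adm_def)
  show "borel_strat (lump_strat a f)" unfolding lump_strat_def by measurable
  show "AE h in path_law i. feasible (strat_path (lump_strat a f) h) (x + a) h"
    using AE_good_path[OF i] f[unfolded adm_def, THEN conjunct2]
    by eventually_elim (auto simp: strat_path_lump good_path_def intro: feasible_lump a)
qed

lemma first_path_0 [simp]: "first_path f 0 = 0"
  by (simp add: first_path_def)

lemma strat_path_0 [simp]: "strat_path f h 0 = 0"
  by (simp add: strat_path_def)

lemma pay_lump_ruin:
  assumes "proper h" "0 \<le> a"
  shows "pay (strat_path f h) (ruin (strat_path f h) x h) \<le>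
    pay (strat_path (lump_strat a f) h) (ruin (strat_path (lump_strat a f) h) (x + a) h)"
  unfolding strat_path_lump ruin_lump[OF assms(1)]
  by (intro pay_lump ruin_nonneg assms) simp

text \<open>The extra capital is paid out at once by \<open>lump_strat\<close>; then the old
  strategy is followed.\<close>

lemma opt_val_mono:
  assumes i: "i \<in> {1..n}" shows "mono (opt_val i)"
proof (rule monoI)
  fix x y :: real assume "x \<le> y"
  then have a: "0 \<le> y - x" by simp
  show "opt_val i x \<le> opt_val i y"
    unfolding opt_val_def
  proof (rule SUP_mono)
    fix f assume "f \<in> {f. adm i x f}"
    then have "adm i y (lump_strat (y - x) f)" using adm_lump[OF i _ a, of x f] by simp
    moreover have "strat_val i x f \<le> strat_val i y (lump_strat (y - x) f)"
      unfolding strat_val_def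
    proof (rule nn_integral_mono_AE, use AE_good_path[OF i] in eventually_elim)
      case (elim h)
      then show ?case using pay_lump_ruin[OF _ a, of h f x] by (simp add: good_path_def)
    qed
    ultimately show "\<exists>g\<in>{f. adm i y f}. strat_val i x f \<le> strat_val i y g" by blast
  qed
qed

text \<open>The lump sum leaves the surplus at the first jump unchanged, so the term with
  \<open>U\<close> is the same on both sides. Monotonicity makes the iterates Borel
  (\<open>iter_measurable\<close>).\<close>

lemma opt_step_mono:
  assumes i: "i \<in> {1..n}" shows "mono (opt_step U i)"
proof (rule monoI)
  fix x y :: real assume "x \<le> y"
  then have a: "0 \<le> y - x" by simp
  show "opt_step U i x \<le> opt_step U i y"
    unfolding opt_step_def
  proof (rule SUP_mono)
    fix f assume "f \<in> {f. adm i x f}"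
    then have "adm i y (lump_strat (y - x) f)" using adm_lump[OF i _ a, of x f] by simp
    moreover have "(\<integral>\<^sup>+e. first_payoff U x f e \<partial>first_law i) \<le> (\<integral>\<^sup>+e. first_payoff U y (lump_strat (y - x) f) e \<partial>first_law i)"
    proof (rule nn_integral_mono_AE, use AE_good_mark[OF i] in eventually_elim)
      case (elim e)
      then have s: "0 < hold e" by (simp add: good_mark_def)
      have "pay (first_path f) (ereal (hold e)) \<le> pay (lump_path (y - x) (first_path f)) (ereal (hold e))"
        using s a by (intro pay_lump) auto
      moreover have "y + c * hold e - lump_path (y - x) (first_path f) (hold e) = x + c * hold e - first_path f (hold e)"
        using s by (simp add: lump_path_def)
      ultimately show ?case unfolding first_payoff_def first_path_lump by (simp only: add_right_mono)
    qed
    ultimately show "\<exists>g\<in>{f. adm i y f}. (\<integral>\<^sup>+e. first_payoff U x f e \<partial>first_law i) \<le> (\<integral>\<^sup>+e. first_payoff U y g e \<partial>first_law i)"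
      by blast
  qed
qed

text \<open>Needed to subtract \<epsilon> from the optimal value in
  \<open>opt_step_le_opt_val_eps\<close>.\<close>

lemma opt_val_finite:
  assumes i: "i \<in> {1..n}" shows "opt_val i x < \<top>"
proof -
  have "opt_val i x \<le> value_bound x"
    unfolding opt_val_def
  proof (rule SUP_least)
    fix f assume f: "f \<in> {f. adm i x f}"
    interpret prob_space "path_law i" by (rule prob_space_path_law)
    have "strat_val i x f \<le> (\<integral>\<^sup>+h. value_bound x \<partial>path_law i)"
      unfolding strat_val_def
    proof (rule nn_integral_mono_AE)
      show "AE h in path_law i. pay (strat_path f h) (ruin (strat_path f h) x h) \<le> value_bound x"
        using AE_good_path[OF i] f[simplified, unfolded adm_def, THEN conjunct2]
        by eventually_elim (auto simp: good_path_def good_mark_def intro!: pay_le_bound)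
    qed
    then show "strat_val i x f \<le> value_bound x" using emeasure_space_1 by simp
  qed
  then show ?thesis using value_bound_finite by (rule le_less_trans)
qed

lemma ruined_strat_path:
  assumes "proper (e ## h)"
  shows "surplus_after (strat_path f (e ## h)) x e = surplus_after (first_path f) x e"
    "ruined (strat_path f (e ## h)) x e \<longleftrightarrow> ruined (first_path f) x e"
  by (simp_all add: ruined_def surplus_after_def strat_path_first[OF assms])

lemma pay_strat_path_first:
  assumes "proper (e ## h)"
  shows "pay (strat_path f (e ## h)) (ereal (hold e)) = pay (first_path f) (ereal (hold e))"
  using assms by (intro pay_cong_upto) (auto simp: strat_path_first)

lemma adm_decompose:
  assumes i: "i \<in> {1..n}" and f: "adm i x f"
  shows "AE e in first_law i. good_mark i e \<and> (AE h in path_law (next_phase e).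
     good_path (next_phase e) h \<and> feasible (strat_path f (e ## h)) x (e ## h))"
proof -
  have "AE h in path_law i. good_path i h \<and> feasible (strat_path f h) x h"
    using AE_good_path[OF i] f[unfolded adm_def, THEN conjunct2] by eventually_elim simp
  from AE_path_lawD[OF i this] AE_good_mark[OF i] show ?thesis
    by eventually_elim (auto simp: good_path_Stream)
qed

text \<open>For almost every first mark the restarted strategy is feasible on almost every remaining
  path, which is admissibility from the new phase and surplus; after a ruinous claim there is
  nothing to continue.\<close>

lemma adm_continuation:
  assumes i: "i \<in> {1..n}" and f: "adm i x f"
  shows "AE e in first_law i. good_mark i e \<and> (\<not> ruined (first_path f) x e \<longrightarrow>
     adm (next_phase e) (surplus_after (first_path f) x e) (continuation f e))"
  using adm_decompose[OF i f]
proof eventually_elim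
  case (elim e)
  have "adm (next_phase e) (surplus_after (first_path f) x e) (continuation f e)" if nr: "\<not> ruined (first_path f) x e"
    unfolding adm_def
  proof
    show "borel_strat (continuation f e)"
      using f by (intro continuation_measurable) (simp add: adm_def)
    show "AE h in path_law (next_phase e). feasible (strat_path (continuation f e) h) (surplus_after (first_path f) x e) h"
      using elim[THEN conjunct2]
    proof eventually_elim
      case (elim h)
      then have pr: "proper (e ## h)" using \<open>good_mark i e \<and> _\<close> by (simp add: good_path_def good_mark_def)
      from feasible_Stream[OF pr, of "strat_path f (e ## h)" x] elim nr show ?case
        by (simp add: ruined_strat_path[OF pr] shift_strat_path[OF pr])
    qed
  qed
  then show ?case using elim by blast
qed

definition strat_val_upto :: "nat \<Rightarrow> nat \<Rightarrow> real \<Rightarrow> strat \<Rightarrow> ennreal" where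
  "strat_val_upto k i x f = (\<integral>\<^sup>+h. pay (strat_path f h) (min (ruin (strat_path f h) x h) (ereal (jump_at k h))) \<partial>path_law i)"

lemma strat_val_eq_SUP:
  assumes i: "i \<in> {1..n}" and f: "adm i x f"
  shows "strat_val i x f = (SUP k. strat_val_upto k i x f)"
proof -
  have [measurable]: "borel_strat f" using f by (simp add: adm_def)
  have ae: "AE h in path_law i. proper h \<and> regular_path (strat_path f h)"
    using AE_good_path[OF i] f[unfolded adm_def, THEN conjunct2]
    by eventually_elim (simp add: good_path_def feasible_def)
  have "strat_val i x f = (\<integral>\<^sup>+h. (SUP k. pay (strat_path f h) (min (ruin (strat_path f h) x h) (ereal (jump_at k h)))) \<partial>path_law i)"
    unfolding strat_val_def
    by (rule nn_integral_cong_AE, use ae in eventually_elim) (rule pay_eq_SUP_jumps, auto intro: ruin_nonneg)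
  also have "\<dots> = (SUP k. strat_val_upto k i x f)"
    unfolding strat_val_upto_def
  proof (rule nn_integral_monotone_convergence_SUP_AE)
    fix k
    show "AE h in path_law i. pay (strat_path f h) (min (ruin (strat_path f h) x h) (ereal (jump_at k h)))
      \<le> pay (strat_path f h) (min (ruin (strat_path f h) x h) (ereal (jump_at (Suc k) h)))"
      using ae by eventually_elim (rule pay_jump_mono, auto intro: ruin_nonneg)
  qed measurable
  finally show ?thesis .
qed

text \<open>Functions that are measurable for each fixed state are put together along the discrete
  coordinate; the default 0 discards illegal states.\<close>

lemma dest_measurable_compose:
  assumes "\<And>z. z \<in> Z \<Longrightarrow> A z \<in> borel_measurable mark_space"
  shows "(\<lambda>e. if dest e \<in> Z then A (dest e) e else 0 :: ennreal) \<in> borel_measurable mark_space"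
proof -
  have "(\<lambda>e. if z \<in> Z then A z e else 0) \<in> borel_measurable mark_space" for z
    using assms by (cases "z \<in> Z") auto
  from measurable_compose_countable[OF this, of dest] show ?thesis by measurable
qed

lemma next_phase_measurable_compose:
  assumes "\<And>z. z \<in> Z \<Longrightarrow> A z \<in> borel_measurable mark_space"
  shows "(\<lambda>e. if next_phase e \<in> Z then A (next_phase e) e else 0 :: ennreal) \<in> borel_measurable mark_space"
proof -
  have "(\<lambda>e. if z \<in> Z then A z e else 0) \<in> borel_measurable mark_space" for z
    using assms by (cases "z \<in> Z") auto
  from measurable_compose_countable[OF this, of next_phase] show ?thesis by measurable
qed

lemma surplus_after_measurable [measurable]:
  assumes [measurable]: "borel_strat f"
  shows "(\<lambda>e. surplus_after (first_path f) x e) \<in> borel_measurable mark_space"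
  unfolding surplus_after_def by measurable

lemma ruined_measurable [measurable]:
  assumes [measurable]: "borel_strat f"
  shows "Measurable.pred mark_space (ruined (first_path f) x)"
proof -
  have [measurable]: "Measurable.pred mark_space (\<lambda>e. dest e = claim_state)"
    by (intro pred_eq_countable) measurable
  show ?thesis unfolding ruined_def[abs_def] by measurable
qed

text \<open>The payoff up to the first jump is common to both sides; the rest is
  \<open>nn_integral_extended_value\<close> with the surplus before the claim as
  \<open>v\<close>.\<close>

lemma nn_integral_first_payoff:
  assumes i: "i \<in> {1..n}" and f: "borel_strat f" and U: "\<And>j. j \<in> {1..n} \<Longrightarrow> U j \<in> borel_measurable borel"
  shows "(\<integral>\<^sup>+e. first_payoff (extended_value U) x f e \<partial>first_law i) =
    (\<integral>\<^sup>+e. pay (first_path f) (ereal (hold e)) + ennreal (exp (- \<delta> * hold e)) *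
      (if ruined (first_path f) x e then 0 else U (next_phase e) (surplus_after (first_path f) x e)) \<partial>first_law i)"
proof -
  note [measurable] = f
  let ?v = "\<lambda>s. x + c * s - first_path f s" and ?g = "\<lambda>s. ennreal (exp (- \<delta> * s))"
  define F1 where "F1 e = (if dest e \<in> {1..n + 1} then ?g (hold e) * extended_value U (dest e) (?v (hold e)) else 0)" for e
  define F2 where "F2 e = (if next_phase e \<in> {1..n} then ?g (hold e) * (if ruined (first_path f) x e then 0 else U (next_phase e) (surplus_after (first_path f) x e)) else 0)" for e
  have F1 [measurable]: "F1 \<in> borel_measurable mark_space"
    unfolding F1_def
  proof (rule dest_measurable_compose)
    fix z assume "z \<in> {1..n + 1}"
    then have [measurable]: "extended_value U z \<in> borel_measurable borel" by (intro extended_value_measurable U)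
    show "(\<lambda>e. ?g (hold e) * extended_value U z (?v (hold e))) \<in> borel_measurable mark_space" by measurable
  qed
  have F2 [measurable]: "F2 \<in> borel_measurable mark_space"
    unfolding F2_def
  proof (rule next_phase_measurable_compose)
    fix w assume "w \<in> {1..n}"
    note [measurable] = U[OF this]
    show "(\<lambda>e. ?g (hold e) * (if ruined (first_path f) x e then 0 else U w (surplus_after (first_path f) x e))) \<in> borel_measurable mark_space"
      by measurable
  qed
  have "(\<integral>\<^sup>+e. first_payoff (extended_value U) x f e \<partial>first_law i) = (\<integral>\<^sup>+e. pay (first_path f) (ereal (hold e)) + F1 e \<partial>first_law i)"
    by (rule nn_integral_cong_AE, use AE_good_mark[OF i] in eventually_elim) (auto simp: first_payoff_def F1_def good_mark_def)
  also have "\<dots> = (\<integral>\<^sup>+e. pay (first_path f) (ereal (hold e)) \<partial>first_law i) + (\<integral>\<^sup>+e. F1 e \<partial>first_law i)"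
    by (rule nn_integral_add) measurable
  also have "(\<integral>\<^sup>+e. F1 e \<partial>first_law i) = (\<integral>\<^sup>+e. F2 e \<partial>first_law i)"
  proof (rule nn_integral_extended_value[OF i U, where g="?g" and v="?v"])
    show "F1 e = ?g (hold e) * extended_value U (dest e) (?v (hold e))" if "good_mark i e" for e
      using that by (simp add: F1_def good_mark_def)
    show "F2 e = ?g (hold e) * (if dest e = claim_state \<and> ?v (hold e) - loss e < 0 then 0 else U (next_phase e) (?v (hold e) - loss e))"
      if "good_mark i e" for e
    proof -
      have "?v (hold e) - loss e = surplus_after (first_path f) x e" by (simp add: surplus_after_def)
      then show ?thesis using that by (simp add: F2_def good_mark_def ruined_def)
    qed
  qed measurable
  also have "(\<integral>\<^sup>+e. pay (first_path f) (ereal (hold e)) \<partial>first_law i) + (\<integral>\<^sup>+e. F2 e \<partial>first_law i) =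
     (\<integral>\<^sup>+e. pay (first_path f) (ereal (hold e)) + F2 e \<partial>first_law i)"
    by (rule nn_integral_add[symmetric]) measurable
  also have "\<dots> = (\<integral>\<^sup>+e. pay (first_path f) (ereal (hold e)) + ?g (hold e) *
      (if ruined (first_path f) x e then 0 else U (next_phase e) (surplus_after (first_path f) x e)) \<partial>first_law i)"
    by (rule nn_integral_cong_AE, use AE_good_mark[OF i] in eventually_elim) (auto simp: F2_def good_mark_def)
  finally show ?thesis .
qed

primrec iter :: "nat \<Rightarrow> nat \<Rightarrow> real \<Rightarrow> ennreal" where
  "iter 0 = (\<lambda>i x. 0)"
| "iter (Suc k) = opt_step (extended_value (iter k))"

lemma iter_measurable: "i \<in> {1..n} \<Longrightarrow> iter k i \<in> borel_measurable borel"
  by (cases k) (auto intro!: borel_measurable_mono_ennreal opt_step_mono)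

lemma strat_val_upto_le_iter:
  "i \<in> {1..n} \<Longrightarrow> adm i x f \<Longrightarrow> strat_val_upto k i x f \<le> iter k i x"
proof (induction k arbitrary: i x f)
  case 0
  have "strat_val_upto 0 i x f = (\<integral>\<^sup>+h. 0 \<partial>path_law i)"
    unfolding strat_val_upto_def
  proof (rule nn_integral_cong_AE, use AE_good_path[OF 0(1)] in eventually_elim)
    case (elim h)
    then have "0 \<le> ruin (strat_path f h) x h" by (intro ruin_nonneg) (simp add: good_path_def)
    then have "min (ruin (strat_path f h) x h) (ereal (jump_at 0 h)) = 0" by (simp add: zero_ereal_def min_def)
    then show ?case by (simp add: pay_0)
  qed
  then show ?case by simp
next
  case (Suc k)
  note i = Suc.prems(1) and f = Suc.prems(2)
  have fm [measurable]: "borel_strat f" using f by (simp add: adm_def)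
  let ?u = "\<lambda>e. surplus_after (first_path f) x e" and ?r = "ruined (first_path f) x"
  have "strat_val_upto (Suc k) i x f = (\<integral>\<^sup>+e. \<integral>\<^sup>+h. pay (strat_path f (e ## h)) (min (ruin (strat_path f (e ## h)) x (e ## h)) (ereal (jump_at (Suc k) (e ## h)))) \<partial>path_law (next_phase e) \<partial>first_law i)"
    unfolding strat_val_upto_def by (rule nn_integral_path_law[OF i]) measurable
  also have "\<dots> \<le> (\<integral>\<^sup>+e. pay (first_path f) (ereal (hold e)) + ennreal (exp (- \<delta> * hold e)) *
      (if ?r e then 0 else iter k (next_phase e) (?u e)) \<partial>first_law i)"
  proof (rule nn_integral_mono_AE)
    show "AE e in first_law i. (\<integral>\<^sup>+h. pay (strat_path f (e ## h)) (min (ruin (strat_path f (e ## h)) x (e ## h)) (ereal (jump_at (Suc k) (e ## h)))) \<partial>path_law (next_phase e))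
      \<le> pay (first_path f) (ereal (hold e)) + ennreal (exp (- \<delta> * hold e)) * (if ?r e then 0 else iter k (next_phase e) (?u e))"
      using adm_continuation[OF i f] adm_decompose[OF i f]
    proof eventually_elim
      case (elim e)
      interpret Q: prob_space "path_law (next_phase e)" by (rule prob_space_path_law)
      have gm: "good_mark i e" and w: "next_phase e \<in> {1..n}" using elim(1) by (auto simp: good_mark_def)
      have [measurable]: "borel_strat (continuation f e)" by (rule continuation_measurable) measurable
      have "(\<integral>\<^sup>+h. pay (strat_path f (e ## h)) (min (ruin (strat_path f (e ## h)) x (e ## h)) (ereal (jump_at (Suc k) (e ## h)))) \<partial>path_law (next_phase e))
        = (\<integral>\<^sup>+h. pay (first_path f) (ereal (hold e)) + (if ?r e then 0 else ennreal (exp (- \<delta> * hold e)) *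
            pay (strat_path (continuation f e) h) (min (ruin (strat_path (continuation f e) h) (?u e) h) (ereal (jump_at k h)))) \<partial>path_law (next_phase e))"
      proof (rule nn_integral_cong_AE, use elim(2)[THEN conjunct2] in eventually_elim)
        case (elim h)
        then have pr: "proper (e ## h)" using gm by (simp add: good_path_def good_mark_def)
        have "regular_path (strat_path f (e ## h))" using elim by (simp add: feasible_def)
        from pay_Stream(1)[OF pr this, of x k] show ?case
          by (simp only: ruined_strat_path[OF pr] shift_strat_path[OF pr] pay_strat_path_first[OF pr])
      qed
      also have "\<dots> = pay (first_path f) (ereal (hold e)) + (if ?r e then 0 else ennreal (exp (- \<delta> * hold e)) * strat_val_upto k (next_phase e) (?u e) (continuation f e))"
        using Q.emeasure_space_1 by (auto simp: nn_integral_add nn_integral_cmult strat_val_upto_def)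
      also have "\<dots> \<le> pay (first_path f) (ereal (hold e)) + ennreal (exp (- \<delta> * hold e)) * (if ?r e then 0 else iter k (next_phase e) (?u e))"
        using Suc.IH[OF w, of "?u e" "continuation f e"] elim(1) by (auto intro!: add_left_mono mult_left_mono)
      finally show ?case .
    qed
  qed
  \<comment> \<open>Here the claim size and restart phase carried by the mark are traded for the
    averaged value at state \<open>n + 1\<close>.\<close>
  also have "\<dots> = (\<integral>\<^sup>+e. first_payoff (extended_value (iter k)) x f e \<partial>first_law i)"
    by (rule nn_integral_first_payoff[OF i fm iter_measurable, symmetric])
  also have "\<dots> \<le> iter (Suc k) i x"
    unfolding iter.simps opt_step_def using f by (intro SUP_upper) simp
  finally show ?case .
qed

lemma opt_val_le_SUP_iter:
  assumes i: "i \<in> {1..n}" shows "opt_val i x \<le> (SUP k. iter k i x)"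
  unfolding opt_val_def
proof (rule SUP_least)
  fix f assume "f \<in> {f. adm i x f}"
  then have f: "adm i x f" by simp
  show "strat_val i x f \<le> (SUP k. iter k i x)"
    unfolding strat_val_eq_SUP[OF i f] by (intro SUP_mono) (use strat_val_upto_le_iter[OF i f] in blast)
qed

text \<open>A countable family of strategies that is nearly optimal at every surplus level: since
  \<open>opt_val w\<close> is monotone, it is approximated from the left by its values on a countable set,
  and the excess surplus can be paid out at once.\<close>

lemma countable_near_optimal:
  "\<exists>(q :: nat \<Rightarrow> nat \<Rightarrow> real) (gs :: nat \<Rightarrow> nat \<Rightarrow> strat). (\<forall>w j. borel_strat (gs w j)) \<and>
    (\<forall>w u a. w \<in> {1..n} \<longrightarrow> a < opt_val w u \<longrightarrow>
      (\<exists>j. q w j \<le> u \<and> adm w (q w j) (gs w j) \<and> a < strat_val w (q w j) (gs w j)))"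
proof -
  have "\<exists>G. w \<in> {1..n} \<longrightarrow> countable G \<and> G \<noteq> {} \<and>
    (\<forall>u a. a < opt_val w u \<longrightarrow> (\<exists>q\<in>G. \<exists>r::rat. q \<le> u \<and> a < ennreal (real_of_rat r) \<and> ennreal (real_of_rat r) < opt_val w q))" for w
  proof (cases "w \<in> {1..n}")
    case True
    from opt_val_mono[OF this] show ?thesis by (rule mono_ennreal_countable_approx) blast
  qed blast
  then obtain G where G: "\<And>w. w \<in> {1..n} \<Longrightarrow> countable (G w)" "\<And>w. w \<in> {1..n} \<Longrightarrow> G w \<noteq> {}"
    "\<And>w u a. w \<in> {1..n} \<Longrightarrow> a < opt_val w u \<Longrightarrow> \<exists>q\<in>G w. \<exists>r::rat. q \<le> u \<and> a < ennreal (real_of_rat r) \<and> ennreal (real_of_rat r) < opt_val w q"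
    by metis
  \<comment> \<open>Enumerates the pairs of a surplus level and a rational number that a strategy at
    this level should beat.\<close>
  define e where "e w j = from_nat_into (G w \<times> (UNIV :: rat set)) j" for w j
  define q where "q w j = fst (e w j)" for w j
  \<comment> \<open>The zero strategy is a default that keeps every member of the family
    Borel.\<close>
  define gs where "gs w j = (if \<exists>f. adm w (q w j) f \<and> ennreal (real_of_rat (snd (e w j))) < strat_val w (q w j) f
    then SOME f. adm w (q w j) f \<and> ennreal (real_of_rat (snd (e w j))) < strat_val w (q w j) f else (\<lambda>_. 0))" for w j
  have gs: "adm w (q w j) (gs w j) \<and> ennreal (real_of_rat (snd (e w j))) < strat_val w (q w j) (gs w j)"
    if "\<exists>f. adm w (q w j) f \<and> ennreal (real_of_rat (snd (e w j))) < strat_val w (q w j) f" for w j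
    using someI_ex[OF that] that by (simp add: gs_def)
  show ?thesis
  proof (intro exI[of _ q] exI[of _ gs] conjI allI impI)
    show "borel_strat (gs w j)" for w j
    proof (cases "\<exists>f. adm w (q w j) f \<and> ennreal (real_of_rat (snd (e w j))) < strat_val w (q w j) f")
      case True
      from gs[OF this] show ?thesis by (simp add: adm_def)
    next
      case False
      then have "gs w j = (\<lambda>_. 0)" unfolding gs_def by (simp only: if_False)
      then show ?thesis by simp
    qed
    show "\<exists>j. q w j \<le> u \<and> adm w (q w j) (gs w j) \<and> a < strat_val w (q w j) (gs w j)"
      if w: "w \<in> {1..n}" and a: "a < opt_val w u" for w u a
    proof -
      from G(3)[OF w a] obtain p r where p: "p \<in> G w" "p \<le> u" "a < ennreal (real_of_rat r)" "ennreal (real_of_rat r) < opt_val w p"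
        by blast
      have "countable (G w \<times> (UNIV :: rat set))" using G(1)[OF w] by (intro countable_SIGMA) auto
      moreover have "(p, r) \<in> G w \<times> UNIV" using p by simp
      ultimately obtain j where j: "e w j = (p, r)" unfolding e_def by (metis from_nat_into_surj)
      obtain f where "adm w p f" "ennreal (real_of_rat r) < strat_val w p f"
        using p(4) unfolding opt_val_def by (auto simp: less_SUP_iff)
      then have "adm w (q w j) (gs w j) \<and> ennreal (real_of_rat r) < strat_val w (q w j) (gs w j)"
        using gs[of w j] by (auto simp: q_def j)
      moreover have "q w j \<le> u" using p(2) by (simp add: q_def j)
      ultimately show ?thesis using p(3) by (intro exI[of _ j]) (auto intro: less_trans)
    qed
  qed
qed

lemma opt_val_measurable: "i \<in> {1..n} \<Longrightarrow> opt_val i \<in> borel_measurable borel"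
  by (intro borel_measurable_mono_ennreal opt_val_mono)

lemma continuation_measurable2:
  assumes f: "borel_strat f"
  shows "(\<lambda>(e, p). continuation f e p) \<in> borel_measurable (mark_space \<Otimes>\<^sub>M (borel \<Otimes>\<^sub>M path_space))"
proof -
  have [measurable]: "(\<lambda>p. f (hold (fst p) + fst (snd p), fst p ## snd (snd p))) \<in> borel_measurable (mark_space \<Otimes>\<^sub>M (borel \<Otimes>\<^sub>M path_space))"
    by (rule measurable_compose[OF _ f]) measurable
  have [measurable]: "(\<lambda>p. first_path f (hold (fst p))) \<in> borel_measurable (mark_space \<Otimes>\<^sub>M (borel \<Otimes>\<^sub>M path_space))"
    by (rule measurable_compose[OF _ first_path_measurable[OF f]]) measurable
  show ?thesis unfolding continuation_def split_beta' fst_conv snd_conv by measurable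
qed

text \<open>Feasibility of \<open>f\<close> matters up to the first jump, that of \<open>g e\<close>
  after it. The separate regularity assumption covers a ruinous first claim, about which
  \<open>rest\<close> is silent.\<close>

lemma concat_feasible:
  assumes pr: "proper (e ## h)" and f: "feasible (strat_path f (e ## h)) x (e ## h)"
    and reg: "regular_path (strat_path (g e) h)"
    and rest: "\<not> ruined (first_path f) x e \<Longrightarrow> feasible (strat_path (g e) h) (surplus_after (first_path f) x e) h"
  shows "feasible (strat_path (concat_strat f g) (e ## h)) x (e ## h)"
proof (rule feasible_StreamI[OF pr])
  let ?F = "strat_path (concat_strat f g) (e ## h)" and ?f = "strat_path f (e ## h)"
  have eq: "?F t = ?f t" if "t \<le> hold e" for t
    by (rule trans[OF concat_strat_first[OF pr that] strat_path_first[OF pr that, symmetric]])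
  have rf: "regular_path ?f" using f by (simp add: feasible_def)
  show "?F 0 = 0" by simp
  show "mono_on {0..hold e} ?F"
    by (rule mono_onI) (auto simp: eq intro: regular_path_mono[OF rf])
  show "continuous (at_left t) ?F" if "0 < t" "t \<le> hold e" for t
    using rf that continuous_at_left_cong[OF that(1), of ?F ?f] eq by (auto simp: regular_path_def)
  show "?F t \<le> x + c * t" if "0 \<le> t" "t < hold e" for t
    using feasible_first[OF pr f that] that eq by simp
  show "regular_path (shift_path ?F (hold e))"
    using reg by (simp add: shift_concat_strat[OF pr])
  have s: "surplus_after ?F x e = surplus_after (first_path f) x e"
    by (simp add: surplus_after_def concat_strat_first[OF pr order_refl])
  show "feasible (shift_path ?F (hold e)) (surplus_after ?F x e) h" if "\<not> ruined ?F x e"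
    using rest that by (simp add: s shift_concat_strat[OF pr] ruined_def)
qed

lemma pay_concat:
  assumes pr: "proper (e ## h)" and F: "regular_path (strat_path (concat_strat f g) (e ## h))"
  shows "pay (strat_path (concat_strat f g) (e ## h)) (ruin (strat_path (concat_strat f g) (e ## h)) x (e ## h)) =
    pay (first_path f) (ereal (hold e)) + (if ruined (first_path f) x e then 0 else ennreal (exp (- \<delta> * hold e)) *
      pay (strat_path (g e) h) (ruin (strat_path (g e) h) (surplus_after (first_path f) x e) h))"
proof -
  let ?F = "strat_path (concat_strat f g) (e ## h)"
  have s: "surplus_after ?F x e = surplus_after (first_path f) x e"
    by (simp add: surplus_after_def concat_strat_first[OF pr order_refl])
  have p: "pay ?F (ereal (hold e)) = pay (first_path f) (ereal (hold e))"
    using pr by (intro pay_cong_upto) (auto simp: concat_strat_first)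
  have r: "ruined ?F x e \<longleftrightarrow> ruined (first_path f) x e" by (simp add: ruined_def s)
  show ?thesis
    using pay_Stream(2)[OF pr F, of x] by (simp only: s r p shift_concat_strat[OF pr])
qed

text \<open>Follow \<open>f\<close> until the first jump; then pay out the excess over a surplus level of the countable
  family and continue with the nearly optimal strategy of that level.\<close>

lemma opt_step_le_opt_val_eps:
  assumes i: "i \<in> {1..n}" and f: "adm i x f" and \<epsilon>: "0 < (\<epsilon> :: real)"
  shows "(\<integral>\<^sup>+e. first_payoff (extended_value opt_val) x f e \<partial>first_law i) \<le> opt_val i x + ennreal \<epsilon>"
proof -
  from countable_near_optimal obtain q :: "nat \<Rightarrow> nat \<Rightarrow> real" and gs :: "nat \<Rightarrow> nat \<Rightarrow> strat"
    where gs_meas: "\<And>w j. borel_strat (gs w j)"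
      and near: "\<And>w u a. w \<in> {1..n} \<Longrightarrow> a < opt_val w u \<Longrightarrow>
        \<exists>j. q w j \<le> u \<and> adm w (q w j) (gs w j) \<and> a < strat_val w (q w j) (gs w j)"
    by (elim exE conjE) blast
  note [measurable] = gs_meas
  have fm [measurable]: "borel_strat f" using f by (simp add: adm_def)
  let ?u = "surplus_after (first_path f) x" and ?r = "ruined (first_path f) x"
  \<comment> \<open>For fixed \<open>w\<close> and \<open>j\<close> the mark will enter only through
    the real number \<open>?u e\<close>, so the condition is measurable in the mark.\<close>
  define good where "good w u j \<longleftrightarrow> q w j \<le> u \<and> adm w (q w j) (gs w j) \<and> opt_val w u \<le> strat_val w (q w j) (gs w j) + ennreal \<epsilon>" for w u j
  \<comment> \<open>The value \<open>Suc j\<close> selects the least suitable index, which keeps the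
    choice measurable; 0 means that no index qualifies or that there is nothing to choose, and then
    \<open>f\<close> is continued.\<close>
  define sel where "sel w e = (if \<not> ?r e \<and> w \<in> {1..n} \<and> (\<exists>j. good w (?u e) j) then Suc (LEAST j. good w (?u e) j) else 0)" for w e
  define g where "g e = (case sel (next_phase e) e of 0 \<Rightarrow> continuation f e
    | Suc j \<Rightarrow> lump_strat (?u e - q (next_phase e) j) (gs (next_phase e) j))" for e
  have sel_meas: "sel w \<in> mark_space \<rightarrow>\<^sub>M count_space UNIV" for w
  proof (cases "w \<in> {1..n}")
    case True
    note [measurable] = opt_val_measurable[OF True]
    have [measurable]: "Measurable.pred mark_space (\<lambda>e. good w (?u e) j)" for j
      unfolding good_def by measurable
    show ?thesis unfolding sel_def[abs_def] by measurable
  next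
    case False
    then show ?thesis by (simp add: sel_def[abs_def] del: atLeastAtMost_iff)
  qed
  have sel_meas2 [measurable]: "(\<lambda>e. sel (next_phase e) e) \<in> mark_space \<rightarrow>\<^sub>M count_space UNIV"
    by (rule measurable_compose_countable[OF sel_meas]) measurable
  have sel_Suc: "\<not> ?r e \<and> w \<in> {1..n} \<and> good w (?u e) j" if "sel w e = Suc j" for w e j
    using that LeastI_ex[of "good w (?u e)"] by (auto simp: sel_def simp del: atLeastAtMost_iff split: if_splits)
  \<comment> \<open>A value above \<epsilon> could be approximated within \<epsilon> by the family.
    If no index qualifies, at most \<epsilon> is therefore lost by any continuation.\<close>
  have sel_0: "opt_val w (?u e) \<le> ennreal \<epsilon>" if "sel w e = 0" "\<not> ?r e" "w \<in> {1..n}" for w e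
  proof (rule ccontr)
    assume "\<not> ?thesis"
    then have l: "ennreal \<epsilon> < opt_val w (?u e)" by simp
    have fin: "opt_val w (?u e) < \<top>" by (rule opt_val_finite) fact
    have "opt_val w (?u e) - ennreal \<epsilon> < opt_val w (?u e)"
      using fin l \<epsilon> by (intro ennreal_between) (auto simp: less_top intro: le_less_trans[OF zero_le l])
    from near[OF that(3) this] obtain j where j: "q w j \<le> ?u e" "adm w (q w j) (gs w j)"
       "opt_val w (?u e) - ennreal \<epsilon> < strat_val w (q w j) (gs w j)" by blast
    then have "good w (?u e) j"
      using l by (auto simp: good_def ennreal_minus_le_iff add.commute dest!: less_imp_le)
    then show False using that by (auto simp: sel_def simp del: atLeastAtMost_iff split: if_splits)
  qed
  have g_meas: "(\<lambda>(e, p). g e p) \<in> borel_measurable (mark_space \<Otimes>\<^sub>M (borel \<Otimes>\<^sub>M path_space))"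
  proof -
    let ?M = "mark_space \<Otimes>\<^sub>M (borel \<Otimes>\<^sub>M path_space)"
    have "(\<lambda>p. case m of 0 \<Rightarrow> continuation f (fst p) (snd p) | Suc j \<Rightarrow> lump_strat (?u (fst p) - q w j) (gs w j) (snd p)) \<in> borel_measurable ?M" for m w
    proof (cases m)
      case 0
      then show ?thesis using continuation_measurable2[OF fm] by (simp add: split_beta')
    next
      case (Suc j)
      have [measurable]: "(\<lambda>p. ?u (fst p)) \<in> borel_measurable ?M"
        by (rule measurable_compose[OF measurable_fst surplus_after_measurable[OF fm]])
      have [measurable]: "(\<lambda>p. gs w j (snd p)) \<in> borel_measurable ?M"
        by (rule measurable_compose[OF measurable_snd gs_meas])
      show ?thesis unfolding Suc lump_strat_def by simp
    qed
    then have "(\<lambda>p. case sel (next_phase (fst p)) (fst p) of 0 \<Rightarrow> continuation f (fst p) (snd p) | Suc j \<Rightarrow> lump_strat (?u (fst p) - q w j) (gs w j) (snd p)) \<in> borel_measurable ?M" for w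
      by (rule measurable_compose_countable) (rule measurable_compose[OF measurable_fst sel_meas2])
    then have "(\<lambda>p. case sel (next_phase (fst p)) (fst p) of 0 \<Rightarrow> continuation f (fst p) (snd p)
       | Suc j \<Rightarrow> lump_strat (?u (fst p) - q (next_phase (fst p)) j) (gs (next_phase (fst p)) j) (snd p)) \<in> borel_measurable ?M"
      by (rule measurable_compose_countable) measurable
    also have "(\<lambda>p. case sel (next_phase (fst p)) (fst p) of 0 \<Rightarrow> continuation f (fst p) (snd p)
       | Suc j \<Rightarrow> lump_strat (?u (fst p) - q (next_phase (fst p)) j) (gs (next_phase (fst p)) j) (snd p)) = (\<lambda>(e, p). g e p)"
      by (auto simp: g_def fun_eq_iff split: nat.split)
    finally show ?thesis .
  qed
  define F where "F = concat_strat f g"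
  have F_meas [measurable]: "borel_strat F"
    unfolding F_def by (rule concat_strat_measurable[OF fm g_meas])
  \<comment> \<open>Feasibility need not be a measurable event, so explicit measurable null sets are
    fixed: one for \<open>f\<close>, and below one for each admissible member of the countable
    family.\<close>
  have "\<exists>N. N \<in> sets path_space \<and> emeasure (path_law i) N = 0 \<and> {h. \<not> (good_path i h \<and> feasible (strat_path f h) x h)} \<subseteq> N"
  proof -
    have "AE h in path_law i. good_path i h \<and> feasible (strat_path f h) x h"
      using AE_good_path[OF i] f[unfolded adm_def, THEN conjunct2] by eventually_elim simp
    then show ?thesis by (rule AE_E) auto
  qed
  then obtain N0 where N0: "N0 \<in> sets path_space" "emeasure (path_law i) N0 = 0"
    "\<And>h. h \<notin> N0 \<Longrightarrow> good_path i h \<and> feasible (strat_path f h) x h" by blast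
  \<comment> \<open>States that \<open>N\<close> can serve as exceptional set of
    \<open>gs w j\<close>; for a member that is not admissible any measurable set will do.\<close>
  define bad where "bad w j N \<longleftrightarrow> N \<in> sets path_space \<and> (w \<in> {1..n} \<and> adm w (q w j) (gs w j) \<longrightarrow> emeasure (path_law w) N = 0 \<and>
     {h. \<not> (good_path w h \<and> feasible (strat_path (gs w j) h) (q w j) h)} \<subseteq> N)" for w j N
  have bad_ex: "\<exists>N. bad w j N" for w j
  proof (cases "w \<in> {1..n} \<and> adm w (q w j) (gs w j)")
    case True
    have "AE h in path_law w. good_path w h \<and> feasible (strat_path (gs w j) h) (q w j) h"
      using AE_good_path[OF True[THEN conjunct1]] True[THEN conjunct2, unfolded adm_def, THEN conjunct2] by eventually_elim simp
    then show ?thesis by (rule AE_E) (auto simp: bad_def)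
  next
    case False
    then show ?thesis by (auto simp: bad_def)
  qed
  define N where "N w j = (SOME N. bad w j N)" for w j
  have N_bad: "bad w j (N w j)" for w j unfolding N_def by (rule someI_ex[OF bad_ex])
  then have N_sets: "\<And>w j. N w j \<in> sets path_space"
    and N: "\<And>w j. w \<in> {1..n} \<Longrightarrow> adm w (q w j) (gs w j) \<Longrightarrow> emeasure (path_law w) (N w j) = 0"
      "\<And>w j h. w \<in> {1..n} \<Longrightarrow> adm w (q w j) (gs w j) \<Longrightarrow> h \<notin> N w j \<Longrightarrow> good_path w h \<and> feasible (strat_path (gs w j) h) (q w j) h"
    unfolding bad_def by blast+
  note [measurable] = N0(1) N_sets
  \<comment> \<open>A measurable event of full probability on which the concatenated strategy is
    feasible, as \<open>AE_path_lawI\<close> requires.\<close>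
  define P where "P h \<longleftrightarrow> h \<notin> N0 \<and> (case sel (next_phase (shd h)) (shd h) of 0 \<Rightarrow> True | Suc j \<Rightarrow> stl h \<notin> N (next_phase (shd h)) j)" for h
  have P_meas: "Measurable.pred path_space P"
  proof -
    have "Measurable.pred path_space (\<lambda>h. case m of 0 \<Rightarrow> True | Suc j \<Rightarrow> stl h \<notin> N w j)" for m w
      by (cases m) measurable
    then have "Measurable.pred path_space (\<lambda>h. case sel (next_phase (shd h)) (shd h) of 0 \<Rightarrow> True | Suc j \<Rightarrow> stl h \<notin> N w j)" for w
      by (rule measurable_compose_countable) (rule measurable_compose[OF measurable_shd sel_meas2])
    then have [measurable]: "Measurable.pred path_space (\<lambda>h. case sel (next_phase (shd h)) (shd h) of 0 \<Rightarrow> True | Suc j \<Rightarrow> stl h \<notin> N (next_phase (shd h)) j)"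
      by (rule measurable_compose_countable) measurable
    show ?thesis unfolding P_def[abs_def] by measurable
  qed
  have AE_P2: "AE e in first_law i. good_mark i e \<and> (AE h in path_law (next_phase e). P (e ## h))"
  proof -
    have "AE h in path_law i. h \<notin> N0" using N0 by (intro AE_not_in) auto
    from AE_path_lawD[OF i this] AE_good_mark[OF i] show ?thesis
    proof eventually_elim
      case (elim e)
      have "AE h in path_law (next_phase e). case sel (next_phase e) e of 0 \<Rightarrow> True | Suc j \<Rightarrow> h \<notin> N (next_phase e) j"
      proof (cases "sel (next_phase e) e")
        case (Suc j)
        from sel_Suc[OF this] have "next_phase e \<in> {1..n}" "adm (next_phase e) (q (next_phase e) j) (gs (next_phase e) j)"
          by (auto simp: good_def)
        from N(1)[OF this] show ?thesis using Suc by (auto intro!: AE_not_in)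
      qed simp
      with elim(1) have "AE h in path_law (next_phase e). P (e ## h)"
        by eventually_elim (cases "sel (next_phase e) e"; simp add: P_def)
      then show ?case using elim(2) by simp
    qed
  qed
  have P_feasible: "proper (e ## h) \<and> feasible (strat_path F (e ## h)) x (e ## h)" if "P (e ## h)" for e h
  proof -
    have gp: "good_path i (e ## h)" and ff: "feasible (strat_path f (e ## h)) x (e ## h)"
      using that N0(3)[of "e ## h"] by (auto simp: P_def)
    have pr: "proper (e ## h)" using gp by (simp add: good_path_def)
    have "feasible (strat_path F (e ## h)) x (e ## h)"
      unfolding F_def
    proof (cases "sel (next_phase e) e")
      case 0
      have ge: "g e = continuation f e" by (simp add: g_def 0)
      show "feasible (strat_path (concat_strat f g) (e ## h)) x (e ## h)"
      proof (rule concat_feasible[OF pr ff])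
        show "regular_path (strat_path (g e) h)"
          unfolding ge shift_strat_path[OF pr, symmetric] using ff pr
          by (intro regular_path_shift) (auto simp: feasible_def)
        show "feasible (strat_path (g e) h) (surplus_after (first_path f) x e) h" if "\<not> ?r e"
          using feasible_Stream[OF pr ff] that
          by (simp add: ge ruined_strat_path[OF pr] shift_strat_path[OF pr])
      qed
    next
      case (Suc j)
      from sel_Suc[OF this] have w: "next_phase e \<in> {1..n}" and gd: "good (next_phase e) (?u e) j" by auto
      have ge: "g e = lump_strat (?u e - q (next_phase e) j) (gs (next_phase e) j)" by (simp add: g_def Suc)
      have "h \<notin> N (next_phase e) j" using that Suc by (simp add: P_def)
      with N(2)[OF w] gd have ok: "feasible (strat_path (gs (next_phase e) j) h) (q (next_phase e) j) h"
        by (auto simp: good_def)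
      have fe: "feasible (strat_path (g e) h) (?u e) h"
        using feasible_lump[OF _ ok, of "?u e - q (next_phase e) j"] pr gd
        by (simp add: ge strat_path_lump good_def)
      show "feasible (strat_path (concat_strat f g) (e ## h)) x (e ## h)"
        using fe feasible_regular[OF fe] by (intro concat_feasible[OF pr ff])
    qed
    with pr show ?thesis by simp
  qed
  have F_adm: "adm i x F"
    unfolding adm_def
  proof
    have "AE h in path_law i. P h"
      by (rule AE_path_lawI[OF i P_meas]) (use AE_P2 in \<open>auto elim!: eventually_mono\<close>)
    then show "AE h in path_law i. feasible (strat_path F h) x h"
    proof eventually_elim
      case (elim h)
      then show ?case using P_feasible[of "shd h" "stl h"] by simp
    qed
  qed fact
  interpret K: prob_space "first_law i" by (rule prob_space_first_law[OF i])
  have "(\<integral>\<^sup>+e. first_payoff (extended_value opt_val) x f e \<partial>first_law i) =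
    (\<integral>\<^sup>+e. pay (first_path f) (ereal (hold e)) + ennreal (exp (- \<delta> * hold e)) * (if ?r e then 0 else opt_val (next_phase e) (?u e)) \<partial>first_law i)"
    by (rule nn_integral_first_payoff[OF i fm opt_val_measurable])
  also have "\<dots> \<le> (\<integral>\<^sup>+e. (\<integral>\<^sup>+h. pay (strat_path F (e ## h)) (ruin (strat_path F (e ## h)) x (e ## h)) \<partial>path_law (next_phase e)) + ennreal \<epsilon> \<partial>first_law i)"
  proof (rule nn_integral_mono_AE, use AE_P2 in eventually_elim)
    case (elim e)
    let ?w = "next_phase e" and ?d = "ennreal (exp (- \<delta> * hold e))"
    interpret Q: prob_space "path_law ?w" by (rule prob_space_path_law)
    have w: "?w \<in> {1..n}" and s: "0 < hold e" using elim by (auto simp: good_mark_def)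
    \<comment> \<open>The discount factor is at most 1, so the error made after the jump does not
      grow.\<close>
    have d1: "?d \<le> 1" using s pos by (simp add: ennreal_le_1)
    have gm [measurable]: "borel_strat (g e)"
      using measurable_compose[OF measurable_Pair1' g_meas, of e] by (simp add: comp_def)
    define I where "I = (\<integral>\<^sup>+h. pay (strat_path (g e) h) (ruin (strat_path (g e) h) (?u e) h) \<partial>path_law ?w)"
    have "(\<integral>\<^sup>+h. pay (strat_path F (e ## h)) (ruin (strat_path F (e ## h)) x (e ## h)) \<partial>path_law ?w) =
      (\<integral>\<^sup>+h. pay (first_path f) (ereal (hold e)) + (if ?r e then 0 else ?d * pay (strat_path (g e) h) (ruin (strat_path (g e) h) (?u e) h)) \<partial>path_law ?w)"
      unfolding F_def
    proof (rule nn_integral_cong_AE, use elim[THEN conjunct2] in eventually_elim)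
      case (elim h)
      then show ?case using P_feasible[OF elim] pay_concat[of e h f g x]
        by (simp add: F_def feasible_def)
    qed
    also have "\<dots> = pay (first_path f) (ereal (hold e)) + (if ?r e then 0 else ?d * I)"
      using Q.emeasure_space_1 by (auto simp: nn_integral_add nn_integral_cmult I_def)
    finally have lhs: "(\<integral>\<^sup>+h. pay (strat_path F (e ## h)) (ruin (strat_path F (e ## h)) x (e ## h)) \<partial>path_law ?w) =
      pay (first_path f) (ereal (hold e)) + (if ?r e then 0 else ?d * I)" .
    have "opt_val ?w (?u e) \<le> I + ennreal \<epsilon>" if nr: "\<not> ?r e"
    proof (cases "sel ?w e")
      case 0
      then have "opt_val ?w (?u e) \<le> ennreal \<epsilon>" using sel_0 nr w by blast
      then show ?thesis by (rule order_trans) simp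
    next
      case (Suc j)
      from sel_Suc[OF this] have gd: "good ?w (?u e) j" by auto
      have ge: "g e = lump_strat (?u e - q ?w j) (gs ?w j)" by (simp add: g_def Suc)
      have "strat_val ?w (q ?w j) (gs ?w j) \<le> I"
        unfolding strat_val_def I_def
      proof (rule nn_integral_mono_AE, use AE_good_path[OF w] in eventually_elim)
        case (elim h)
        then show ?case
          using pay_lump_ruin[of h "?u e - q ?w j" "gs ?w j" "q ?w j"] gd
          by (simp add: good_path_def good_def ge)
      qed
      then show ?thesis using gd by (auto simp: good_def intro: order_trans add_right_mono)
    qed
    then have "?d * (if ?r e then 0 else opt_val ?w (?u e)) \<le> (if ?r e then 0 else ?d * I) + ennreal \<epsilon>"
    proof (cases "?r e")
      case False
      assume *: "\<not> ?r e \<Longrightarrow> opt_val ?w (?u e) \<le> I + ennreal \<epsilon>"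
      have "?d * opt_val ?w (?u e) \<le> ?d * (I + ennreal \<epsilon>)" by (rule mult_left_mono[OF *[OF False]]) simp
      also have "\<dots> = ?d * I + ?d * ennreal \<epsilon>" by (rule distrib_left)
      also have "\<dots> \<le> ?d * I + 1 * ennreal \<epsilon>" by (intro add_left_mono mult_right_mono d1) simp
      finally show ?thesis using False by simp
    qed simp
    then show ?case unfolding lhs by (simp add: add.assoc add_left_mono)
  qed
  also have "\<dots> = (\<integral>\<^sup>+e. (\<integral>\<^sup>+h. pay (strat_path F (e ## h)) (ruin (strat_path F (e ## h)) x (e ## h)) \<partial>path_law (next_phase e)) \<partial>first_law i) + ennreal \<epsilon>"
  proof -
    have "(\<lambda>e. \<integral>\<^sup>+h. pay (strat_path F (e ## h)) (ruin (strat_path F (e ## h)) x (e ## h)) \<partial>path_law (next_phase e)) \<in> borel_measurable mark_space"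
    proof (rule nn_integral_kernel_measurable)
      have "(\<lambda>p. fst p ## snd p) \<in> mark_space \<Otimes>\<^sub>M path_space \<rightarrow>\<^sub>M path_space" by measurable
      from measurable_compose[OF this pay_val_measurable(1)[OF F_meas, of x]]
      show "(\<lambda>(e, h). pay (strat_path F (e ## h)) (ruin (strat_path F (e ## h)) x (e ## h))) \<in> borel_measurable (mark_space \<Otimes>\<^sub>M path_space)"
        by (simp add: split_beta')
    qed
    then show ?thesis using K.emeasure_space_1 by (subst nn_integral_add) auto
  qed
  also have "(\<integral>\<^sup>+e. (\<integral>\<^sup>+h. pay (strat_path F (e ## h)) (ruin (strat_path F (e ## h)) x (e ## h)) \<partial>path_law (next_phase e)) \<partial>first_law i) = strat_val i x F"
    unfolding strat_val_def by (rule nn_integral_path_law[OF i, symmetric]) measurable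
  also have "strat_val i x F \<le> opt_val i x"
    unfolding opt_val_def using F_adm by (intro SUP_upper) simp
  finally show ?thesis by (simp add: add_right_mono)
qed

lemma opt_step_le_opt_val:
  assumes i: "i \<in> {1..n}"
  shows "opt_step (extended_value opt_val) i x \<le> opt_val i x"
  unfolding opt_step_def
proof (rule SUP_least)
  fix f assume "f \<in> {f. adm i x f}"
  then have "adm i x f" by simp
  then show "(\<integral>\<^sup>+e. first_payoff (extended_value opt_val) x f e \<partial>first_law i) \<le> opt_val i x"
    by (rule ennreal_le_epsilon[OF opt_step_le_opt_val_eps[OF i]])
qed

lemma claim_iterate_mono:
  assumes "\<And>j y. j \<in> {1..n} \<Longrightarrow> U j y \<le> W j y"
  shows "claim_iterate R U x \<le> claim_iterate R W x"
  unfolding claim_iterate_def using assms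
  by (intro mult_left_mono nn_integral_mono mult_right_mono sum_mono) auto

lemma opt_step_extended_mono:
  assumes i: "i \<in> {1..n}" and le: "\<And>j y. j \<in> {1..n} \<Longrightarrow> U j y \<le> W j y"
  shows "opt_step (extended_value U) i x \<le> opt_step (extended_value W) i x"
  unfolding opt_step_def
proof (rule SUP_mono)
  fix f assume "f \<in> {f. adm i x f}"
  moreover have "(\<integral>\<^sup>+e. first_payoff (extended_value U) x f e \<partial>first_law i) \<le> (\<integral>\<^sup>+e. first_payoff (extended_value W) x f e \<partial>first_law i)"
  proof (rule nn_integral_mono_AE, use AE_good_mark[OF i] in eventually_elim)
    case (elim e)
    then have "dest e \<in> {1..n + 1}" by (simp add: good_mark_def)
    then have "dest e = claim_state \<or> dest e \<in> {1..n}" by (auto simp: claim_state_def)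
    then have "extended_value U (dest e) y \<le> extended_value W (dest e) y" for y
      using le claim_iterate_mono[of U W, OF le] by (auto simp: extended_value_def simp del: atLeastAtMost_iff)
    then show ?case unfolding first_payoff_def by (intro add_left_mono mult_left_mono) auto
  qed
  ultimately show "\<exists>g\<in>{f. adm i x f}. (\<integral>\<^sup>+e. first_payoff (extended_value U) x f e \<partial>first_law i) \<le> (\<integral>\<^sup>+e. first_payoff (extended_value W) x g e \<partial>first_law i)"
    by blast
qed

text \<open>The iteration starts below the optimal value and its operator is monotone, so
  \<open>opt_step_le_opt_val\<close> keeps every iterate below.\<close>

lemma iter_le_opt_val: "i \<in> {1..n} \<Longrightarrow> iter k i x \<le> opt_val i x"
proof (induction k arbitrary: i x)
  case (Suc k)
  have "iter (Suc k) i x \<le> opt_step (extended_value opt_val) i x"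
    unfolding iter.simps by (rule opt_step_extended_mono[OF Suc.prems Suc.IH])
  also have "\<dots> \<le> opt_val i x" by (rule opt_step_le_opt_val[OF Suc.prems])
  finally show ?case .
qed simp

lemma iter_mono: "i \<in> {1..n} \<Longrightarrow> iter k i x \<le> iter (Suc k) i x"
proof (induction k arbitrary: i x)
  case (Suc k)
  show ?case unfolding iter.simps(2)[of "Suc k"] iter.simps(2)[of k]
    by (rule opt_step_extended_mono[OF Suc.prems Suc.IH[unfolded iter.simps(2)]])
qed simp

theorem iter_tendsto_opt_val:
  assumes i: "i \<in> {1..n}" shows "(\<lambda>k. iter k i x) \<longlonglongrightarrow> opt_val i x"
proof -
  have "(\<lambda>k. iter k i x) \<longlonglongrightarrow> (SUP k. iter k i x)"
    by (intro LIMSEQ_SUP incseq_SucI iter_mono i)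
  also have "(SUP k. iter k i x) = opt_val i x"
    by (intro antisym SUP_least iter_le_opt_val opt_val_le_SUP_iter i)
  finally show ?thesis .
qed

end

subsection \<open>Ruin and admissibility along the marked path\<close>

lemma pred_bex_countable:
  assumes X: "countable X" and P: "\<And>i. i \<in> X \<Longrightarrow> Measurable.pred M (P i)"
  shows "Measurable.pred M (\<lambda>x. \<exists>i\<in>X. P i x)"
proof -
  have "(\<Union>i\<in>X. {x \<in> space M. P i x}) \<in> sets M"
    using P by (intro sets.countable_UN'[OF X]) (auto simp: pred_def)
  also have "(\<Union>i\<in>X. {x \<in> space M. P i x}) = {x \<in> space M. \<exists>i\<in>X. P i x}" by auto
  finally show ?thesis by (simp add: pred_def)
qed

context risk begin

text \<open>The outcomes on which the model is identified with its marked path; by completeness of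
  the filtration this event is observed at every time (\<open>nice_observed\<close>).\<close>

definition nice :: "nat \<Rightarrow> 'a \<Rightarrow> bool" where
  "nice i \<omega> \<longleftrightarrow> in_range i \<omega> \<and> good_path i (marks \<omega>)"

lemma AE_nice: "i \<in> {1..n} \<Longrightarrow> AE \<omega> in law R i. nice i \<omega>"
  unfolding nice_def by (rule AE_marks_good)

lemma hold_marks: "hold (marks \<omega> !! k) = sojourn R k \<omega>"
  and dest_marks: "dest (marks \<omega> !! k) = target R (Suc k) \<omega>"
  and next_phase_marks: "next_phase (marks \<omega> !! k) = phase R (Suc k) \<omega>"
  by (simp_all add: marks_snth mark_at_def)

lemma jump_time_eq: "jump_time R k \<omega> = jump_at k (marks \<omega>)"
  by (simp add: jump_time_def jump_at_def hold_marks)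

lemma nice_proper: "nice i \<omega> \<Longrightarrow> proper (marks \<omega>)"
  by (simp add: nice_def good_path_def)

lemma nice_phase: "nice i \<omega> \<Longrightarrow> phase R k \<omega> = cur_phase i (marks \<omega>) k"
  by (cases k) (simp_all add: cur_phase_def next_phase_marks nice_def in_range_def)

lemma nice_good_mark: "nice i \<omega> \<Longrightarrow> good_mark (phase R k \<omega>) (marks \<omega> !! k)"
  using nice_phase[of i \<omega> k] by (simp add: nice_def good_path_def)

definition claims_upto :: "nat \<Rightarrow> mark stream \<Rightarrow> nat" where
  "claims_upto k h = (\<Sum>l<k. if dest (h !! l) = claim_state then 1 else 0)"

lemma jumps_before:
  assumes pr: "proper h" and k: "jump_at k h \<le> t" "t < jump_at (Suc k) h"
  shows "jump_at j h \<le> t \<longleftrightarrow> j \<le> k"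
proof
  assume "jump_at j h \<le> t"
  show "j \<le> k"
  proof (rule ccontr)
    assume "\<not> j \<le> k"
    then have "jump_at (Suc k) h \<le> jump_at j h" by (intro proper_jump_at_mono[OF pr]) simp
    then show False using k \<open>jump_at j h \<le> t\<close> by simp
  qed
next
  assume "j \<le> k"
  then show "jump_at j h \<le> t" using proper_jump_at_mono[OF pr, of j k] k by simp
qed

lemma state_between_jumps:
  assumes nice: "nice i \<omega>" and k: "jump_at k (marks \<omega>) \<le> t" "t < jump_at (Suc k) (marks \<omega>)"
  shows "phase_process R t \<omega> = phase R k \<omega>" "num_claims R t \<omega> = claims_upto k (marks \<omega>)"
    "aggregate_claims R t \<omega> = total_loss k (marks \<omega>)"
proof -
  note pr = nice_proper[OF nice]
  note jb = jumps_before[OF pr k]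
  have "{j. 1 \<le> j \<and> jump_time R j \<omega> \<le> t} = {1..k}"
    by (auto simp: jump_time_eq jb)
  then have "num_jumps R t \<omega> = k" by (simp add: num_jumps_def)
  then show "phase_process R t \<omega> = phase R k \<omega>" by (simp add: phase_process_def)
  have "{j. 1 \<le> j \<and> jump_time R j \<omega> \<le> t \<and> target R j \<omega> = num_phases R + 1} = Suc ` {l \<in> {..<k}. target R (Suc l) \<omega> = claim_state}"
  proof (intro equalityI subsetI)
    fix j assume "j \<in> {j. 1 \<le> j \<and> jump_time R j \<omega> \<le> t \<and> target R j \<omega> = num_phases R + 1}"
    then show "j \<in> Suc ` {l \<in> {..<k}. target R (Suc l) \<omega> = claim_state}"
      by (cases j) (auto simp: jump_time_eq jb claim_state_def)
  qed (auto simp: jump_time_eq jb claim_state_def)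
  then have "num_claims R t \<omega> = card {l \<in> {..<k}. target R (Suc l) \<omega> = claim_state}"
    by (simp add: num_claims_def card_image)
  also have "\<dots> = claims_upto k (marks \<omega>)"
    by (simp add: claims_upto_def dest_marks sum.If_cases Int_def)
  finally show nc: "num_claims R t \<omega> = claims_upto k (marks \<omega>)" .
  have "(\<Sum>j = 1..claims_upto k (marks \<omega>). claim R j \<omega>) = total_loss k (marks \<omega>)" for k
  proof (induction k)
    case (Suc k)
    then show ?case
      by (auto simp: claims_upto_def total_loss_Suc marks_snth mark_at_def claim_count_def)
  qed (simp add: claims_upto_def)
  then show "aggregate_claims R t \<omega> = total_loss k (marks \<omega>)"
    by (simp add: aggregate_claims_def nc)
qed

text \<open>\<open>good_mark\<close> excludes a jump back into the same phase, and a claim at the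
  first jump sends the absorbed process to \<open>n + 1\<close>; hence the state first changes at
  the end of the first sojourn.\<close>

lemma first_jump:
  assumes nice: "nice i \<omega>"
  shows "first_jump_time R \<omega> = hold (marks \<omega> !! 0)"
    and "absorbed_process R (hold (marks \<omega> !! 0)) \<omega> = dest (marks \<omega> !! 0)"
proof -
  let ?h = "marks \<omega>" and ?s = "hold (marks \<omega> !! 0)"
  note pr = nice_proper[OF nice]
  have j1: "jump_at (Suc 0) ?h = ?s" by (simp add: jump_at_Suc)
  have gm: "good_mark i (?h !! 0)" using nice_good_mark[OF nice, of 0] nice by (simp add: nice_def in_range_def)
  have s: "0 < ?s" using gm by (simp add: good_mark_def)
  have i: "phase R 0 \<omega> = i" using nice by (simp add: nice_def in_range_def)
  have before: "absorbed_process R t \<omega> = i" if "0 \<le> t" "t < ?s" for t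
    using state_between_jumps[OF nice, of 0 t] that i by (simp add: j1 absorbed_process_def claims_upto_def)
  have at: "absorbed_process R ?s \<omega> = dest (?h !! 0)"
    using state_between_jumps[OF nice, of 1 ?s] proper_jump_at_strict[OF pr, of 1 2] gm
    by (auto simp: j1 numeral_2_eq_2 absorbed_process_def claims_upto_def claim_state_def good_mark_def next_phase_marks[symmetric])
  then show "absorbed_process R (hold (marks \<omega> !! 0)) \<omega> = dest (marks \<omega> !! 0)" .
  have "dest (?h !! 0) \<noteq> i" using gm by (simp add: good_mark_def)
  then have "Inf {t. 0 \<le> t \<and> absorbed_process R t \<omega> \<noteq> absorbed_process R 0 \<omega>} = ?s"
    using before[of 0] s at before by (intro cInf_eq_minimum) (auto simp: not_le[symmetric])
  then show "first_jump_time R \<omega> = hold (marks \<omega> !! 0)" by (simp add: first_jump_time_def)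
qed

lemma claim_ruin_time_eq:
  assumes nice: "nice i \<omega>"
  shows "claim_ruin_time R x D \<omega> = ruin (\<lambda>t. D t \<omega>) x (marks \<omega>)"
proof -
  let ?h = "marks \<omega>"
  note pr = nice_proper[OF nice]
  have sur: "surplus R x D (jump_at (Suc k) ?h) \<omega> = x + c * jump_at (Suc k) ?h - total_loss (Suc k) ?h - D (jump_at (Suc k) ?h) \<omega>" for k
    using state_between_jumps(3)[OF nice, of "Suc k" "jump_at (Suc k) ?h"] proper_jump_at_strict[OF pr, of "Suc k" "Suc (Suc k)"]
    by (simp add: surplus_def)
  have "{t \<in> claim_times R \<omega>. surplus R x D t \<omega> < 0} = {jump_at (Suc k) ?h | k. dest (?h !! k) = claim_state \<and>
     x + c * jump_at (Suc k) ?h - total_loss (Suc k) ?h - D (jump_at (Suc k) ?h) \<omega> < 0}"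
  proof (intro equalityI subsetI)
    fix t assume "t \<in> {t \<in> claim_times R \<omega>. surplus R x D t \<omega> < 0}"
    then obtain j where j: "t = jump_at j ?h" "1 \<le> j" "target R j \<omega> = n + 1" "surplus R x D t \<omega> < 0"
      by (auto simp: claim_times_def jump_time_eq)
    then obtain k where "j = Suc k" by (cases j) auto
    then show "t \<in> {jump_at (Suc k) ?h | k. dest (?h !! k) = claim_state \<and>
     x + c * jump_at (Suc k) ?h - total_loss (Suc k) ?h - D (jump_at (Suc k) ?h) \<omega> < 0}"
      using j sur[of k] by (auto simp: dest_marks claim_state_def)
  next
    fix t assume "t \<in> {jump_at (Suc k) ?h | k. dest (?h !! k) = claim_state \<and>
     x + c * jump_at (Suc k) ?h - total_loss (Suc k) ?h - D (jump_at (Suc k) ?h) \<omega> < 0}"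
    then obtain k where "t = jump_at (Suc k) ?h" "target R (Suc k) \<omega> = n + 1" "surplus R x D t \<omega> < 0"
      using sur by (auto simp: dest_marks claim_state_def)
    then show "t \<in> {t \<in> claim_times R \<omega>. surplus R x D t \<omega> < 0}"
      unfolding claim_times_def jump_time_eq by (auto intro!: exI[of _ "Suc k"])
  qed
  then show ?thesis by (simp add: claim_ruin_time_def ruin_def)
qed

lemma budget_iff:
  assumes nice: "nice i \<omega>"
  shows "(\<forall>t\<ge>0. ereal t < claim_ruin_time R x D \<omega> \<longrightarrow> D t \<omega> \<le> x + c * t - aggregate_claims R t \<omega>) \<longleftrightarrow>
    (\<forall>k t. jump_at k (marks \<omega>) \<le> t \<longrightarrow> t < jump_at (Suc k) (marks \<omega>) \<longrightarrow> ereal t < ruin (\<lambda>t. D t \<omega>) x (marks \<omega>) \<longrightarrow>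
        D t \<omega> \<le> x + c * t - total_loss k (marks \<omega>))" (is "?L \<longleftrightarrow> ?R")
proof
  assume L: ?L
  show ?R
  proof (intro allI impI)
    fix k t assume t: "jump_at k (marks \<omega>) \<le> t" "t < jump_at (Suc k) (marks \<omega>)" "ereal t < ruin (\<lambda>t. D t \<omega>) x (marks \<omega>)"
    have "0 \<le> t" using proper_jump_at_nonneg[OF nice_proper[OF nice], of k] t(1) by simp
    moreover have "ereal t < claim_ruin_time R x D \<omega>" using t(3) claim_ruin_time_eq[OF nice, of x D] by simp
    ultimately have "D t \<omega> \<le> x + c * t - aggregate_claims R t \<omega>" using L by blast
    then show "D t \<omega> \<le> x + c * t - total_loss k (marks \<omega>)"
      by (simp only: state_between_jumps(3)[OF nice t(1,2)])
  qed
next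
  assume r: ?R
  show ?L
  proof (intro allI impI)
    fix t assume t: "0 \<le> t" "ereal t < claim_ruin_time R x D \<omega>"
    obtain k where k: "jump_at k (marks \<omega>) \<le> t" "t < jump_at (Suc k) (marks \<omega>)"
      by (rule proper_ex_interval[OF nice_proper[OF nice] t(1)])
    have "D t \<omega> \<le> x + c * t - total_loss k (marks \<omega>)"
      using r k t(2) unfolding claim_ruin_time_eq[OF nice] by blast
    then show "D t \<omega> \<le> x + c * t - aggregate_claims R t \<omega>"
      using state_between_jumps(3)[OF nice k] by simp
  qed
qed

lemma admissible_path_iff:
  assumes nice: "nice i \<omega>"
  shows "(D 0 \<omega> = 0 \<and> mono_on {0..} (\<lambda>t. D t \<omega>) \<and> (\<forall>t>0. continuous (at_left t) (\<lambda>s. D s \<omega>)) \<and>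
        (\<forall>t\<ge>0. \<exists>l. ((\<lambda>s. D s \<omega>) \<longlongrightarrow> l) (at_right t)) \<and>
        (\<forall>t\<ge>0. ereal t < claim_ruin_time R x D \<omega> \<longrightarrow> D t \<omega> \<le> x + c * t - aggregate_claims R t \<omega>))
    \<longleftrightarrow> feasible (\<lambda>t. D t \<omega>) x (marks \<omega>)"
proof -
  have "\<exists>l. ((\<lambda>s. D s \<omega>) \<longlongrightarrow> l) (at_right t)" if "regular_path (\<lambda>t. D t \<omega>)" "0 \<le> t" for t
    using right_lim_tendsto[OF that] by blast
  then show ?thesis
    unfolding budget_iff[OF nice] feasible_def regular_path_def by blast
qed

text \<open>Before \<open>ruin\<close> the budget constraint says that the surplus is nonnegative,
  so a negative surplus cannot precede the first ruinous claim.\<close>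

lemma ruin_time_eq:
  assumes nice: "nice i \<omega>" and f: "feasible (\<lambda>t. D t \<omega>) x (marks \<omega>)"
  shows "ruin_time R x D \<omega> = ruin (\<lambda>t. D t \<omega>) x (marks \<omega>)"
proof (rule antisym)
  note pr = nice_proper[OF nice]
  show "ruin_time R x D \<omega> \<le> ruin (\<lambda>t. D t \<omega>) x (marks \<omega>)"
    unfolding claim_ruin_time_eq[OF nice, symmetric] ruin_time_def claim_ruin_time_def
    using proper_jump_at_nonneg[OF pr]
    by (intro Inf_superset_mono image_mono) (auto simp: claim_times_def jump_time_eq)
  show "ruin (\<lambda>t. D t \<omega>) x (marks \<omega>) \<le> ruin_time R x D \<omega>"
    unfolding ruin_time_def
  proof (rule Inf_greatest)
    fix y assume "y \<in> ereal ` {t. 0 \<le> t \<and> surplus R x D t \<omega> < 0}"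
    then obtain t where t: "y = ereal t" "0 \<le> t" "surplus R x D t \<omega> < 0" by auto
    obtain k where k: "jump_at k (marks \<omega>) \<le> t" "t < jump_at (Suc k) (marks \<omega>)"
      by (rule proper_ex_interval[OF pr t(2)])
    show "ruin (\<lambda>t. D t \<omega>) x (marks \<omega>) \<le> y"
    proof (rule ccontr)
      assume "\<not> ?thesis"
      then have "D t \<omega> \<le> x + c * t - total_loss k (marks \<omega>)"
        using f k t(1) unfolding feasible_def by (simp add: not_le)
      then show False using t(3) state_between_jumps(3)[OF nice k] by (simp add: surplus_def)
    qed
  qed
qed

subsection \<open>Observed and predictable events\<close>

abbreviation "observed \<equiv> observed_sigma R"
abbreviation "predictable \<equiv> predictable_sigma R"

lemma observed_gen:
  "{phase_process R s -` {j} \<inter> space (law R i) |s j. 0 \<le> s \<and> s \<le> t} \<union>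
      {num_claims R s -` {m} \<inter> space (law R i) |s m. 0 \<le> s \<and> s \<le> t} \<union>
      {aggregate_claims R s -` B \<inter> space (law R i) |s B. 0 \<le> s \<and> s \<le> t \<and> B \<in> sets borel} \<union>
      null_sets (completion (law R i)) \<subseteq> Pow (space (law R i))"
  using sets.sets_into_space[of _ "completion (law R i)"] by (auto simp: null_sets_def)

lemma space_observed [simp]: "space (observed i t) = space (law R i)"
  unfolding observed_sigma_def by (rule space_measure_of[OF observed_gen])

lemma sets_observed: "sets (observed i t) = sigma_sets (space (law R i))
     ({phase_process R s -` {j} \<inter> space (law R i) |s j. 0 \<le> s \<and> s \<le> t} \<union>
      {num_claims R s -` {m} \<inter> space (law R i) |s m. 0 \<le> s \<and> s \<le> t} \<union>
      {aggregate_claims R s -` B \<inter> space (law R i) |s B. 0 \<le> s \<and> s \<le> t \<and> B \<in> sets borel} \<union>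
      null_sets (completion (law R i)))"
  unfolding observed_sigma_def by (rule sets_measure_of[OF observed_gen])

lemma observed_mono: "s \<le> t \<Longrightarrow> sets (observed i s) \<subseteq> sets (observed i t)"
  unfolding sets_observed by (intro sigma_sets_mono' Un_mono subset_refl) (blast intro: order_trans)+

lemma observed_null: "A \<in> null_sets (completion (law R i)) \<Longrightarrow> A \<in> sets (observed i t)"
  unfolding sets_observed by (rule sigma_sets.Basic) simp

lemma observed_measurable [measurable (raw)]:
  assumes "0 \<le> s" "s \<le> t"
  shows "phase_process R s \<in> observed i t \<rightarrow>\<^sub>M count_space UNIV"
    "num_claims R s \<in> observed i t \<rightarrow>\<^sub>M count_space UNIV"
    "aggregate_claims R s \<in> borel_measurable (observed i t)"
proof -
  show "phase_process R s \<in> observed i t \<rightarrow>\<^sub>M count_space UNIV"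
    unfolding measurable_count_space_eq2_countable sets_observed space_observed
  proof (intro conjI ballI)
    fix j show "phase_process R s -` {j} \<inter> space (law R i) \<in> sigma_sets (space (law R i))
     ({phase_process R s -` {j} \<inter> space (law R i) |s j. 0 \<le> s \<and> s \<le> t} \<union>
      {num_claims R s -` {m} \<inter> space (law R i) |s m. 0 \<le> s \<and> s \<le> t} \<union>
      {aggregate_claims R s -` B \<inter> space (law R i) |s B. 0 \<le> s \<and> s \<le> t \<and> B \<in> sets borel} \<union>
      null_sets (completion (law R i)))"
      by (rule sigma_sets.Basic, rule UnI1, rule UnI1, rule UnI1) (use assms in blast)
  qed simp
  show "num_claims R s \<in> observed i t \<rightarrow>\<^sub>M count_space UNIV"
    unfolding measurable_count_space_eq2_countable sets_observed space_observed
  proof (intro conjI ballI)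
    fix m show "num_claims R s -` {m} \<inter> space (law R i) \<in> sigma_sets (space (law R i))
     ({phase_process R s -` {j} \<inter> space (law R i) |s j. 0 \<le> s \<and> s \<le> t} \<union>
      {num_claims R s -` {m} \<inter> space (law R i) |s m. 0 \<le> s \<and> s \<le> t} \<union>
      {aggregate_claims R s -` B \<inter> space (law R i) |s B. 0 \<le> s \<and> s \<le> t \<and> B \<in> sets borel} \<union>
      null_sets (completion (law R i)))"
      by (rule sigma_sets.Basic, rule UnI1, rule UnI1, rule UnI2) (use assms in blast)
  qed simp
  show "aggregate_claims R s \<in> borel_measurable (observed i t)"
  proof (rule measurableI)
    fix B :: "real set" assume "B \<in> sets borel"
    then show "aggregate_claims R s -` B \<inter> space (observed i t) \<in> sets (observed i t)"
      unfolding sets_observed space_observed using assms by (intro sigma_sets.Basic) auto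
  qed simp
qed

text \<open>The filtration is completed: the exceptional set is null and hence observed at every
  time.\<close>

lemma AE_observed:
  assumes "AE \<omega> in law R i. P \<omega>"
  shows "Measurable.pred (observed i t) P"
proof -
  from assms obtain N where N: "{\<omega> \<in> space (law R i). \<not> P \<omega>} \<subseteq> N" "N \<in> null_sets (law R i)"
    unfolding eventually_ae_filter by auto
  then have "{\<omega> \<in> space (law R i). \<not> P \<omega>} \<in> null_sets (completion (law R i))"
    by (auto simp: null_sets_completion_iff2)
  then have "{\<omega> \<in> space (law R i). \<not> P \<omega>} \<in> sets (observed i t)" by (rule observed_null)
  then have "space (observed i t) - {\<omega> \<in> space (law R i). \<not> P \<omega>} \<in> sets (observed i t)"
    by (rule sets.compl_sets)
  also have "space (observed i t) - {\<omega> \<in> space (law R i). \<not> P \<omega>} = {\<omega> \<in> space (observed i t). P \<omega>}" by auto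
  finally show ?thesis by (simp add: pred_def)
qed

lemma nice_observed:
  assumes "i \<in> {1..n}" shows "Measurable.pred (observed i t) (nice i)"
  by (rule AE_observed[OF AE_nice[OF assms]])

lemma pred_observed_mono:
  assumes "Measurable.pred (observed i s) P" "s \<le> t"
  shows "Measurable.pred (observed i t) P"
  using assms observed_mono[of s t i] unfolding pred_def space_observed by auto

text \<open>The phase alone would miss a claim followed by a restart in the same phase; together
  with the number of claims it makes every jump visible (\<open>state_changes\<close>).\<close>

definition state_at :: "real \<Rightarrow> 'a \<Rightarrow> nat \<times> nat" where
  "state_at t \<omega> = (phase_process R t \<omega>, num_claims R t \<omega>)"

lemma state_changes:
  assumes nice: "nice i \<omega>" and "jump_at k (marks \<omega>) \<le> s" "s < jump_at (Suc k) (marks \<omega>)"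
    "jump_at (Suc k) (marks \<omega>) \<le> t" "t < jump_at (Suc (Suc k)) (marks \<omega>)"
  shows "state_at s \<omega> \<noteq> state_at t \<omega>"
  using state_between_jumps[OF nice assms(2,3)] state_between_jumps[OF nice assms(4,5)] nice_good_mark[OF nice, of k]
  by (auto simp: state_at_def claims_upto_def good_mark_def next_phase_marks)

text \<open>Expresses a jump time through observations at countably many times. The time
  \<open>t\<close> is added to the rationals because the jump may occur at \<open>t\<close>
  itself.\<close>

lemma next_jump_iff:
  assumes nice: "nice i \<omega>" and t: "0 \<le> t"
  shows "jump_at (Suc k) (marks \<omega>) \<le> t \<longleftrightarrow>
    (\<exists>q\<in>\<rat>. 0 \<le> q \<and> q < t \<and> jump_at k (marks \<omega>) \<le> q \<and> (\<exists>r\<in>insert t \<rat>. q < r \<and> r \<le> t \<and> state_at q \<omega> \<noteq> state_at r \<omega>))"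
    (is "?L \<longleftrightarrow> ?R")
proof
  let ?T = "\<lambda>k. jump_at k (marks \<omega>)"
  note pr = nice_proper[OF nice]
  assume L: ?L
  have "?T k < ?T (Suc k)" by (rule proper_jump_at_strict[OF pr]) simp
  then obtain q where q: "q \<in> \<rat>" "?T k < q" "q < ?T (Suc k)" using Rats_dense_in_real by blast
  have nn: "0 \<le> ?T k" by (rule proper_jump_at_nonneg[OF pr])
  have lt2: "?T (Suc k) < ?T (Suc (Suc k))" by (rule proper_jump_at_strict[OF pr]) simp
  \<comment> \<open>The second time is taken before the following jump, so that exactly one jump
    separates the two observations.\<close>
  have "\<exists>r\<in>insert t \<rat>. ?T (Suc k) \<le> r \<and> r < ?T (Suc (Suc k)) \<and> r \<le> t"
  proof (cases "?T (Suc k) = t")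
    case False
    then have "?T (Suc k) < min t (?T (Suc (Suc k)))" using L lt2 by simp
    then obtain r where "r \<in> \<rat>" "?T (Suc k) < r" "r < min t (?T (Suc (Suc k)))" using Rats_dense_in_real by blast
    then show ?thesis by (intro bexI[of _ r]) auto
  qed (use lt2 in auto)
  then obtain r where r: "r \<in> insert t \<rat>" "?T (Suc k) \<le> r" "r < ?T (Suc (Suc k))" "r \<le> t" by blast
  have "state_at q \<omega> \<noteq> state_at r \<omega>" using state_changes[OF nice, of k q r] q r by simp
  then show ?R using q r nn L by (intro bexI[of _ q] conjI bexI[of _ r]) auto
next
  let ?T = "\<lambda>k. jump_at k (marks \<omega>)"
  assume ?R
  then obtain q r where q: "?T k \<le> q" "q < r" "r \<le> t" "state_at q \<omega> \<noteq> state_at r \<omega>" by blast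
  show ?L
  proof (rule ccontr)
    assume "\<not> ?L"
    then have "state_at q \<omega> = state_at r \<omega>"
      using q state_between_jumps[OF nice, of k q] state_between_jumps[OF nice, of k r] by (simp add: state_at_def)
    then show False using q by simp
  qed
qed

text \<open>Induction along \<open>next_jump_iff\<close>, whose right-hand side involves only the
  previous jump time and states at times up to \<open>t\<close>.\<close>

lemma jump_observed:
  assumes i: "i \<in> {1..n}"
  shows "0 \<le> t \<Longrightarrow> Measurable.pred (observed i t) (\<lambda>\<omega>. nice i \<omega> \<and> jump_at k (marks \<omega>) \<le> t)"
proof (induction k arbitrary: t)
  case 0
  then show ?case using nice_observed[OF i] by simp
next
  case (Suc k)
  note [measurable] = nice_observed[OF i]
  have [measurable]: "Measurable.pred (observed i t) (\<lambda>\<omega>. nice i \<omega> \<and> jump_at k (marks \<omega>) \<le> q)" if "0 \<le> q" "q \<le> t" for q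
    using pred_observed_mono[OF Suc.IH] that by blast
  have st: "Measurable.pred (observed i t) (\<lambda>\<omega>. state_at q \<omega> \<noteq> state_at r \<omega>)" if "0 \<le> q" "q \<le> t" "0 \<le> r" "r \<le> t" for q r
  proof -
    have [measurable]: "Measurable.pred (observed i t) (\<lambda>\<omega>. phase_process R q \<omega> = phase_process R r \<omega>)"
      "Measurable.pred (observed i t) (\<lambda>\<omega>. num_claims R q \<omega> = num_claims R r \<omega>)"
      using that by (intro pred_eq_countable observed_measurable; simp)+
    show ?thesis unfolding state_at_def by simp
  qed
  have "Measurable.pred (observed i t) (\<lambda>\<omega>. \<exists>q\<in>\<rat>. 0 \<le> q \<and> q < t \<and> (nice i \<omega> \<and> jump_at k (marks \<omega>) \<le> q) \<and> (\<exists>r\<in>insert t \<rat>. q < r \<and> r \<le> t \<and> state_at q \<omega> \<noteq> state_at r \<omega>))"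
  proof (rule pred_bex_countable[OF countable_rat])
    fix q :: real
    show "Measurable.pred (observed i t) (\<lambda>\<omega>. 0 \<le> q \<and> q < t \<and> (nice i \<omega> \<and> jump_at k (marks \<omega>) \<le> q) \<and> (\<exists>r\<in>insert t \<rat>. q < r \<and> r \<le> t \<and> state_at q \<omega> \<noteq> state_at r \<omega>))"
    proof (cases "0 \<le> q \<and> q < t")
      case True
      then have a: "Measurable.pred (observed i t) (\<lambda>\<omega>. nice i \<omega> \<and> jump_at k (marks \<omega>) \<le> q)" by simp
      have "Measurable.pred (observed i t) (\<lambda>\<omega>. \<exists>r\<in>insert t \<rat>. q < r \<and> r \<le> t \<and> state_at q \<omega> \<noteq> state_at r \<omega>)"
      proof (rule pred_bex_countable)
        show "countable (insert t \<rat>)" by (simp add: countable_rat)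
        fix r
        show "Measurable.pred (observed i t) (\<lambda>\<omega>. q < r \<and> r \<le> t \<and> state_at q \<omega> \<noteq> state_at r \<omega>)"
          using st[of q r] True by (cases "q < r \<and> r \<le> t") simp_all
      qed
      from pred_intros_logic(3)[OF a this] show ?thesis using True by (simp only: simp_thms)
    next
      case False
      then have eq: "(0 \<le> q \<and> q < t \<and> X) = False" for X by blast
      show ?thesis unfolding eq by simp
    qed
  qed
  then have "Measurable.pred (observed i t) (\<lambda>\<omega>. nice i \<omega> \<and> (\<exists>q\<in>\<rat>. 0 \<le> q \<and> q < t \<and> (nice i \<omega> \<and> jump_at k (marks \<omega>) \<le> q) \<and> (\<exists>r\<in>insert t \<rat>. q < r \<and> r \<le> t \<and> state_at q \<omega> \<noteq> state_at r \<omega>)))"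
    by (intro pred_intros_logic nice_observed[OF i])
  moreover have "nice i \<omega> \<and> (\<exists>q\<in>\<rat>. 0 \<le> q \<and> q < t \<and> (nice i \<omega> \<and> jump_at k (marks \<omega>) \<le> q) \<and> (\<exists>r\<in>insert t \<rat>. q < r \<and> r \<le> t \<and> state_at q \<omega> \<noteq> state_at r \<omega>)) \<longleftrightarrow>
    nice i \<omega> \<and> jump_at (Suc k) (marks \<omega>) \<le> t" for \<omega>
    using next_jump_iff[of i \<omega> t k, OF _ Suc.prems] by blast
  ultimately show ?case by (simp only:)
qed

definition between :: "nat \<Rightarrow> nat \<Rightarrow> real \<Rightarrow> 'a \<Rightarrow> bool" where
  "between i k t \<omega> \<longleftrightarrow> nice i \<omega> \<and> jump_at k (marks \<omega>) \<le> t \<and> t < jump_at (Suc k) (marks \<omega>)"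

lemma between_observed:
  assumes i: "i \<in> {1..n}" and t: "0 \<le> t"
  shows "Measurable.pred (observed i t) (between i k t)"
proof -
  have "between i k t = (\<lambda>\<omega>. (nice i \<omega> \<and> jump_at k (marks \<omega>) \<le> t) \<and> \<not> (nice i \<omega> \<and> jump_at (Suc k) (marks \<omega>) \<le> t))"
    by (auto simp: between_def fun_eq_iff)
  then show ?thesis by (simp only:) (intro pred_intros_logic jump_observed[OF i t])
qed

lemma predictable_gen:
  "{{0} \<times> A |A. A \<in> sets (observed i 0)} \<union> {{s<..t} \<times> A |s t A. 0 \<le> s \<and> s \<le> t \<and> A \<in> sets (observed i s)}
   \<subseteq> Pow ({0..} \<times> space (law R i))"
  using sets.sets_into_space[of _ "observed i _"] by auto

lemma space_predictable: "space (predictable i) = {0..} \<times> space (law R i)"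
  unfolding predictable_sigma_def by (rule space_measure_of[OF predictable_gen])

lemma sets_predictable: "sets (predictable i) = sigma_sets ({0..} \<times> space (law R i))
  ({{0} \<times> A |A. A \<in> sets (observed i 0)} \<union> {{s<..t} \<times> A |s t A. 0 \<le> s \<and> s \<le> t \<and> A \<in> sets (observed i s)})"
  unfolding predictable_sigma_def by (rule sets_measure_of[OF predictable_gen])

text \<open>The products of \<open>(s, s + m]\<close> with an event observed at \<open>s\<close> are
  generators; their union over \<open>m\<close> is the set in question.\<close>

lemma predictable_after:
  assumes "0 \<le> s" and P: "Measurable.pred (observed i s) P"
  shows "Measurable.pred (predictable i) (\<lambda>p. s < fst p \<and> P (snd p))"
proof -
  let ?A = "{\<omega> \<in> space (law R i). P \<omega>}"
  have A: "?A \<in> sets (observed i s)" using P by (simp add: pred_def)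
  have "{s<..s + real m} \<times> ?A \<in> sets (predictable i)" for m
    unfolding sets_predictable using A assms(1) by (intro sigma_sets.Basic UnI2 CollectI exI[of _ s] exI[of _ "s + real m"] exI[of _ ?A]) auto
  then have "(\<Union>m. {s<..s + real m} \<times> ?A) \<in> sets (predictable i)" by auto
  also have "(\<Union>m. {s<..s + real m} \<times> ?A) = {p \<in> space (predictable i). s < fst p \<and> P (snd p)}"
  proof (intro equalityI subsetI)
    fix p assume p: "p \<in> {p \<in> space (predictable i). s < fst p \<and> P (snd p)}"
    obtain m where "fst p - s \<le> real m" using real_arch_simple by blast
    then have "fst p \<le> s + real m" by simp
    then show "p \<in> (\<Union>m. {s<..s + real m} \<times> ?A)" using p by (cases p) (auto simp: space_predictable intro!: exI[of _ m])
  qed (use assms(1) in \<open>auto simp: space_predictable\<close>)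
  finally show ?thesis by (simp add: pred_def)
qed

lemma fst_predictable: "fst \<in> borel_measurable (predictable i)"
proof (rule borel_measurableI_greater)
  fix a :: real
  have "{p \<in> space (predictable i). a < fst p} = (if 0 \<le> a then {p \<in> space (predictable i). a < fst p \<and> True} else space (predictable i))"
    by (auto simp: space_predictable)
  also have "\<dots> \<in> sets (predictable i)"
    using predictable_after[where s=a and i=i and P="\<lambda>_. True"] sets.top[of "observed i a"]
    by (auto simp: pred_def)
  finally show "{p \<in> space (predictable i). a < fst p} \<in> sets (predictable i)" .
qed

lemma nice_predictable:
  assumes i: "i \<in> {1..n}" shows "Measurable.pred (predictable i) (\<lambda>p. nice i (snd p))"
proof -
  have "{0} \<times> {\<omega> \<in> space (law R i). nice i \<omega>} \<in> sets (predictable i)"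
    using nice_observed[OF i, of 0] unfolding sets_predictable by (intro sigma_sets.Basic) (auto simp: pred_def)
  moreover have "{p \<in> space (predictable i). 0 < fst p \<and> nice i (snd p)} \<in> sets (predictable i)"
    using predictable_after[OF _ nice_observed[OF i], of 0] by (simp add: pred_def)
  ultimately have "{0} \<times> {\<omega> \<in> space (law R i). nice i \<omega>} \<union> {p \<in> space (predictable i). 0 < fst p \<and> nice i (snd p)} \<in> sets (predictable i)"
    by (rule sets.Un)
  also have "{0} \<times> {\<omega> \<in> space (law R i). nice i \<omega>} \<union> {p \<in> space (predictable i). 0 < fst p \<and> nice i (snd p)} = {p \<in> space (predictable i). nice i (snd p)}"
    by (auto simp: space_predictable)
  finally show ?thesis by (simp add: pred_def)
qed

text \<open>Immediately after the \<open>k\<close>-th jump there is a rational time before which no further jump occurs;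
  hence whatever is visible between two jumps is predictable after the first of them.\<close>

lemma predictable_state:
  assumes i: "i \<in> {1..n}"
    and P: "\<And>q. 0 \<le> q \<Longrightarrow> Measurable.pred (observed i q) (P q)"
    and PQ: "\<And>q \<omega>. between i k q \<omega> \<Longrightarrow> P q \<omega> \<longleftrightarrow> Q \<omega>"
  shows "Measurable.pred (predictable i) (\<lambda>p. nice i (snd p) \<and> jump_at k (marks (snd p)) < fst p \<and> Q (snd p))"
proof -
  have "Measurable.pred (predictable i) (\<lambda>p. \<exists>q\<in>\<rat> \<inter> {0..}. q < fst p \<and> (between i k q (snd p) \<and> P q (snd p)))"
  proof (rule pred_bex_countable)
    show "countable (\<rat> \<inter> {0 :: real..})" by (rule countable_Int1[OF countable_rat])
    fix q :: real assume "q \<in> \<rat> \<inter> {0..}"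
    then have q: "0 \<le> q" by simp
    show "Measurable.pred (predictable i) (\<lambda>p. q < fst p \<and> (between i k q (snd p) \<and> P q (snd p)))"
      by (rule predictable_after[OF q pred_intros_logic(3)[OF between_observed[OF i q] P[OF q]]])
  qed
  moreover have "(\<exists>q\<in>\<rat> \<inter> {0..}. q < t \<and> between i k q \<omega> \<and> P q \<omega>) \<longleftrightarrow> nice i \<omega> \<and> jump_at k (marks \<omega>) < t \<and> Q \<omega>" for t \<omega>
  proof
    assume r: "nice i \<omega> \<and> jump_at k (marks \<omega>) < t \<and> Q \<omega>"
    then have pr: "proper (marks \<omega>)" by (auto intro: nice_proper)
    have "jump_at k (marks \<omega>) < min t (jump_at (Suc k) (marks \<omega>))"
      using r proper_jump_at_strict[OF pr, of k "Suc k"] by simp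
    then obtain q where q: "q \<in> \<rat>" "jump_at k (marks \<omega>) < q" "q < min t (jump_at (Suc k) (marks \<omega>))" using Rats_dense_in_real by blast
    then have b: "between i k q \<omega>" using r by (simp add: between_def)
    have "0 \<le> q" using proper_jump_at_nonneg[OF pr, of k] q by simp
    then show "\<exists>q\<in>\<rat> \<inter> {0..}. q < t \<and> between i k q \<omega> \<and> P q \<omega>"
      using q b PQ[OF b] r by (intro bexI[of _ q]) auto
  next
    assume "\<exists>q\<in>\<rat> \<inter> {0..}. q < t \<and> between i k q \<omega> \<and> P q \<omega>"
    then obtain q where "q < t" "between i k q \<omega>" "P q \<omega>" by blast
    then show "nice i \<omega> \<and> jump_at k (marks \<omega>) < t \<and> Q \<omega>" using PQ by (auto simp: between_def)
  qed
  ultimately show ?thesis by (simp only:)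
qed

definition jumped :: "nat \<Rightarrow> nat \<Rightarrow> real \<times> 'a \<Rightarrow> bool" where
  "jumped i k p \<longleftrightarrow> nice i (snd p) \<and> jump_at k (marks (snd p)) < fst p"

lemma jumped_predictable [measurable]:
  assumes "i \<in> {1..n}" shows "Measurable.pred (predictable i) (jumped i k)"
  unfolding jumped_def[abs_def] using predictable_state[OF assms, where P="\<lambda>_ _. True" and Q="\<lambda>_. True" and k=k] by simp

text \<open>A jump before both the current time and \<open>a\<close> has been observed at some
  rational time before both.\<close>

lemma jump_at_predictable:
  assumes i: "i \<in> {1..n}"
  shows "(\<lambda>p. if jumped i k p then jump_at k (marks (snd p)) else 0) \<in> borel_measurable (predictable i)"
proof (rule borel_measurableI_less)
  fix a :: real
  have m: "Measurable.pred (predictable i) (\<lambda>p. \<exists>q\<in>\<rat> \<inter> {0..<a}. q < fst p \<and> (nice i (snd p) \<and> jump_at k (marks (snd p)) \<le> q))"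
  proof (rule pred_bex_countable)
    show "countable (\<rat> \<inter> {0..<a})" by (rule countable_Int1[OF countable_rat])
    fix q assume "q \<in> \<rat> \<inter> {0..<a}"
    then have q: "0 \<le> q" by simp
    show "Measurable.pred (predictable i) (\<lambda>p. q < fst p \<and> (nice i (snd p) \<and> jump_at k (marks (snd p)) \<le> q))"
      by (rule predictable_after[OF q jump_observed[OF i q]])
  qed
  have "(\<exists>q\<in>\<rat> \<inter> {0..<a}. q < t \<and> nice i \<omega> \<and> jump_at k (marks \<omega>) \<le> q) \<longleftrightarrow> nice i \<omega> \<and> jump_at k (marks \<omega>) < t \<and> jump_at k (marks \<omega>) < a" for t \<omega>
  proof
    assume r: "nice i \<omega> \<and> jump_at k (marks \<omega>) < t \<and> jump_at k (marks \<omega>) < a"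
    then have pr: "proper (marks \<omega>)" by (auto intro: nice_proper)
    have "jump_at k (marks \<omega>) < min t a" using r by simp
    then obtain q where q: "q \<in> \<rat>" "jump_at k (marks \<omega>) < q" "q < min t a" using Rats_dense_in_real by blast
    moreover have "0 \<le> q" using proper_jump_at_nonneg[OF pr, of k] q by simp
    ultimately show "\<exists>q\<in>\<rat> \<inter> {0..<a}. q < t \<and> nice i \<omega> \<and> jump_at k (marks \<omega>) \<le> q"
      using r by (intro bexI[of _ q]) auto
  qed auto
  with m have [measurable]: "Measurable.pred (predictable i) (\<lambda>p. nice i (snd p) \<and> jump_at k (marks (snd p)) < fst p \<and> jump_at k (marks (snd p)) < a)"
    by (simp only:)
  note [measurable] = jumped_predictable[OF i]
  have "{p \<in> space (predictable i). (nice i (snd p) \<and> jump_at k (marks (snd p)) < fst p \<and> jump_at k (marks (snd p)) < a) \<or> (\<not> jumped i k p \<and> 0 < a)} \<in> sets (predictable i)"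
    by measurable
  also have "{p \<in> space (predictable i). (nice i (snd p) \<and> jump_at k (marks (snd p)) < fst p \<and> jump_at k (marks (snd p)) < a) \<or> (\<not> jumped i k p \<and> 0 < a)} =
    {p \<in> space (predictable i). (if jumped i k p then jump_at k (marks (snd p)) else 0) < a}"
    by (auto simp: jumped_def)
  finally show "{p \<in> space (predictable i). (if jumped i k p then jump_at k (marks (snd p)) else 0) < a} \<in> sets (predictable i)" .
qed

text \<open>Between two jumps the phase, the number of claims and the aggregate claims are constant,
  so \<open>predictable_state\<close> reads their values after the \<open>k\<close>-th jump off any
  time before the next one.\<close>

lemma phase_predictable:
  assumes i: "i \<in> {1..n}"
  shows "(\<lambda>p. if jumped i k p then phase R k (snd p) else 0) \<in> predictable i \<rightarrow>\<^sub>M count_space UNIV"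
    "(\<lambda>p. if jumped i k p then claims_upto k (marks (snd p)) else 0) \<in> predictable i \<rightarrow>\<^sub>M count_space UNIV"
    "(\<lambda>p. if jumped i k p then total_loss k (marks (snd p)) else 0) \<in> borel_measurable (predictable i)"
proof -
  note [measurable] = jumped_predictable[OF i]
  have P: "Measurable.pred (observed i q) (\<lambda>\<omega>. phase_process R q \<omega> = j)" "Measurable.pred (observed i q) (\<lambda>\<omega>. num_claims R q \<omega> = j)"
    if "0 \<le> q" for q j
    using that by (intro pred_eq_countable observed_measurable; simp)+
  have pc: "f \<in> predictable i \<rightarrow>\<^sub>M count_space UNIV" if "\<And>j. Measurable.pred (predictable i) (\<lambda>p. f p = j)" for f :: "real \<times> 'a \<Rightarrow> nat"
    unfolding measurable_count_space_eq2_countable using that by (auto simp: pred_def vimage_def Int_def conj_commute)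
  show "(\<lambda>p. if jumped i k p then phase R k (snd p) else 0) \<in> predictable i \<rightarrow>\<^sub>M count_space UNIV"
  proof (rule pc)
    fix j
    have [measurable]: "Measurable.pred (predictable i) (\<lambda>p. nice i (snd p) \<and> jump_at k (marks (snd p)) < fst p \<and> phase R k (snd p) = j)"
      by (rule predictable_state[OF i P(1)]) (auto simp: between_def state_between_jumps)
    have "Measurable.pred (predictable i) (\<lambda>p. (nice i (snd p) \<and> jump_at k (marks (snd p)) < fst p \<and> phase R k (snd p) = j) \<or> (\<not> jumped i k p \<and> 0 = j))"
      by measurable
    also have "(\<lambda>p. (nice i (snd p) \<and> jump_at k (marks (snd p)) < fst p \<and> phase R k (snd p) = j) \<or> (\<not> jumped i k p \<and> 0 = j)) =
      (\<lambda>p. (if jumped i k p then phase R k (snd p) else 0) = j)" by (auto simp: jumped_def fun_eq_iff)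
    finally show "Measurable.pred (predictable i) (\<lambda>p. (if jumped i k p then phase R k (snd p) else 0) = j)" .
  qed
  show "(\<lambda>p. if jumped i k p then claims_upto k (marks (snd p)) else 0) \<in> predictable i \<rightarrow>\<^sub>M count_space UNIV"
  proof (rule pc)
    fix j
    have [measurable]: "Measurable.pred (predictable i) (\<lambda>p. nice i (snd p) \<and> jump_at k (marks (snd p)) < fst p \<and> claims_upto k (marks (snd p)) = j)"
      by (rule predictable_state[OF i P(2)]) (auto simp: between_def state_between_jumps)
    have "Measurable.pred (predictable i) (\<lambda>p. (nice i (snd p) \<and> jump_at k (marks (snd p)) < fst p \<and> claims_upto k (marks (snd p)) = j) \<or> (\<not> jumped i k p \<and> 0 = j))"
      by measurable
    also have "(\<lambda>p. (nice i (snd p) \<and> jump_at k (marks (snd p)) < fst p \<and> claims_upto k (marks (snd p)) = j) \<or> (\<not> jumped i k p \<and> 0 = j)) =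
      (\<lambda>p. (if jumped i k p then claims_upto k (marks (snd p)) else 0) = j)" by (auto simp: jumped_def fun_eq_iff)
    finally show "Measurable.pred (predictable i) (\<lambda>p. (if jumped i k p then claims_upto k (marks (snd p)) else 0) = j)" .
  qed
  show "(\<lambda>p. if jumped i k p then total_loss k (marks (snd p)) else 0) \<in> borel_measurable (predictable i)"
  proof (rule borel_measurableI_less)
    fix a :: real
    have [measurable]: "Measurable.pred (predictable i) (\<lambda>p. nice i (snd p) \<and> jump_at k (marks (snd p)) < fst p \<and> total_loss k (marks (snd p)) < a)"
    proof (rule predictable_state[OF i])
      show "Measurable.pred (observed i q) (\<lambda>\<omega>. aggregate_claims R q \<omega> < a)" if "0 \<le> q" for q
      proof -
        have [measurable]: "aggregate_claims R q \<in> borel_measurable (observed i q)" using that by (intro observed_measurable) auto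
        show ?thesis by measurable
      qed
    qed (auto simp: between_def state_between_jumps)
    have "{p \<in> space (predictable i). (nice i (snd p) \<and> jump_at k (marks (snd p)) < fst p \<and> total_loss k (marks (snd p)) < a) \<or> (\<not> jumped i k p \<and> 0 < a)} \<in> sets (predictable i)"
      by measurable
    also have "{p \<in> space (predictable i). (nice i (snd p) \<and> jump_at k (marks (snd p)) < fst p \<and> total_loss k (marks (snd p)) < a) \<or> (\<not> jumped i k p \<and> 0 < a)} =
      {p \<in> space (predictable i). (if jumped i k p then total_loss k (marks (snd p)) else 0) < a}"
      by (auto simp: jumped_def)
    finally show "{p \<in> space (predictable i). (if jumped i k p then total_loss k (marks (snd p)) else 0) < a} \<in> sets (predictable i)" .
  qed
qed

text \<open>Each mark is rebuilt from predictable data: differences of jump times and of total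
  losses, the phase, and the number of claims, whose increase tells a claim from an ordinary jump.
  The target of an ordinary jump is the new phase.\<close>

lemma past_predictable:
  assumes i: "i \<in> {1..n}"
  shows "(\<lambda>p. if nice i (snd p) then past (fst p) (marks (snd p)) else no_marks) \<in> predictable i \<rightarrow>\<^sub>M path_space"
proof (rule measurable_stream_space2)
  fix k
  note [measurable] = jumped_predictable[OF i]
  define T where "T k p = (if jumped i k p then jump_at k (marks (snd p)) else 0)" for k p
  define J where "J k p = (if jumped i k p then phase R k (snd p) else 0)" for k p
  define C where "C k p = (if jumped i k p then claims_upto k (marks (snd p)) else 0)" for k p
  define L where "L k p = (if jumped i k p then total_loss k (marks (snd p)) else 0)" for k p
  have [measurable]: "T k \<in> borel_measurable (predictable i)" "J k \<in> predictable i \<rightarrow>\<^sub>M count_space UNIV"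
    "C k \<in> predictable i \<rightarrow>\<^sub>M count_space UNIV" "L k \<in> borel_measurable (predictable i)" for k
    unfolding T_def J_def C_def L_def by (rule jump_at_predictable[OF i] phase_predictable[OF i])+
  have [measurable]: "Measurable.pred (predictable i) (\<lambda>p. C (Suc k) p = C k p)" by (rule pred_eq_countable) measurable
  have "(\<lambda>p. if jumped i (Suc k) p then (T (Suc k) p - T k p, if C (Suc k) p = C k p then J (Suc k) p else claim_state, J (Suc k) p, L (Suc k) p - L k p) else no_mark)
    \<in> predictable i \<rightarrow>\<^sub>M mark_space"
    by measurable
  also have "(\<lambda>p. if jumped i (Suc k) p then (T (Suc k) p - T k p, if C (Suc k) p = C k p then J (Suc k) p else claim_state, J (Suc k) p, L (Suc k) p - L k p) else no_mark) =
    (\<lambda>p. (if nice i (snd p) then past (fst p) (marks (snd p)) else no_marks) !! k)"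
  proof
    fix p
    show "(if jumped i (Suc k) p then (T (Suc k) p - T k p, if C (Suc k) p = C k p then J (Suc k) p else claim_state, J (Suc k) p, L (Suc k) p - L k p) else no_mark) =
      (if nice i (snd p) then past (fst p) (marks (snd p)) else no_marks) !! k"
    proof (cases "jumped i (Suc k) p")
      case True
      then have ni: "nice i (snd p)" and lt: "jump_at (Suc k) (marks (snd p)) < fst p" by (auto simp: jumped_def)
      have "jump_at k (marks (snd p)) < jump_at (Suc k) (marks (snd p))"
        by (rule proper_jump_at_strict[OF nice_proper[OF ni]]) simp
      then have J0: "jumped i k p" using True by (simp add: jumped_def)
      have gm: "good_mark (phase R k (snd p)) (marks (snd p) !! k)" by (rule nice_good_mark[OF ni])
      have "marks (snd p) !! k = (T (Suc k) p - T k p, if C (Suc k) p = C k p then J (Suc k) p else claim_state, J (Suc k) p, L (Suc k) p - L k p)"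
        using True J0 gm by (auto simp: prod_eq_iff T_def C_def J_def L_def jump_at_Suc total_loss_Suc claims_upto_def next_phase_marks dest_marks good_mark_def)
      then show ?thesis using True ni lt by (simp add: past_snth)
    qed (auto simp: jumped_def past_snth)
  qed
  finally show "(\<lambda>p. (if nice i (snd p) then past (fst p) (marks (snd p)) else no_marks) !! k) \<in> predictable i \<rightarrow>\<^sub>M mark_space" .
qed

lemma strat_predictable:
  assumes i: "i \<in> {1..n}" and f: "borel_strat f"
  shows "(\<lambda>(t, \<omega>). if nice i \<omega> then strat_path f (marks \<omega>) t else 0) \<in> borel_measurable (predictable i)"
proof -
  note [measurable] = nice_predictable[OF i] fst_predictable
  have "(\<lambda>p. (fst p, if nice i (snd p) then past (fst p) (marks (snd p)) else no_marks)) \<in> predictable i \<rightarrow>\<^sub>M borel \<Otimes>\<^sub>M path_space"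
    by (intro measurable_Pair fst_predictable past_predictable[OF i])
  from measurable_compose[OF this f]
  have [measurable]: "(\<lambda>p. f (fst p, if nice i (snd p) then past (fst p) (marks (snd p)) else no_marks)) \<in> borel_measurable (predictable i)" .
  have "(\<lambda>p. if nice i (snd p) then if fst p \<le> 0 then 0 else f (fst p, if nice i (snd p) then past (fst p) (marks (snd p)) else no_marks) else 0) \<in> borel_measurable (predictable i)"
    by measurable
  also have "(\<lambda>p. if nice i (snd p) then if fst p \<le> 0 then 0 else f (fst p, if nice i (snd p) then past (fst p) (marks (snd p)) else no_marks) else 0) =
    (\<lambda>(t, \<omega>). if nice i \<omega> then strat_path f (marks \<omega>) t else 0)"
    by (auto simp: strat_path_def fun_eq_iff)
  finally show ?thesis .
qed

section \<open>Predictable processes as functions of time and past\<close>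

lemma past_prefix:
  assumes pr: "proper h" and "jump_at k h < u" "l < k"
  shows "past u h !! l = h !! l"
  using proper_jump_at_mono[OF pr, of "Suc l" k] assms by (simp add: past_snth)

lemma jump_at_past:
  assumes pr: "proper h" and k: "jump_at k h < u"
  shows "jump_at k (past u h) = jump_at k h"
  unfolding jump_at_def by (intro sum.cong refl) (simp add: past_prefix[OF pr k])

text \<open>In \<open>past t h\<close> the first mark with sojourn time \<open>0\<close> stands for the first jump that has not yet been
  seen. Thus \<open>visible k r\<close> says that exactly \<open>k\<close> jumps occur up to time \<open>r\<close>, and for \<open>r < t\<close> this can be
  read off \<open>past t h\<close>.\<close>

definition visible :: "nat \<Rightarrow> real \<Rightarrow> mark stream \<Rightarrow> bool" where
  "visible k r h \<longleftrightarrow> jump_at k h \<le> r \<and> (\<forall>l<k. 0 < hold (h !! l)) \<and> (hold (h !! k) = 0 \<or> r < jump_at (Suc k) h)"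

lemma visible_measurable [measurable]: "Measurable.pred path_space (visible k r)"
  unfolding visible_def[abs_def] by measurable

lemma visible_past:
  assumes pr: "proper h" and r: "0 \<le> r" "r < u"
  shows "visible k r (past u h) \<longleftrightarrow> jump_at k h \<le> r \<and> r < jump_at (Suc k) h"
proof
  assume v: "visible k r (past u h)"
  have lt: "jump_at k h < u"
  proof (cases k)
    case (Suc l)
    then have "0 < hold (past u h !! l)" using v by (simp add: visible_def)
    then show ?thesis using Suc by (auto simp: past_snth no_mark_def split: if_splits)
  qed (use r in simp)
  have 1: "jump_at k h \<le> r" using v by (simp add: visible_def jump_at_past[OF pr lt])
  have 2: "r < jump_at (Suc k) h"
  proof (cases "jump_at (Suc k) h < u")
    case True
    then have "past u h !! k = h !! k" by (simp add: past_snth)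
    then show ?thesis using v proper_hold[OF pr, of k] jump_at_past[OF pr True] by (simp add: visible_def)
  qed (use r in simp)
  show "jump_at k h \<le> r \<and> r < jump_at (Suc k) h" using 1 2 by simp
next
  assume k: "jump_at k h \<le> r \<and> r < jump_at (Suc k) h"
  then have lt: "jump_at k h < u" using r by simp
  have "hold (past u h !! k) = 0 \<or> r < jump_at (Suc k) (past u h)"
  proof (cases "jump_at (Suc k) h < u")
    case True then show ?thesis using k jump_at_past[OF pr True] by simp
  next
    case False then show ?thesis by (simp add: past_snth no_mark_def)
  qed
  then show "visible k r (past u h)"
    using k proper_hold[OF pr] by (simp add: visible_def jump_at_past[OF pr lt] past_prefix[OF pr lt])
qed

text \<open>What happened up to \<open>r\<close> depends on the marks of the first \<open>k\<close>
  jumps, and \<open>k\<close> itself can be read off the past. One set \<open>B\<close> and one null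
  set serve all \<open>u > s\<close>, as the rectangles generating the predictable sigma-algebra
  require.\<close>

lemma visible_functional:
  assumes i: "i \<in> {1..n}" and r: "0 \<le> r" "r \<le> s"
    and prefix: "\<And>k h h'. (\<And>l. l < k \<Longrightarrow> h !! l = h' !! l) \<Longrightarrow> X k h = X k h'"
    and meas: "\<And>k. Measurable.pred path_space (X k)"
    and Y: "\<And>k \<omega>. between i k r \<omega> \<Longrightarrow> Y \<omega> \<longleftrightarrow> X k (marks \<omega>)"
  shows "\<exists>B\<in>sets path_space. AE \<omega> in law R i. \<forall>u>s. Y \<omega> \<longleftrightarrow> past u (marks \<omega>) \<in> B"
proof (intro bexI[of _ "{h. \<exists>k. visible k r h \<and> X k h}"])
  note [measurable] = meas
  have "{h \<in> space path_space. \<exists>k. visible k r h \<and> X k h} \<in> sets path_space" by measurable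
  then show "{h. \<exists>k. visible k r h \<and> X k h} \<in> sets path_space" by simp
  show "AE \<omega> in law R i. \<forall>u>s. Y \<omega> \<longleftrightarrow> past u (marks \<omega>) \<in> {h. \<exists>k. visible k r h \<and> X k h}"
    using AE_nice[OF i]
  proof eventually_elim
    case (elim \<omega>)
    note pr = nice_proper[OF elim]
    show ?case
    proof (intro allI impI)
      fix u assume "s < u"
      then have ru: "r < u" using r by simp
      obtain k where k: "jump_at k (marks \<omega>) \<le> r" "r < jump_at (Suc k) (marks \<omega>)" by (rule proper_ex_interval[OF pr r(1)])
      have uniq: "j = k" if "visible j r (past u (marks \<omega>))" for j
      proof -
        have j: "jump_at j (marks \<omega>) \<le> r" "r < jump_at (Suc j) (marks \<omega>)" using that visible_past[OF pr r(1) ru] by auto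
        show ?thesis using jumps_before[OF pr k, of j] jumps_before[OF pr j, of k] j k by simp
      qed
      have vk: "visible k r (past u (marks \<omega>))" using k visible_past[OF pr r(1) ru] by simp
      have lt: "jump_at k (marks \<omega>) < u" using k ru by simp
      have "X k (past u (marks \<omega>)) = X k (marks \<omega>)" by (rule prefix) (rule past_prefix[OF pr lt])
      moreover have "Y \<omega> \<longleftrightarrow> X k (marks \<omega>)" by (rule Y) (simp add: between_def elim k)
      moreover have "(\<exists>j. visible j r (past u (marks \<omega>)) \<and> X j (past u (marks \<omega>))) \<longleftrightarrow> X k (past u (marks \<omega>))"
        using vk uniq by blast
      ultimately show "Y \<omega> \<longleftrightarrow> past u (marks \<omega>) \<in> {h. \<exists>k. visible k r h \<and> X k h}"
        by (simp only: mem_Collect_eq)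
    qed
  qed
qed

lemma prefix_eqs:
  assumes "\<And>l. l < k \<Longrightarrow> h !! l = h' !! l"
  shows "claims_upto k h = claims_upto k h'" "total_loss k h = total_loss k h'" "cur_phase i h k = cur_phase i h' k"
  using assms by (auto simp: claims_upto_def total_loss_def cur_phase_def intro!: sum.cong split: nat.split)

text \<open>The property is stable under complements and countable unions, so the generators decide.
  Null sets of the completion are represented by the empty set.\<close>

lemma observed_functional:
  assumes i: "i \<in> {1..n}" and A: "A \<in> sets (observed i s)"
  shows "\<exists>B\<in>sets path_space. AE \<omega> in law R i. \<forall>u>s. \<omega> \<in> A \<longleftrightarrow> past u (marks \<omega>) \<in> B"
  using A unfolding sets_observed
proof (induction rule: sigma_sets.induct)
  case (Basic A)
  have sp: "\<exists>B\<in>sets path_space. AE \<omega> in law R i. \<forall>u>s. \<omega> \<in> A \<longleftrightarrow> past u (marks \<omega>) \<in> B"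
    if A: "A = {\<omega> \<in> space (law R i). Y \<omega>}" and ex: "\<exists>B\<in>sets path_space. AE \<omega> in law R i. \<forall>u>s. Y \<omega> \<longleftrightarrow> past u (marks \<omega>) \<in> B" for Y
  proof -
    obtain B where B: "B \<in> sets path_space" "AE \<omega> in law R i. \<forall>u>s. Y \<omega> \<longleftrightarrow> past u (marks \<omega>) \<in> B" using ex by blast
    have "AE \<omega> in law R i. \<forall>u>s. \<omega> \<in> A \<longleftrightarrow> past u (marks \<omega>) \<in> B"
      using B(2) AE_space by eventually_elim (simp add: A)
    then show ?thesis using B(1) by blast
  qed
  consider (phase) r j where "0 \<le> r" "r \<le> s" "A = phase_process R r -` {j} \<inter> space (law R i)"
    | (claims) r m where "0 \<le> r" "r \<le> s" "A = num_claims R r -` {m} \<inter> space (law R i)"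
    | (agg) r C where "0 \<le> r" "r \<le> s" "C \<in> sets borel" "A = aggregate_claims R r -` C \<inter> space (law R i)"
    | (null) "A \<in> null_sets (completion (law R i))"
    using Basic by blast
  then show ?case
  proof cases
    case phase
    have "\<exists>B\<in>sets path_space. AE \<omega> in law R i. \<forall>u>s. phase_process R r \<omega> = j \<longleftrightarrow> past u (marks \<omega>) \<in> B"
    proof (rule visible_functional[OF i phase(1,2), where X="\<lambda>k h. cur_phase i h k = j"])
      show "Measurable.pred path_space (\<lambda>h. cur_phase i h k = j)" for k
      proof (rule pred_eq_countable)
        show "(\<lambda>h. cur_phase i h k) \<in> path_space \<rightarrow>\<^sub>M count_space UNIV"
          unfolding cur_phase_def by (cases k) simp_all
      qed simp
      show "phase_process R r \<omega> = j \<longleftrightarrow> cur_phase i (marks \<omega>) k = j" if "between i k r \<omega>" for k \<omega>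
        using that state_between_jumps(1)[of i \<omega> k r] nice_phase[of i \<omega> k] by (simp add: between_def)
      show "(cur_phase i h k = j) = (cur_phase i h' k = j)" if "\<And>l. l < k \<Longrightarrow> h !! l = h' !! l" for k h h'
        using prefix_eqs(3)[OF that, of k i] by simp
    qed
    then show ?thesis by (rule sp[rotated]) (auto simp: phase)
  next
    case claims
    have "\<exists>B\<in>sets path_space. AE \<omega> in law R i. \<forall>u>s. num_claims R r \<omega> = m \<longleftrightarrow> past u (marks \<omega>) \<in> B"
    proof (rule visible_functional[OF i claims(1,2), where X="\<lambda>k h. claims_upto k h = m"])
      have pd: "Measurable.pred path_space (\<lambda>h. dest (h !! l) = claim_state)" for l by (intro pred_eq_countable) measurable
      show "Measurable.pred path_space (\<lambda>h. claims_upto k h = m)" for k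
      proof (rule pred_eq_countable)
        note [measurable] = pd
        show "claims_upto k \<in> path_space \<rightarrow>\<^sub>M count_space UNIV" unfolding claims_upto_def[abs_def] by measurable
      qed simp
      show "num_claims R r \<omega> = m \<longleftrightarrow> claims_upto k (marks \<omega>) = m" if "between i k r \<omega>" for k \<omega>
        using that state_between_jumps(2)[of i \<omega> k r] by (simp add: between_def)
      show "(claims_upto k h = m) = (claims_upto k h' = m)" if "\<And>l. l < k \<Longrightarrow> h !! l = h' !! l" for k h h'
        using prefix_eqs(1)[OF that, of k] by simp
    qed
    then show ?thesis by (rule sp[rotated]) (auto simp: claims)
  next
    case agg
    have "\<exists>B\<in>sets path_space. AE \<omega> in law R i. \<forall>u>s. aggregate_claims R r \<omega> \<in> C \<longleftrightarrow> past u (marks \<omega>) \<in> B"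
    proof (rule visible_functional[OF i agg(1,2), where X="\<lambda>k h. total_loss k h \<in> C"])
      show "Measurable.pred path_space (\<lambda>h. total_loss k h \<in> C)" for k
        using agg(3) by measurable
      show "aggregate_claims R r \<omega> \<in> C \<longleftrightarrow> total_loss k (marks \<omega>) \<in> C" if "between i k r \<omega>" for k \<omega>
        using that state_between_jumps(3)[of i \<omega> k r] by (simp add: between_def)
      show "(total_loss k h \<in> C) = (total_loss k h' \<in> C)" if "\<And>l. l < k \<Longrightarrow> h !! l = h' !! l" for k h h'
        using prefix_eqs(2)[OF that, of k] by simp
    qed
    then show ?thesis by (rule sp[rotated]) (auto simp: agg)
  next
    case null
    then have "AE \<omega> in law R i. \<omega> \<notin> A" using AE_not_in[OF null] by (simp add: AE_completion_iff)
    then show ?thesis by (intro bexI[of _ "{}"]) auto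
  qed
next
  case Empty
  then show ?case by (intro bexI[of _ "{}"]) auto
next
  case (Compl A)
  then obtain B where B: "B \<in> sets path_space" "AE \<omega> in law R i. \<forall>u>s. \<omega> \<in> A \<longleftrightarrow> past u (marks \<omega>) \<in> B" by blast
  have "space path_space - B \<in> sets path_space" using B(1) by (rule sets.compl_sets)
  moreover have "AE \<omega> in law R i. \<forall>u>s. \<omega> \<in> space (law R i) - A \<longleftrightarrow> past u (marks \<omega>) \<in> space path_space - B"
    using B(2) AE_space by eventually_elim simp
  ultimately show ?case by blast
next
  case (Union A)
  then have "\<forall>m. \<exists>B. B \<in> sets path_space \<and> (AE \<omega> in law R i. \<forall>u>s. \<omega> \<in> A m \<longleftrightarrow> past u (marks \<omega>) \<in> B)" by blast
  from choice[OF this] obtain B where B: "\<And>m. B m \<in> sets path_space" "\<And>m. AE \<omega> in law R i. \<forall>u>s. \<omega> \<in> A m \<longleftrightarrow> past u (marks \<omega>) \<in> B m" by blast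
  have "(\<Union>m. B m) \<in> sets path_space" using B(1) by (intro sets.countable_UN) auto
  moreover have "AE \<omega> in law R i. \<forall>m. \<forall>u>s. \<omega> \<in> A m \<longleftrightarrow> past u (marks \<omega>) \<in> B m"
    unfolding AE_all_countable using B(2) by blast
  then have "AE \<omega> in law R i. \<forall>u>s. \<omega> \<in> (\<Union>m. A m) \<longleftrightarrow> past u (marks \<omega>) \<in> (\<Union>m. B m)"
    by eventually_elim blast
  ultimately show ?case by blast
qed

lemma predictable_functional:
  assumes i: "i \<in> {1..n}" and A: "A \<in> sets (predictable i)"
  shows "\<exists>B\<in>sets (borel \<Otimes>\<^sub>M path_space). AE \<omega> in law R i. \<forall>t>0. (t, \<omega>) \<in> A \<longleftrightarrow> (t, past t (marks \<omega>)) \<in> B"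
  using A unfolding sets_predictable
proof (induction rule: sigma_sets.induct)
  case (Basic A)
  then consider (zero) C where "A = {0} \<times> C" | (left) s t C where "0 \<le> s" "A = {s<..t} \<times> C" "C \<in> sets (observed i s)" by blast
  then show ?case
  proof cases
    \<comment> \<open>Time 0 is excluded from the statement, so the empty set represents this
      generator.\<close>
    case zero
    then show ?thesis by (intro bexI[of _ "{}"]) auto
  next
    case left
    obtain B where B: "B \<in> sets path_space" "AE \<omega> in law R i. \<forall>u>s. \<omega> \<in> C \<longleftrightarrow> past u (marks \<omega>) \<in> B"
      using observed_functional[OF i left(3)] by blast
    have "{s<..t} \<times> B \<in> sets (borel \<Otimes>\<^sub>M path_space)" using B(1) by (intro pair_measureI) auto
    moreover have "AE \<omega> in law R i. \<forall>u>0. (u, \<omega>) \<in> A \<longleftrightarrow> (u, past u (marks \<omega>)) \<in> {s<..t} \<times> B"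
      using B(2) by eventually_elim (auto simp: left(2))
    ultimately show ?thesis by blast
  qed
next
  case Empty
  then show ?case by (intro bexI[of _ "{}"]) auto
next
  case (Compl A)
  then obtain B where B: "B \<in> sets (borel \<Otimes>\<^sub>M path_space)" "AE \<omega> in law R i. \<forall>t>0. (t, \<omega>) \<in> A \<longleftrightarrow> (t, past t (marks \<omega>)) \<in> B" by blast
  have "space (borel \<Otimes>\<^sub>M path_space) - B \<in> sets (borel \<Otimes>\<^sub>M path_space)" using B(1) by (rule sets.compl_sets)
  moreover have "AE \<omega> in law R i. \<forall>t>0. (t, \<omega>) \<in> {0..} \<times> space (law R i) - A \<longleftrightarrow> (t, past t (marks \<omega>)) \<in> space (borel \<Otimes>\<^sub>M path_space) - B"
    using B(2) AE_space by eventually_elim (simp add: space_pair_measure)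
  ultimately show ?case by blast
next
  case (Union A)
  then have "\<forall>m. \<exists>B. B \<in> sets (borel \<Otimes>\<^sub>M path_space) \<and> (AE \<omega> in law R i. \<forall>t>0. (t, \<omega>) \<in> A m \<longleftrightarrow> (t, past t (marks \<omega>)) \<in> B)" by blast
  from choice[OF this] obtain B where B: "\<And>m. B m \<in> sets (borel \<Otimes>\<^sub>M path_space)"
    "\<And>m. AE \<omega> in law R i. \<forall>t>0. (t, \<omega>) \<in> A m \<longleftrightarrow> (t, past t (marks \<omega>)) \<in> B m" by blast
  have "(\<Union>m. B m) \<in> sets (borel \<Otimes>\<^sub>M path_space)" using B(1) by (intro sets.countable_UN) auto
  moreover have "AE \<omega> in law R i. \<forall>m. \<forall>t>0. (t, \<omega>) \<in> A m \<longleftrightarrow> (t, past t (marks \<omega>)) \<in> B m"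
    unfolding AE_all_countable using B(2) by blast
  then have "AE \<omega> in law R i. \<forall>t>0. (t, \<omega>) \<in> (\<Union>m. A m) \<longleftrightarrow> (t, past t (marks \<omega>)) \<in> (\<Union>m. B m)"
    by eventually_elim blast
  ultimately show ?case by blast
qed

lemma INF_rat_above: "(INF q::rat. if (g :: real) < real_of_rat q then ereal (real_of_rat q) else \<infinity>) = ereal g"
proof (rule antisym)
  show "ereal g \<le> (INF q::rat. if g < real_of_rat q then ereal (real_of_rat q) else \<infinity>)"
    by (rule INF_greatest) auto
  show "(INF q::rat. if g < real_of_rat q then ereal (real_of_rat q) else \<infinity>) \<le> ereal g" (is "?I \<le> _")
  proof (rule ccontr)
    assume "\<not> ?thesis"
    then have "ereal g < ?I" by (simp only: not_le)
    then obtain z where z: "ereal g < ereal z" "ereal z < ?I" using ereal_dense2 by blast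
    then obtain q :: rat where q: "g < real_of_rat q" "real_of_rat q < z" using of_rat_dense[of g z] by auto
    have "?I \<le> (if g < real_of_rat q then ereal (real_of_rat q) else \<infinity>)" by (rule INF_lower) simp
    then have "?I \<le> ereal (real_of_rat q)" using q by simp
    also have "\<dots> < ereal z" using q by simp
    finally show False using z by simp
  qed
qed

text \<open>A Doob-Dynkin factorization: \<open>f\<close> is rebuilt from sets representing the
  sublevel sets of \<open>g\<close> at rational levels. As these are countably many, one null set
  serves all times.\<close>

lemma predictable_factor:
  assumes i: "i \<in> {1..n}" and g: "g \<in> borel_measurable (predictable i)"
  obtains f where "borel_strat f" "AE \<omega> in law R i. \<forall>t>0. g (t, \<omega>) = f (t, past t (marks \<omega>))"
proof -
  have "\<forall>q::rat. \<exists>B. B \<in> sets (borel \<Otimes>\<^sub>M path_space) \<and> (AE \<omega> in law R i. \<forall>t>0. (t, \<omega>) \<in> {p \<in> space (predictable i). g p < real_of_rat q} \<longleftrightarrow> (t, past t (marks \<omega>)) \<in> B)"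
  proof
    fix q :: rat
    have "{p \<in> space (predictable i). g p < real_of_rat q} \<in> sets (predictable i)" using g by measurable
    from predictable_functional[OF i this]
    show "\<exists>B. B \<in> sets (borel \<Otimes>\<^sub>M path_space) \<and> (AE \<omega> in law R i. \<forall>t>0. (t, \<omega>) \<in> {p \<in> space (predictable i). g p < real_of_rat q} \<longleftrightarrow> (t, past t (marks \<omega>)) \<in> B)" by blast
  qed
  from choice[OF this] obtain B where B [measurable]: "\<And>q. B q \<in> sets (borel \<Otimes>\<^sub>M path_space)"
    and B_eq: "\<And>q. AE \<omega> in law R i. \<forall>t>0. (t, \<omega>) \<in> {p \<in> space (predictable i). g p < real_of_rat q} \<longleftrightarrow> (t, past t (marks \<omega>)) \<in> B q" by blast
  define f where "f p = real_of_ereal (INF q. if p \<in> B q then ereal (real_of_rat q) else \<infinity>)" for p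
  have "borel_strat f" unfolding f_def by measurable
  moreover have "AE \<omega> in law R i. \<forall>q. \<forall>t>0. (t, \<omega>) \<in> {p \<in> space (predictable i). g p < real_of_rat q} \<longleftrightarrow> (t, past t (marks \<omega>)) \<in> B q"
    unfolding AE_all_countable using B_eq by blast
  then have "AE \<omega> in law R i. \<forall>t>0. g (t, \<omega>) = f (t, past t (marks \<omega>))"
    using AE_space
  proof eventually_elim
    case (elim \<omega>)
    show ?case
    proof (intro allI impI)
      fix t :: real assume t: "0 < t"
      then have eq: "(t, past t (marks \<omega>)) \<in> B q \<longleftrightarrow> g (t, \<omega>) < real_of_rat q" for q
        using elim by (auto simp: space_predictable)
      show "g (t, \<omega>) = f (t, past t (marks \<omega>))" unfolding f_def eq INF_rat_above by simp
    qed
  qed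
  ultimately show thesis by (rule that)
qed

text \<open>Feasibility of the paths of a Borel strategy involves uncountably many times and need not be a
  measurable event. The paths of the following modification are left-continuous by construction, and
  its feasibility follows from countably many conditions.\<close>

definition left_strat :: "strat \<Rightarrow> strat" where
  "left_strat f = (\<lambda>(t, h). real_of_ereal (SUP q::rat. if 0 < real_of_rat q \<and> real_of_rat q < t
     then ereal (f (real_of_rat q, past (real_of_rat q) h)) else 0))"

text \<open>The default 0 for rationals outside \<open>(0, t)\<close> is neutral for nonnegative
  paths and gives the value 0 at time 0.\<close>

definition left_sup :: "(real \<Rightarrow> real) \<Rightarrow> real \<Rightarrow> ereal" where
  "left_sup d t = (SUP q::rat. if 0 < real_of_rat q \<and> real_of_rat q < t then ereal (d (real_of_rat q)) else 0)"

definition rat_mono :: "(real \<Rightarrow> real) \<Rightarrow> bool" where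
  "rat_mono d \<longleftrightarrow> (\<forall>q r::rat. 0 < real_of_rat q \<longrightarrow> real_of_rat q \<le> real_of_rat r \<longrightarrow> 0 \<le> d (real_of_rat q) \<and> d (real_of_rat q) \<le> d (real_of_rat r))"

lemma past_past:
  assumes pr: "proper h" and "q < t" shows "past q (past t h) = past q h"
proof (rule stream_eqI)
  fix k show "past q (past t h) !! k = past q h !! k"
  proof (cases "jump_at (Suc k) h < t")
    case True
    then show ?thesis using jump_at_past[OF pr True] by (simp add: past_snth)
  qed (use assms in \<open>simp add: past_snth\<close>)
qed

lemma left_strat_measurable:
  assumes f: "borel_strat f" shows "borel_strat (left_strat f)"
proof -
  have "(\<lambda>p. past a (snd p)) \<in> borel \<Otimes>\<^sub>M path_space \<rightarrow>\<^sub>M path_space" for a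
    using measurable_compose[OF _ past_measurable, of "\<lambda>p. (a, snd p)" "borel \<Otimes>\<^sub>M path_space"] by simp
  then have [measurable]: "(\<lambda>p. f (a, past a (snd p))) \<in> borel_measurable (borel \<Otimes>\<^sub>M path_space)" for a
    by (intro measurable_compose[OF _ f] measurable_Pair) auto
  show ?thesis unfolding left_strat_def split_beta' by measurable
qed

lemma strat_path_left_strat:
  assumes pr: "proper h"
  shows "strat_path (left_strat f) h t = real_of_ereal (left_sup (strat_path f h) t)"
proof (cases "t \<le> 0")
  case True
  then have "\<not> (0 < real_of_rat q \<and> real_of_rat q < t)" for q by linarith
  then have "(if 0 < real_of_rat q \<and> real_of_rat q < t then X else 0) = 0" for q and X :: ereal by (simp only: if_False)
  then have "left_sup (strat_path f h) t = 0" unfolding left_sup_def by (simp only:) simp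
  then show ?thesis using True by (simp add: strat_path_def)
next
  case False
  have eq: "(if 0 < real_of_rat q \<and> real_of_rat q < t then ereal (f (real_of_rat q, past (real_of_rat q) (past t h))) else 0) =
    (if 0 < real_of_rat q \<and> real_of_rat q < t then ereal (strat_path f h (real_of_rat q)) else 0)" for q
    using past_past[OF pr] by (auto simp: strat_path_def)
  have "strat_path (left_strat f) h t = left_strat f (t, past t h)"
    using False by (simp only: strat_path_def if_False)
  also have "\<dots> = real_of_ereal (left_sup (strat_path f h) t)"
    unfolding left_strat_def left_sup_def prod.case eq ..
  finally show ?thesis .
qed

lemma left_sup_nonneg: "0 \<le> left_sup d t"
  unfolding left_sup_def by (rule SUP_upper2[of 0]) simp_all

lemma left_sup_mono:
  assumes "rat_mono d" "s \<le> t" shows "left_sup d s \<le> left_sup d t"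
  unfolding left_sup_def using assms by (intro SUP_mono) (auto simp: rat_mono_def intro!: exI)

lemma left_sup_upper: "0 < real_of_rat q \<Longrightarrow> real_of_rat q < t \<Longrightarrow> ereal (d (real_of_rat q)) \<le> left_sup d t"
  unfolding left_sup_def by (rule SUP_upper2[of q]) simp_all

lemma left_sup_least:
  assumes "\<And>q. 0 < real_of_rat q \<Longrightarrow> real_of_rat q < t \<Longrightarrow> d (real_of_rat q) \<le> B" "0 \<le> B"
  shows "left_sup d t \<le> ereal B"
  unfolding left_sup_def by (rule SUP_least) (use assms in \<open>auto simp: zero_ereal_def\<close>)

text \<open>The supremum is finite because the value at any positive rational time beyond
  \<open>t\<close> bounds it.\<close>

lemma left_sup_real:
  assumes d: "rat_mono d" shows "ereal (real_of_ereal (left_sup d t)) = left_sup d t"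
proof -
  obtain r :: rat where r: "max 0 t < real_of_rat r" using of_rat_dense[of "max 0 t" "max 0 t + 1"] by auto
  have "left_sup d t \<le> ereal (d (real_of_rat r))"
    using d r by (intro left_sup_least) (auto simp: rat_mono_def)
  then have "\<bar>left_sup d t\<bar> \<noteq> \<infinity>" using left_sup_nonneg[of d t] by auto
  then show ?thesis by (simp add: ereal_real)
qed

lemma regular_path_left_sup:
  assumes d: "rat_mono d" shows "regular_path (\<lambda>t. real_of_ereal (left_sup d t))"
  unfolding regular_path_def
proof (intro conjI allI impI)
  note re = left_sup_real[OF d]
  have "left_sup d 0 \<le> ereal 0" by (rule left_sup_least) auto
  then show "real_of_ereal (left_sup d 0) = 0" using left_sup_nonneg[of d 0] by (simp add: zero_ereal_def[symmetric])
  have mono: "real_of_ereal (left_sup d s) \<le> real_of_ereal (left_sup d t)" if "s \<le> t" for s t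
    using left_sup_mono[OF d that] re[of s] re[of t] by (metis ereal_less_eq(3))
  show "mono_on {0..} (\<lambda>t. real_of_ereal (left_sup d t))" by (intro mono_onI mono)
  fix t :: real assume t: "0 < t"
  show "continuous (at_left t) (\<lambda>t. real_of_ereal (left_sup d t))"
    unfolding continuous_within
  proof (rule order_tendstoI)
    fix a assume "a < real_of_ereal (left_sup d t)"
    then have "ereal a < left_sup d t" using re[of t] by (metis less_ereal.simps(1))
    then obtain q :: rat where q: "ereal a < (if 0 < real_of_rat q \<and> real_of_rat q < t then ereal (d (real_of_rat q)) else 0)"
      unfolding left_sup_def less_SUP_iff by blast
    show "\<forall>\<^sub>F s in at_left t. a < real_of_ereal (left_sup d s)"
    proof (cases "0 < real_of_rat q \<and> real_of_rat q < t")
      case True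
      have "a < real_of_ereal (left_sup d s)" if "real_of_rat q < s" for s
      proof -
        have "ereal a < ereal (d (real_of_rat q))" using q True by (simp only: if_True simp_thms)
        also have "\<dots> \<le> left_sup d s" using True that by (intro left_sup_upper) auto
        finally have "ereal a < left_sup d s" .
        then show ?thesis using re[of s] by (metis less_ereal.simps(1))
      qed
      then show ?thesis unfolding eventually_at_left_field using True by (intro exI[of _ "real_of_rat q"]) auto
    next
      case False
      then have a: "a < 0" using q by (simp add: zero_ereal_def split: if_splits)
      have "a < real_of_ereal (left_sup d s)" for s
        using a left_sup_nonneg[of d s] by (simp add: less_le_trans[OF a] real_of_ereal_pos)
      then show ?thesis by simp
    qed
  next
    fix a assume a: "real_of_ereal (left_sup d t) < a"
    have "real_of_ereal (left_sup d s) < a" if "s < t" for s using mono[of s t] that a by simp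
    then show "\<forall>\<^sub>F s in at_left t. real_of_ereal (left_sup d s) < a"
      unfolding eventually_at_left_field using t by (intro exI[of _ 0]) auto
  qed
qed

text \<open>By left-continuity the values at earlier rational times come arbitrarily close to
  \<open>d t\<close>; thus the modification leaves regular paths unchanged
  (\<open>left_strat_eq\<close>).\<close>

lemma left_sup_regular:
  assumes d: "regular_path d" and t: "0 \<le> t"
  shows "left_sup d t = ereal (d t)"
proof (rule antisym)
  show "left_sup d t \<le> ereal (d t)"
    using regular_path_nonneg[OF d t] by (intro left_sup_least regular_path_mono[OF d]) auto
  show "ereal (d t) \<le> left_sup d t"
  proof (cases "t = 0")
    case True
    then show ?thesis using d left_sup_nonneg[of d t] by (simp add: regular_path_def zero_ereal_def)
  next
    case False
    then have t0: "0 < t" using t by simp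
    show ?thesis
    proof (rule ccontr)
      assume "\<not> ?thesis"
      then have "left_sup d t < ereal (d t)" by (simp only: not_le)
      then obtain z where z: "left_sup d t < ereal z" "ereal z < ereal (d t)"
        using ereal_dense2 by blast
      have "(d \<longlongrightarrow> d t) (at_left t)" using d t0 by (simp add: regular_path_def continuous_within)
      then have "\<forall>\<^sub>F s in at_left t. z < d s" using z by (intro order_tendstoD(1)) auto
      then obtain b where b: "b < t" "\<And>s. b < s \<Longrightarrow> s < t \<Longrightarrow> z < d s" unfolding eventually_at_left_field by blast
      obtain q :: rat where q: "max 0 b < real_of_rat q" "real_of_rat q < t" using of_rat_dense[of "max 0 b" t] b t0 by auto
      then have "ereal z < ereal (d (real_of_rat q))" using b(2) by simp
      also have "\<dots> \<le> left_sup d t" using q by (intro left_sup_upper) auto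
      finally show False using z by simp
    qed
  qed
qed

lemma left_strat_eq:
  assumes "proper h" "regular_path (strat_path f h)"
  shows "strat_path (left_strat f) h = strat_path f h"
proof
  fix t show "strat_path (left_strat f) h t = strat_path f h t"
    using strat_path_left_strat[OF assms(1), of f t] left_sup_regular[OF assms(2), of t]
    by (cases "t \<le> 0") (simp_all add: strat_path_def)
qed

text \<open>Jump times need a condition of their own: the modification takes limits from the left,
  where the constraint involves only the losses of earlier jumps, while at the jump time the new
  loss already counts.\<close>

definition rat_feasible :: "strat \<Rightarrow> real \<Rightarrow> mark stream \<Rightarrow> bool" where
  "rat_feasible f x h \<longleftrightarrow> rat_mono (strat_path f h) \<and>
    (\<forall>k. \<forall>q::rat. 0 < real_of_rat q \<longrightarrow> jump_at k h \<le> real_of_rat q \<longrightarrow> real_of_rat q < jump_at (Suc k) h \<longrightarrow>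
       ereal (real_of_rat q) < ruin (strat_path (left_strat f) h) x h \<longrightarrow> strat_path f h (real_of_rat q) \<le> x + c * real_of_rat q - total_loss k h) \<and>
    (\<forall>k. ereal (jump_at k h) < ruin (strat_path (left_strat f) h) x h \<longrightarrow>
       strat_path (left_strat f) h (jump_at k h) \<le> x + c * jump_at k h - total_loss k h)"

lemma rat_feasible_measurable:
  assumes f: "borel_strat f" shows "Measurable.pred path_space (rat_feasible f x)"
proof -
  note lf = left_strat_measurable[OF f]
  have [measurable]: "(\<lambda>h. strat_path f h a) \<in> borel_measurable path_space" for a
    by (rule strat_path_measurable[OF f]) measurable
  have [measurable]: "(\<lambda>h. strat_path (left_strat f) h (jump_at k h)) \<in> borel_measurable path_space" for k
    by (rule strat_path_measurable[OF lf]) measurable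
  note [measurable] = ruin_measurable[OF lf]
  show ?thesis unfolding rat_feasible_def[abs_def] rat_mono_def by measurable
qed

lemma feasible_rat_feasible:
  assumes pr: "proper h" and f: "feasible (strat_path f h) x h"
  shows "rat_feasible f x h"
proof -
  have reg: "regular_path (strat_path f h)" using f by (rule feasible_regular)
  have "rat_mono (strat_path f h)"
    unfolding rat_mono_def using regular_path_mono[OF reg] regular_path_nonneg[OF reg] by auto
  moreover have "strat_path f h (jump_at k h) \<le> x + c * jump_at k h - total_loss k h" if "ereal (jump_at k h) < ruin (strat_path f h) x h" for k
    using f that proper_jump_at_strict[OF pr, of k "Suc k"] unfolding feasible_def by blast
  ultimately show ?thesis
    using f unfolding rat_feasible_def left_strat_eq[OF pr reg] feasible_def by blast
qed

lemma rat_feasible_feasible: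
  assumes pr: "proper h" and f: "rat_feasible f x h"
  shows "feasible (strat_path (left_strat f) h) x h"
  unfolding feasible_def
proof (intro conjI allI impI)
  let ?d = "strat_path f h"
  have rm: "rat_mono ?d" using f by (simp add: rat_feasible_def)
  have eq: "strat_path (left_strat f) h = (\<lambda>t. real_of_ereal (left_sup ?d t))"
    using strat_path_left_strat[OF pr] by (rule ext)
  show "regular_path (strat_path (left_strat f) h)"
    unfolding eq by (rule regular_path_left_sup[OF rm])
  fix k t assume t: "jump_at k h \<le> t" "t < jump_at (Suc k) h" "ereal t < ruin (strat_path (left_strat f) h) x h"
  show "strat_path (left_strat f) h t \<le> x + c * t - total_loss k h"
  proof (cases "t = jump_at k h")
    case True
    then show ?thesis using f t(3) by (simp add: rat_feasible_def)
  next
    case False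
    then have lt: "jump_at k h < t" using t by simp
    have nn: "0 \<le> jump_at k h" by (rule proper_jump_at_nonneg[OF pr])
    have bd: "?d (real_of_rat r) \<le> x + c * t - total_loss k h" if r: "jump_at k h < real_of_rat r" "real_of_rat r < t" for r
    proof -
      have "ereal (real_of_rat r) < ruin (strat_path (left_strat f) h) x h" using r t(3) by (meson less_ereal.simps(1) less_trans)
      then have "?d (real_of_rat r) \<le> x + c * real_of_rat r - total_loss k h"
        using f le_less_trans[OF nn r(1)] less_imp_le[OF r(1)] less_trans[OF r(2) t(2)]
        unfolding rat_feasible_def by blast
      also have "\<dots> \<le> x + c * t - total_loss k h" using r pos by simp
      finally show ?thesis .
    qed
    have "left_sup ?d t \<le> ereal (x + c * t - total_loss k h)"
    proof (rule left_sup_least)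
      fix q :: rat assume q: "0 < real_of_rat q" "real_of_rat q < t"
      \<comment> \<open>A rational time after both the last jump and \<open>q\<close>: only after
        the jump does the constraint involve \<open>total_loss k h\<close>, and monotonicity
        transfers the bound to \<open>q\<close>.\<close>
      obtain r :: rat where r: "max (jump_at k h) (real_of_rat q) < real_of_rat r" "real_of_rat r < t"
        using of_rat_dense[of "max (jump_at k h) (real_of_rat q)" t] lt q by auto
      have "?d (real_of_rat q) \<le> ?d (real_of_rat r)" using rm q r unfolding rat_mono_def by auto
      also have "\<dots> \<le> x + c * t - total_loss k h" using r by (intro bd) auto
      finally show "?d (real_of_rat q) \<le> x + c * t - total_loss k h" .
    next
      obtain r :: rat where r: "jump_at k h < real_of_rat r" "real_of_rat r < t" using of_rat_dense[OF lt] by auto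
      have "0 \<le> ?d (real_of_rat r)"
        using rm le_less_trans[OF nn r(1)] unfolding rat_mono_def by blast
      also have "\<dots> \<le> x + c * t - total_loss k h" using r by (intro bd) auto
      finally show "0 \<le> x + c * t - total_loss k h" .
    qed
    then have "ereal (strat_path (left_strat f) h t) \<le> ereal (x + c * t - total_loss k h)"
      unfolding eq left_sup_real[OF rm] .
    then show ?thesis by simp
  qed
qed

subsection \<open>Strategies as Borel functionals of the observed past\<close>

definition represents :: "nat \<Rightarrow> real \<Rightarrow> (real \<Rightarrow> 'a \<Rightarrow> real) \<Rightarrow> strat \<Rightarrow> bool" where
  "represents i x D f \<longleftrightarrow> adm i x f \<and> (AE \<omega> in law R i. nice i \<omega> \<and> feasible (\<lambda>t. D t \<omega>) x (marks \<omega>) \<and>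
     (\<forall>t\<ge>0. D t \<omega> = strat_path f (marks \<omega>) t))"

lemma path_law_distr: "i \<in> {1..n} \<Longrightarrow> path_law i = distr (law R i) path_space marks"
  by (simp only: path_law_def if_True)

text \<open>The factor \<open>f\<close> from \<open>predictable_factor\<close> agrees with
  \<open>D\<close> on almost every outcome, but almost sure feasibility is transported to
  \<open>path_law\<close> by way of a measurable event. Hence the detour through
  \<open>rat_feasible\<close> to \<open>left_strat f\<close>, which still represents
  \<open>D\<close>.\<close>

lemma admissible_represented:
  assumes i: "i \<in> {1..n}" and D: "admissible R i x D"
  shows "\<exists>f. represents i x D f"
proof -
  have "(\<lambda>(t, \<omega>). D t \<omega>) \<in> borel_measurable (predictable i)" using D by (simp add: admissible_def)
  from predictable_factor[OF i this] obtain f where f: "borel_strat f"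
    and eq: "AE \<omega> in law R i. \<forall>t>0. D t \<omega> = f (t, past t (marks \<omega>))" by auto
  have ae: "AE \<omega> in law R i. nice i \<omega> \<and> feasible (\<lambda>t. D t \<omega>) x (marks \<omega>) \<and> (\<forall>t\<ge>0. D t \<omega> = strat_path f (marks \<omega>) t)"
    using D[unfolded admissible_def, THEN conjunct2] AE_nice[OF i] eq
  proof eventually_elim
    case (elim \<omega>)
    have "feasible (\<lambda>t. D t \<omega>) x (marks \<omega>)"
      using elim(1) admissible_path_iff[OF elim(2), of D x] by blast
    moreover have "D t \<omega> = strat_path f (marks \<omega>) t" if "0 \<le> t" for t
      using that elim(1,3) by (cases "t = 0") (auto simp: strat_path_def)
    ultimately show ?case using elim(2) by blast
  qed
  have feas: "feasible (strat_path f (marks \<omega>)) x (marks \<omega>)"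
    if "nice i \<omega> \<and> feasible (\<lambda>t. D t \<omega>) x (marks \<omega>) \<and> (\<forall>t\<ge>0. D t \<omega> = strat_path f (marks \<omega>) t)" for \<omega>
    using that feasible_cong[OF nice_proper, of i \<omega> "\<lambda>t. D t \<omega>" "strat_path f (marks \<omega>)" x] by blast
  have "AE \<omega> in law R i. rat_feasible f x (marks \<omega>)"
    using ae
  proof eventually_elim
    case (elim \<omega>)
    show ?case by (rule feasible_rat_feasible[OF nice_proper[OF elim[THEN conjunct1]] feas[OF elim]])
  qed
  then have "AE h in path_law i. rat_feasible f x h"
    unfolding path_law_distr[OF i] using rat_feasible_measurable[OF f, of x]
    by (subst AE_distr_iff[OF marks_measurable[OF i]]) (simp_all add: pred_def)
  then have "AE h in path_law i. feasible (strat_path (left_strat f) h) x h"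
    using AE_good_path[OF i] by eventually_elim (auto simp: good_path_def intro: rat_feasible_feasible)
  then have "adm i x (left_strat f)" using left_strat_measurable[OF f] by (simp add: adm_def)
  moreover have "AE \<omega> in law R i. nice i \<omega> \<and> feasible (\<lambda>t. D t \<omega>) x (marks \<omega>) \<and> (\<forall>t\<ge>0. D t \<omega> = strat_path (left_strat f) (marks \<omega>) t)"
    using ae
  proof eventually_elim
    case (elim \<omega>)
    have "strat_path (left_strat f) (marks \<omega>) = strat_path f (marks \<omega>)"
      using elim feas[OF elim] by (intro left_strat_eq nice_proper feasible_regular) auto
    then show ?case using elim by simp
  qed
  ultimately show ?thesis unfolding represents_def by blast
qed

lemma adm_represents:
  assumes i: "i \<in> {1..n}" and f: "adm i x f"
  shows "\<exists>D. admissible R i x D \<and> represents i x D f"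
proof -
  \<comment> \<open>The path of \<open>f\<close> is predictable only on the almost sure event
    \<open>nice i\<close>; the value 0 elsewhere makes \<open>D\<close> predictable
    everywhere.\<close>
  define D where "D t \<omega> = (if nice i \<omega> then strat_path f (marks \<omega>) t else 0)" for t \<omega>
  have fm: "borel_strat f" using f by (simp add: adm_def)
  have "AE \<omega> in law R i. feasible (strat_path f (marks \<omega>)) x (marks \<omega>)"
    using f[unfolded adm_def path_law_distr[OF i], THEN conjunct2] by (rule AE_distrD[OF marks_measurable[OF i]])
  then have ae: "AE \<omega> in law R i. nice i \<omega> \<and> feasible (\<lambda>t. D t \<omega>) x (marks \<omega>) \<and> (\<forall>t\<ge>0. D t \<omega> = strat_path f (marks \<omega>) t)"
    using AE_nice[OF i] by eventually_elim (simp add: D_def)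
  have "admissible R i x D"
    unfolding admissible_def
  proof
    show "(\<lambda>(t, \<omega>). D t \<omega>) \<in> borel_measurable (predictable i)"
      unfolding D_def by (rule strat_predictable[OF i fm])
    show "AE \<omega> in law R i. D 0 \<omega> = 0 \<and> mono_on {0..} (\<lambda>t. D t \<omega>) \<and> (\<forall>t>0. continuous (at_left t) (\<lambda>s. D s \<omega>)) \<and>
        (\<forall>t\<ge>0. \<exists>l. ((\<lambda>s. D s \<omega>) \<longlongrightarrow> l) (at_right t)) \<and>
        (\<forall>t\<ge>0. ereal t < claim_ruin_time R x D \<omega> \<longrightarrow> D t \<omega> \<le> x + c * t - aggregate_claims R t \<omega>)"
      using ae
    proof eventually_elim
      case (elim \<omega>)
      then show ?case using admissible_path_iff[of i \<omega> D x] by blast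
    qed
  qed
  then show ?thesis using ae f unfolding represents_def by blast
qed

lemma strategy_value_eq:
  assumes i: "i \<in> {1..n}" and r: "represents i x D f"
  shows "strategy_value R D i x = strat_val i x f"
proof -
  have fm [measurable]: "borel_strat f" using r by (simp add: represents_def adm_def)
  have "strategy_value R D i x = (\<integral>\<^sup>+ \<omega>. discounted_dividends R D (ruin_time R x D \<omega>) \<omega> \<partial>law R i)"
    by (simp add: strategy_value_def nn_integral_completion)
  also have "\<dots> = (\<integral>\<^sup>+ \<omega>. pay (strat_path f (marks \<omega>)) (ruin (strat_path f (marks \<omega>)) x (marks \<omega>)) \<partial>law R i)"
  proof (rule nn_integral_cong_AE, use r[unfolded represents_def, THEN conjunct2] in eventually_elim)
    case (elim \<omega>)
    then have nice: "nice i \<omega>" and fe: "feasible (\<lambda>t. D t \<omega>) x (marks \<omega>)" and eq: "\<And>t. 0 \<le> t \<Longrightarrow> D t \<omega> = strat_path f (marks \<omega>) t" by auto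
    note pr = nice_proper[OF nice]
    have "discounted_dividends R D (ruin_time R x D \<omega>) \<omega> = pay (\<lambda>t. D t \<omega>) (ruin (\<lambda>t. D t \<omega>) x (marks \<omega>))"
      unfolding ruin_time_eq[where D = D, OF nice fe]
      by (rule discounted_dividends_eq_pay[where D = D, OF feasible_regular[OF fe] ruin_nonneg[OF pr]])
    also have "ruin (\<lambda>t. D t \<omega>) x (marks \<omega>) = ruin (strat_path f (marks \<omega>)) x (marks \<omega>)"
      by (rule ruin_cong[OF pr eq])
    also have "pay (\<lambda>t. D t \<omega>) \<dots> = pay (strat_path f (marks \<omega>)) \<dots>"
      by (rule pay_cong[OF ruin_nonneg[OF pr] eq])
    finally show ?case .
  qed
  also have "\<dots> = strat_val i x f"
    unfolding strat_val_def path_law_distr[OF i] by (rule nn_integral_distr[symmetric, OF marks_measurable[OF i]]) measurable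
  finally show ?thesis .
qed

lemma optimal_value_eq:
  assumes i: "i \<in> {1..n}" shows "optimal_value R i x = opt_val i x"
  unfolding optimal_value_def opt_val_def
proof (rule antisym)
  show "(SUP D\<in>{D. admissible R i x D}. strategy_value R D i x) \<le> (SUP f\<in>{f. adm i x f}. strat_val i x f)"
  proof (rule SUP_mono)
    fix D assume "D \<in> {D. admissible R i x D}"
    then obtain f where f: "represents i x D f" using admissible_represented[OF i] by blast
    then show "\<exists>f\<in>{f. adm i x f}. strategy_value R D i x \<le> strat_val i x f"
      using strategy_value_eq[OF i f] by (intro bexI[of _ f]) (auto simp: represents_def)
  qed
  show "(SUP f\<in>{f. adm i x f}. strat_val i x f) \<le> (SUP D\<in>{D. admissible R i x D}. strategy_value R D i x)"
  proof (rule SUP_mono)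
    fix f assume "f \<in> {f. adm i x f}"
    then obtain D where "admissible R i x D" "represents i x D f" using adm_represents[OF i] by blast
    then show "\<exists>D\<in>{D. admissible R i x D}. strat_val i x f \<le> strategy_value R D i x"
      using strategy_value_eq[OF i] by (intro bexI[of _ D]) auto
  qed
qed

text \<open>Up to the first jump time \<open>D\<close> is the deterministic
  \<open>first_path f\<close>, so everything under the integral depends on the first mark alone. The
  auxiliary \<open>F\<close> is a measurable version that vanishes at illegal targets.\<close>

lemma first_payoff_eq:
  assumes i: "i \<in> {1..n}" and r: "represents i x D f"
    and U: "\<And>z. z \<in> {1..n + 1} \<Longrightarrow> U z \<in> borel_measurable borel"
  shows "(\<integral>\<^sup>+ \<omega>. (let \<tau>1 = first_jump_time R \<omega> in
                 discounted_dividends R D (ereal \<tau>1) \<omega> +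
                 ennreal (exp (- discount R * \<tau>1)) *
                   U (absorbed_process R \<tau>1 \<omega>) (x + premium R * \<tau>1 - D \<tau>1 \<omega>))
          \<partial>completion (law R i)) = (\<integral>\<^sup>+e. first_payoff U x f e \<partial>first_law i)" (is "?L = _")
proof -
  have fm [measurable]: "borel_strat f" using r by (simp add: represents_def adm_def)
  define F where "F e = (if dest e \<in> {1..n + 1} then pay (first_path f) (ereal (hold e)) +
     ennreal (exp (- \<delta> * hold e)) * U (dest e) (x + c * hold e - first_path f (hold e)) else 0)" for e
  have F [measurable]: "F \<in> borel_measurable mark_space"
    unfolding F_def
  proof (rule dest_measurable_compose)
    fix z assume "z \<in> {1..n + 1}"
    note [measurable] = U[OF this]
    show "(\<lambda>e. pay (first_path f) (ereal (hold e)) + ennreal (exp (- \<delta> * hold e)) * U z (x + c * hold e - first_path f (hold e))) \<in> borel_measurable mark_space"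
      by measurable
  qed
  have F_eq: "F e = first_payoff U x f e" if "good_mark j e" for j e
    using that by (simp add: F_def first_payoff_def good_mark_def)
  have "?L = (\<integral>\<^sup>+ \<omega>. F (shd (marks \<omega>)) \<partial>law R i)"
    unfolding nn_integral_completion
  proof (rule nn_integral_cong_AE, use r[unfolded represents_def, THEN conjunct2] in eventually_elim)
    case (elim \<omega>)
    then have nice: "nice i \<omega>" and fe: "feasible (\<lambda>t. D t \<omega>) x (marks \<omega>)" and eq: "\<And>t. 0 \<le> t \<Longrightarrow> D t \<omega> = strat_path f (marks \<omega>) t" by auto
    let ?e = "shd (marks \<omega>)"
    have pr: "proper (?e ## stl (marks \<omega>))" using nice_proper[OF nice] by simp
    have gm: "good_mark (phase R 0 \<omega>) ?e" using nice_good_mark[OF nice, of 0] by simp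
    then have s: "0 < hold ?e" by (simp add: good_mark_def)
    have eq1: "D t \<omega> = first_path f t" if "0 \<le> t" "t \<le> hold ?e" for t
      using eq[OF that(1)] strat_path_first[OF pr that(2), of f] by simp
    have "discounted_dividends R D (ereal (hold ?e)) \<omega> = pay (\<lambda>t. D t \<omega>) (ereal (hold ?e))"
      using s by (intro discounted_dividends_eq_pay[where D = D, OF feasible_regular[OF fe]]) simp
    also have "\<dots> = pay (first_path f) (ereal (hold ?e))" using s eq1 by (intro pay_cong_upto) auto
    finally have "discounted_dividends R D (ereal (hold ?e)) \<omega> = pay (first_path f) (ereal (hold ?e))" .
    then show ?case
      using first_jump[OF nice] eq1[of "hold ?e"] s F_eq[OF gm] by (simp add: Let_def first_payoff_def)
  qed
  also have "\<dots> = (\<integral>\<^sup>+h. F (shd h) \<partial>path_law i)"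
    unfolding path_law_distr[OF i] by (rule nn_integral_distr[symmetric, OF marks_measurable[OF i]]) measurable
  also have "\<dots> = (\<integral>\<^sup>+e. \<integral>\<^sup>+h. F (shd (e ## h)) \<partial>path_law (next_phase e) \<partial>first_law i)"
    by (rule nn_integral_path_law[OF i]) measurable
  also have "\<dots> = (\<integral>\<^sup>+e. F e \<partial>first_law i)"
    by (intro nn_integral_cong) (simp add: prob_space.emeasure_space_1[OF prob_space_path_law, simplified])
  also have "\<dots> = (\<integral>\<^sup>+e. first_payoff U x f e \<partial>first_law i)"
    by (rule nn_integral_cong_AE, use AE_good_mark[OF i] in eventually_elim) (rule F_eq)
  finally show ?thesis .
qed

lemma phase_iterate_eq:
  assumes i: "i \<in> {1..n}" and U: "\<And>z. z \<in> {1..n + 1} \<Longrightarrow> U z \<in> borel_measurable borel"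
  shows "phase_iterate R U i x = opt_step U i x"
  unfolding phase_iterate_def opt_step_def
proof (rule antisym)
  let ?I = "\<lambda>D. \<integral>\<^sup>+ \<omega>. (let \<tau>1 = first_jump_time R \<omega> in
                 discounted_dividends R D (ereal \<tau>1) \<omega> +
                 ennreal (exp (- discount R * \<tau>1)) *
                   U (absorbed_process R \<tau>1 \<omega>) (x + premium R * \<tau>1 - D \<tau>1 \<omega>))
          \<partial>completion (law R i)"
  show "(SUP D\<in>{D. admissible R i x D}. ?I D) \<le> (SUP f\<in>{f. adm i x f}. \<integral>\<^sup>+e. first_payoff U x f e \<partial>first_law i)"
  proof (rule SUP_mono)
    fix D assume "D \<in> {D. admissible R i x D}"
    then obtain f where f: "represents i x D f" using admissible_represented[OF i] by blast
    then show "\<exists>f\<in>{f. adm i x f}. ?I D \<le> (\<integral>\<^sup>+e. first_payoff U x f e \<partial>first_law i)"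
      using eq_refl[OF first_payoff_eq[where U = U, OF i f U]] by (intro bexI[of _ f]) (simp_all only: represents_def mem_Collect_eq)
  qed
  show "(SUP f\<in>{f. adm i x f}. \<integral>\<^sup>+e. first_payoff U x f e \<partial>first_law i) \<le> (SUP D\<in>{D. admissible R i x D}. ?I D)"
  proof (rule SUP_mono)
    fix f assume "f \<in> {f. adm i x f}"
    then obtain D where D: "admissible R i x D" "represents i x D f" using adm_represents[OF i] by blast
    then show "\<exists>D\<in>{D. admissible R i x D}. (\<integral>\<^sup>+e. first_payoff U x f e \<partial>first_law i) \<le> ?I D"
      using eq_refl[OF first_payoff_eq[where U = U, OF i D(2) U, symmetric]] by (intro bexI[of _ D]) (simp_all only: mem_Collect_eq)
  qed
qed

text \<open>At \<open>n + 1\<close> the iterate is built from the phase iterates of the same stage,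
  just as in \<open>extended_value\<close>, so the work is in the phases. At stage 0 the average of
  the zero function is 0.\<close>

lemma value_iterate_eq: "z \<in> {1..n + 1} \<Longrightarrow> value_iterate R k z = extended_value (iter k) z"
proof (induction k arbitrary: z)
  case 0
  show ?case by (rule ext) (simp add: extended_value_def claim_iterate_def)
next
  case (Suc k)
  have m: "value_iterate R k z \<in> borel_measurable borel" if "z \<in> {1..n + 1}" for z
    unfolding Suc.IH[OF that] by (rule extended_value_measurable[OF iter_measurable that])
  have ph: "phase_iterate R (value_iterate R k) i x = iter (Suc k) i x" if i: "i \<in> {1..n}" for i x
  proof -
    have "(\<integral>\<^sup>+e. first_payoff (value_iterate R k) x f e \<partial>first_law i) = (\<integral>\<^sup>+e. first_payoff (extended_value (iter k)) x f e \<partial>first_law i)" for f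
    proof (rule nn_integral_cong_AE, use AE_good_mark[OF i] in eventually_elim)
      case (elim e)
      then have "dest e \<in> {1..n + 1}" by (simp add: good_mark_def)
      from Suc.IH[OF this] show ?case by (simp add: first_payoff_def)
    qed
    then have "opt_step (value_iterate R k) i x = iter (Suc k) i x"
      unfolding iter.simps opt_step_def by (simp only:)
    moreover have "phase_iterate R (value_iterate R k) i x = opt_step (value_iterate R k) i x"
      by (rule phase_iterate_eq[OF i m])
    ultimately show ?thesis by simp
  qed
  show ?case
  proof (cases "z = claim_state")
    case True
    have "claim_iterate R (phase_iterate R (value_iterate R k)) x = claim_iterate R (iter (Suc k)) x" for x
      by (intro antisym claim_iterate_mono) (simp_all only: ph order_refl)
    then show ?thesis using True by (auto simp: extended_value_def claim_state_def fun_eq_iff)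
  next
    case False
    then have "z \<in> {1..n}" using Suc.prems by (auto simp: claim_state_def)
    from ph[OF this] False show ?thesis by (simp add: extended_value_def claim_state_def fun_eq_iff)
  qed
qed

theorem value_iterate_tendsto:
  assumes i: "i \<in> {1..n}"
  shows "(\<lambda>k. value_iterate R k i x) \<longlonglongrightarrow> optimal_value R i x"
proof -
  have "value_iterate R k i x = iter k i x" for k
    using i value_iterate_eq[of i k] by (auto simp: extended_value_def claim_state_def)
  then show ?thesis using iter_tendsto_opt_val[OF i] by (simp add: optimal_value_eq[OF i])
qed

end

theorem proposition5p2:
  fixes R :: "'a risk_model" and i :: nat and x :: real
  assumes "phase_type_risk_model R"
    and "num_phases R \<ge> 3"
    and "i \<in> {1..num_phases R}"
    and "x \<ge> 0"
  shows "(\<lambda>k. value_iterate R k i x) \<longlonglongrightarrow> optimal_value R i x"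
  using risk.value_iterate_tendsto[OF risk.intro[OF assms(1)] assms(3)] .

end
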